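(* Let $R$ be a commutative ring, let $n\ge 1$ be an integer, let $S=R[X_0,\ldots,X_n]_{\mathbb{Q}}$ and $X=\operatorname{Proj} S$. Then: 1. There is an isomorphism $S\simeq \bigoplus_{m\in\mathbb{Q}} H^0(X,\mathcal{O}_X(m))$ of graded $R$-modules. 2. $H^n(X,\mathcal{O}_{X}(-n-1))$ is a free $R$-module of infinite rank.
   Context: $R[X_0,\ldots,X_n]_{\mathbb{Q}}$ is the ring of polynomials with rational degree: the union over $i\ge1$ of $R[X_0,X_0^{1/2},\ldots,X_0^{1/i},\ldots,X_n,X_n^{1/2},\ldots,X_n^{1/i}]$ with formally adjoined compatible roots; equivalently, the ring of finite $R$-linear combinations of monomials $X_0^{r_0}\cdots X_n^{r_n}$, $r_j\in\mathbb{Q}_{\ge0}$, with exponents adding under multiplication. It is graded by $\mathbb{Q}_{\ge 0}$: $S=\bigoplus_{d\in\mathbb{Q}_{\ge0}}S_d$, where $S_d$ is the $R$-span of monomials with $r_0+\cdots+r_n=d$ (and $S_d=0$ for $d<0$). $\operatorname{Proj} S$ is the set of homogeneous prime ideals of $S$ not containing $S_+=\bigoplus_{d>0}S_d$, with closed sets $V_+(I)=\{\mathfrak{p}: I\subseteq\mathfrak{p}\}$ for homogeneous ideals $I$, and with its scheme structure, for which the sets $D_+(f)$ ($f$ homogeneous of positive degree) of primes not containing $f$ are affine open, $D_+(f)=\operatorname{Spec}$ of the degree-zero part of $S_f$ (localization at $\{1,f,f^2,\ldots\}$). For $m\in\mathbb{Q}$, $S(m)$ is the $\mathbb{Q}$-graded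 $S$-module with $S(m)_d=S_{m+d}$ for $d\in\mathbb{Q}$, and $\mathcal{O}_X(m)$ is the associated quasi-coherent sheaf $\widetilde{S(m)}$ on $X$, whose sections over $D_+(f)$ are the degree-zero elements of $S(m)_f$, i.e. the degree-$m$ elements of $S_f$. Cohomology is sheaf cohomology, computed by the Čech complex of the affine cover $\{D_+(X_i)\}_{0\le i\le n}$. *)

theory Defs
  imports Complex_Main "HOL-Algebra.Module" "HOL-Algebra.Ideal"
begin

section \<open>Modules over a commutative ring\<close>

text \<open>
  Modules are records of type \<^typ>\<open>('a, 'b) module\<close>. The fields \<open>mult\<close> and \<open>one\<close> play no role
  in \<^const>\<open>module\<close>; they are left undefined for modules that carry no multiplication.
\<close>

definition self_module :: "('a, 'r) ring_scheme \<Rightarrow> ('a, 'a) module" where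
  "self_module R =
    \<lparr>carrier = carrier R, mult = mult R, one = one R, zero = zero R, add = add R, smult = mult R\<rparr>"

definition direct_prod :: "'i set \<Rightarrow> ('i \<Rightarrow> ('a, 'b) module) \<Rightarrow> ('a, 'i \<Rightarrow> 'b) module" where
  "direct_prod I M =
    \<lparr>carrier = (\<Pi>\<^sub>E i\<in>I. carrier (M i)), mult = undefined, one = undefined,
     zero = (\<lambda>i\<in>I. \<zero>\<^bsub>M i\<^esub>),
     add = (\<lambda>x y. \<lambda>i\<in>I. x i \<oplus>\<^bsub>M i\<^esub> y i),
     smult = (\<lambda>c x. \<lambda>i\<in>I. c \<odot>\<^bsub>M i\<^esub> x i)\<rparr>"

definition direct_sum :: "'i set \<Rightarrow> ('i \<Rightarrow> ('a, 'b) module) \<Rightarrow> ('a, 'i \<Rightarrow> 'b) module" where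
  "direct_sum I M =
    (direct_prod I M)\<lparr>carrier :=
      {x \<in> carrier (direct_prod I M). finite {i \<in> I. x i \<noteq> \<zero>\<^bsub>M i\<^esub>}}\<rparr>"

definition quot_module :: "('a, 'b) module \<Rightarrow> 'b set \<Rightarrow> ('a, 'b set) module" where
  "quot_module M N =
    \<lparr>carrier = a_rcosets\<^bsub>M\<^esub> N, mult = undefined, one = undefined,
     zero = N, add = set_add M,
     smult = (\<lambda>c K. \<Union>x\<in>K. N +>\<^bsub>M\<^esub> (c \<odot>\<^bsub>M\<^esub> x))\<rparr>"

definition module_iso :: "('a, 'r) ring_scheme \<Rightarrow> ('a, 'b) module \<Rightarrow> ('a, 'c) module \<Rightarrow> ('b \<Rightarrow> 'c) set"
  where
  "module_iso R M N =
    {h. module R M \<and> module R N \<and> bij_betw h (carrier M) (carrier N) \<and>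
        (\<forall>x\<in>carrier M. \<forall>y\<in>carrier M. h (x \<oplus>\<^bsub>M\<^esub> y) = h x \<oplus>\<^bsub>N\<^esub> h y) \<and>
        (\<forall>c\<in>carrier R. \<forall>x\<in>carrier M. h (c \<odot>\<^bsub>M\<^esub> x) = c \<odot>\<^bsub>N\<^esub> h x)}"

text \<open>A grading of a module is a family of subsets of its carrier, indexed by the degrees.\<close>

definition graded_module_iso ::
  "('a, 'r) ring_scheme \<Rightarrow> ('a, 'b) module \<Rightarrow> (rat \<Rightarrow> 'b set) \<Rightarrow>
   ('a, 'c) module \<Rightarrow> (rat \<Rightarrow> 'c set) \<Rightarrow> ('b \<Rightarrow> 'c) set" where
  "graded_module_iso R M G N H = {h \<in> module_iso R M N. \<forall>d. h ` G d = H d}"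

definition direct_sum_grading :: "(rat \<Rightarrow> ('a, 'b) module) \<Rightarrow> rat \<Rightarrow> (rat \<Rightarrow> 'b) set" where
  "direct_sum_grading M d =
    {x \<in> carrier (direct_sum UNIV M). \<forall>e. e \<noteq> d \<longrightarrow> x e = \<zero>\<^bsub>M e\<^esub>}"

text \<open>
  \<open>M\<close> is isomorphic to a direct sum of infinitely many copies of \<open>R\<close>. Taking the index set in the
  type of the elements of \<open>M\<close> is no restriction when that type is infinite: if \<open>R\<close> is not the zero
  ring, a basis of \<open>M\<close> injects into the carrier of \<open>M\<close>.
\<close>

definition free_of_infinite_rank :: "('a, 'r) ring_scheme \<Rightarrow> ('a, 'b) module \<Rightarrow> bool" where
  "free_of_infinite_rank R M \<longleftrightarrow>
    (\<exists>I :: 'b set. infinite I \<and> module_iso R (direct_sum I (\<lambda>_. self_module R)) M \<noteq> {})"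


section \<open>Polynomials with rational degree\<close>

text \<open>
  The monomial \<open>X\<^sub>0^(r 0) \<cdots> X\<^sub>n^(r n)\<close> is represented by its exponent vector \<open>r\<close>, padded by zeros,
  and a polynomial by its function of coefficients.
\<close>

definition exponents :: "nat \<Rightarrow> (nat \<Rightarrow> rat) set" where
  "exponents n = {r. (\<forall>i\<le>n. 0 \<le> r i) \<and> (\<forall>i>n. r i = 0)}"

definition qpoly_ring :: "('a, 'r) ring_scheme \<Rightarrow> nat \<Rightarrow> ('a, (nat \<Rightarrow> rat) \<Rightarrow> 'a) module" where
  "qpoly_ring R n =
    \<lparr>carrier = {p. range p \<subseteq> carrier R \<and> finite {r. p r \<noteq> \<zero>\<^bsub>R\<^esub>} \<and> {r. p r \<noteq> \<zero>\<^bsub>R\<^esub>} \<subseteq> exponents n},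
     mult = (\<lambda>p q r. \<Oplus>\<^bsub>R\<^esub>s\<in>{s. p s \<noteq> \<zero>\<^bsub>R\<^esub>}. p s \<otimes>\<^bsub>R\<^esub> q (\<lambda>i. r i - s i)),
     one = (\<lambda>r. if r = (\<lambda>_. 0) then \<one>\<^bsub>R\<^esub> else \<zero>\<^bsub>R\<^esub>),
     zero = (\<lambda>r. \<zero>\<^bsub>R\<^esub>),
     add = (\<lambda>p q r. p r \<oplus>\<^bsub>R\<^esub> q r),
     smult = (\<lambda>c p r. c \<otimes>\<^bsub>R\<^esub> p r)\<rparr>"

definition qpoly_var :: "('a, 'r) ring_scheme \<Rightarrow> nat \<Rightarrow> (nat \<Rightarrow> rat) \<Rightarrow> 'a" where
  "qpoly_var R i = (\<lambda>r. if r = (\<lambda>j. if j = i then 1 else 0) then \<one>\<^bsub>R\<^esub> else \<zero>\<^bsub>R\<^esub>)"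

definition qpoly_grading :: "('a, 'r) ring_scheme \<Rightarrow> nat \<Rightarrow> rat \<Rightarrow> ((nat \<Rightarrow> rat) \<Rightarrow> 'a) set" where
  "qpoly_grading R n d =
    {p \<in> carrier (qpoly_ring R n). \<forall>r. p r \<noteq> \<zero>\<^bsub>R\<^esub> \<longrightarrow> (\<Sum>i\<le>n. r i) = d}"


section \<open>The space \<open>Proj\<close> of a graded ring\<close>

text \<open>
  In this and the next section \<open>S\<close> is an \<open>R\<close>-algebra with a grading \<open>G\<close> by \<^typ>\<open>rat\<close>, concentrated in
  nonnegative degrees.
\<close>

definition homogeneous_ideal :: "('a, 's) module \<Rightarrow> (rat \<Rightarrow> 's set) \<Rightarrow> 's set \<Rightarrow> bool" where
  "homogeneous_ideal S G I \<longleftrightarrow> ideal I S \<and> genideal S (I \<inter> (\<Union>d. G d)) = I"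

definition irrelevant_ideal :: "('a, 's) module \<Rightarrow> (rat \<Rightarrow> 's set) \<Rightarrow> 's set" where
  "irrelevant_ideal S G =
    {(\<Oplus>\<^bsub>S\<^esub>d\<in>D. f d) | D f. finite D \<and> D \<subseteq> {0<..} \<and> f \<in> (\<Pi> d\<in>D. G d)}"

definition Proj :: "('a, 's) module \<Rightarrow> (rat \<Rightarrow> 's set) \<Rightarrow> 's set set" where
  "Proj S G = {P. primeideal P S \<and> homogeneous_ideal S G P \<and> \<not> irrelevant_ideal S G \<subseteq> P}"

definition V_plus :: "('a, 's) module \<Rightarrow> (rat \<Rightarrow> 's set) \<Rightarrow> 's set \<Rightarrow> 's set set" where
  "V_plus S G I = {P \<in> Proj S G. I \<subseteq> P}"

definition D_plus :: "('a, 's) module \<Rightarrow> (rat \<Rightarrow> 's set) \<Rightarrow> 's \<Rightarrow> 's set set" where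
  "D_plus S G f = {P \<in> Proj S G. f \<notin> P}"

definition Proj_open :: "('a, 's) module \<Rightarrow> (rat \<Rightarrow> 's set) \<Rightarrow> 's set set \<Rightarrow> bool" where
  "Proj_open S G U \<longleftrightarrow> (\<exists>I. homogeneous_ideal S G I \<and> U = Proj S G - V_plus S G I)"


section \<open>Twisting sheaves\<close>

text \<open>
  The stalk of \<open>O(m)\<close> at \<open>P\<close> is the degree-zero part of the localization of \<open>S(m)\<close> at the homogeneous
  elements outside \<open>P\<close>: its elements are the fractions \<open>a / f\<close> with \<open>f\<close> homogeneous of some degree \<open>d\<close>,
  outside \<open>P\<close>, and \<open>a\<close> in \<open>S(m)\<^sub>d\<close>. The grading of \<open>S(m)\<close> is \<^term>\<open>shift G m\<close>.
\<close>

definition shift :: "(rat \<Rightarrow> 's set) \<Rightarrow> rat \<Rightarrow> rat \<Rightarrow> 's set" where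
  "shift G m d = G (m + d)"

definition fractions_at :: "(rat \<Rightarrow> 's set) \<Rightarrow> rat \<Rightarrow> 's set \<Rightarrow> ('s \<times> 's) set" where
  "fractions_at G m P = (\<Union>d. shift G m d \<times> (G d - P))"

definition hfrac ::
  "('a, 's) module \<Rightarrow> (rat \<Rightarrow> 's set) \<Rightarrow> rat \<Rightarrow> 's set \<Rightarrow> 's \<Rightarrow> 's \<Rightarrow> ('s \<times> 's) set" where
  "hfrac S G m P a f =
    {(b, g) \<in> fractions_at G m P.
       \<exists>h \<in> (\<Union>d. G d) - P. h \<otimes>\<^bsub>S\<^esub> (g \<otimes>\<^bsub>S\<^esub> a) = h \<otimes>\<^bsub>S\<^esub> (f \<otimes>\<^bsub>S\<^esub> b)}"

text \<open>Sums and scalar multiples are defined as unions over all choices of representatives.\<close>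

definition twist_stalk ::
  "('a, 's) module \<Rightarrow> (rat \<Rightarrow> 's set) \<Rightarrow> rat \<Rightarrow> 's set \<Rightarrow> ('a, ('s \<times> 's) set) module" where
  "twist_stalk S G m P =
    \<lparr>carrier = {hfrac S G m P a f | a f. (a, f) \<in> fractions_at G m P},
     mult = undefined, one = undefined,
     zero = hfrac S G m P \<zero>\<^bsub>S\<^esub> \<one>\<^bsub>S\<^esub>,
     add = (\<lambda>x y. \<Union>(a, f)\<in>x. \<Union>(b, g)\<in>y.
              hfrac S G m P (g \<otimes>\<^bsub>S\<^esub> a \<oplus>\<^bsub>S\<^esub> f \<otimes>\<^bsub>S\<^esub> b) (f \<otimes>\<^bsub>S\<^esub> g)),
     smult = (\<lambda>c x. \<Union>(a, f)\<in>x. hfrac S G m P (c \<odot>\<^bsub>S\<^esub> a) f)\<rparr>"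

text \<open>
  Sections over \<open>U\<close> are families of stalk elements that are locally given by a single fraction;
  the restriction maps are the restrictions of functions.
\<close>

definition twist_sheaf ::
  "('a, 's) module \<Rightarrow> (rat \<Rightarrow> 's set) \<Rightarrow> rat \<Rightarrow> 's set set \<Rightarrow> ('a, 's set \<Rightarrow> ('s \<times> 's) set) module" where
  "twist_sheaf S G m U =
    (direct_prod U (twist_stalk S G m))\<lparr>carrier :=
      {s \<in> carrier (direct_prod U (twist_stalk S G m)).
        \<forall>P\<in>U. \<exists>V a f. Proj_open S G V \<and> P \<in> V \<and> V \<subseteq> U \<and>
          (\<forall>Q\<in>V. (a, f) \<in> fractions_at G m Q \<and> s Q = hfrac S G m Q a f)}\<rparr>"


section \<open>Cech cohomology\<close>

text \<open>
  \<open>F\<close> is a sheaf of \<open>R\<close>-modules of functions, as above, and \<open>U 0, \<dots>, U n\<close> is an open cover. An index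
  tuple \<open>i\<^sub>0 < \<cdots> < i\<^sub>p\<close> is represented by the set of its entries.
\<close>

definition cech_simplices :: "nat \<Rightarrow> nat \<Rightarrow> nat set set" where
  "cech_simplices n p = {\<sigma>. \<sigma> \<subseteq> {..n} \<and> card \<sigma> = Suc p}"

definition cech_cochains ::
  "('x set \<Rightarrow> ('a, 'x \<Rightarrow> 'y) module) \<Rightarrow> (nat \<Rightarrow> 'x set) \<Rightarrow> nat \<Rightarrow> nat \<Rightarrow>
   ('a, nat set \<Rightarrow> 'x \<Rightarrow> 'y) module" where
  "cech_cochains F U n p = direct_prod (cech_simplices n p) (\<lambda>\<sigma>. F (\<Inter>i\<in>\<sigma>. U i))"

definition cech_diff ::
  "('x set \<Rightarrow> ('a, 'x \<Rightarrow> 'y) module) \<Rightarrow> (nat \<Rightarrow> 'x set) \<Rightarrow> nat \<Rightarrow> nat \<Rightarrow>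
   (nat set \<Rightarrow> 'x \<Rightarrow> 'y) \<Rightarrow> (nat set \<Rightarrow> 'x \<Rightarrow> 'y)" where
  "cech_diff F U n p c =
    (\<lambda>\<sigma>\<in>cech_simplices n (Suc p).
      let W = (\<Inter>i\<in>\<sigma>. U i) in
      \<Oplus>\<^bsub>F W\<^esub>i\<in>\<sigma>.
        let s = restrict (c (\<sigma> - {i})) W
        in if even (card {j \<in> \<sigma>. j < i}) then s else \<ominus>\<^bsub>F W\<^esub> s)"

definition cech_cocycles ::
  "('x set \<Rightarrow> ('a, 'x \<Rightarrow> 'y) module) \<Rightarrow> (nat \<Rightarrow> 'x set) \<Rightarrow> nat \<Rightarrow> nat \<Rightarrow>
   ('a, nat set \<Rightarrow> 'x \<Rightarrow> 'y) module" where
  "cech_cocycles F U n p =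
    (cech_cochains F U n p)\<lparr>carrier :=
      a_kernel (cech_cochains F U n p) (cech_cochains F U n (Suc p)) (cech_diff F U n p)\<rparr>"

definition cech_coboundaries ::
  "('x set \<Rightarrow> ('a, 'x \<Rightarrow> 'y) module) \<Rightarrow> (nat \<Rightarrow> 'x set) \<Rightarrow> nat \<Rightarrow> nat \<Rightarrow>
   (nat set \<Rightarrow> 'x \<Rightarrow> 'y) set" where
  "cech_coboundaries F U n p =
    (case p of 0 \<Rightarrow> {\<zero>\<^bsub>cech_cochains F U n 0\<^esub>}
     | Suc q \<Rightarrow> cech_diff F U n q ` carrier (cech_cochains F U n q))"

definition cech_cohomology ::
  "('x set \<Rightarrow> ('a, 'x \<Rightarrow> 'y) module) \<Rightarrow> (nat \<Rightarrow> 'x set) \<Rightarrow> nat \<Rightarrow> nat \<Rightarrow>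
   ('a, (nat set \<Rightarrow> 'x \<Rightarrow> 'y) set) module" where
  "cech_cohomology F U n p = quot_module (cech_cocycles F U n p) (cech_coboundaries F U n p)"

text \<open>
  \<open>H\<^sup>p(X, O\<^sub>X(m))\<close> for \<open>X = Proj R[X\<^sub>0, \<dots>, X\<^sub>n]\<^sub>\<rat>\<close>, by the affine cover \<open>D\<^sub>+(X\<^sub>0), \<dots>, D\<^sub>+(X\<^sub>n)\<close>.
\<close>

definition H_twist ::
  "('a, 'r) ring_scheme \<Rightarrow> nat \<Rightarrow> nat \<Rightarrow> rat \<Rightarrow>
   ('a, (nat set \<Rightarrow> ((nat \<Rightarrow> rat) \<Rightarrow> 'a) set \<Rightarrow>
         (((nat \<Rightarrow> rat) \<Rightarrow> 'a) \<times> ((nat \<Rightarrow> rat) \<Rightarrow> 'a)) set) set) module" where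
  "H_twist R n p m =
    cech_cohomology
      (twist_sheaf (qpoly_ring R n) (qpoly_grading R n) m)
      (\<lambda>i. D_plus (qpoly_ring R n) (qpoly_grading R n) (qpoly_var R i)) n p"

end

(*
  On D+(X_i : i in sigma) the sections of O(m) are the Laurent polynomials of degree m whose
  exponents are nonnegative outside sigma. As for every affine scheme, this comes down to a partition
  of unity: a section is given by finitely many fractions a_k / k, after passing to powers these
  satisfy a_k l = a_l k, and a power of the product of the X_i lies in the ideal of the k because no
  homogeneous prime ideal contains all of them without containing the product. In the Cech complex a
  0-cocycle is then a Laurent polynomial all of whose exponents are nonnegative (this needs two
  variables), and the top coboundaries are spanned by the monomials with at least one nonnegative
  exponent. So H^n has as basis the monomials with all exponents negative; in degree -n-1 there are
  infinitely many of them, since the exponents are rational.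
*)

theory Submission
  imports Defs "HOL-Algebra.Multiplicative_Group" "HOL-Library.Countable_Set"
begin

section \<open>Homogeneous prime ideals\<close>

text \<open>\<open>S\<close> need not be noetherian, and sections are families of germs at
  homogeneous primes, not elements of localizations. Everything about sections on D_+(f) is
  therefore drawn from one existence statement: if no power of \<open>f\<close> lies in the ideal of
  a set of homogeneous elements, Zorn's lemma supplies a point of Proj that contains the set but not
  \<open>f\<close>. Applied to annihilators, it shows that a locally vanishing element is killed by
  a power of \<open>f\<close>; applied to denominators, it gives compactness of D_+(f). Rational
  degrees do no harm: an element has finitely many components \<open>comp d x\<close>, so
  leading-term arguments still have a largest degree to look at. Monomials cancel in Laurent
  polynomials whatever zero divisors \<open>R\<close> has, so when \<open>f\<close> is a monomial,
  being killed by a power of \<open>f\<close> means being zero. In Cech degrees 0 and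
  \<open>n\<close> every cocycle is given by one and the same Laurent polynomial on all simplices,
  hence both cohomology modules are instances of a single quotient: Laurent polynomials on a set of
  exponents modulo those on a subset.\<close>

locale graded_ring = cring S for S :: "('a, 's) module" (structure) +
  fixes G :: "rat \<Rightarrow> 's set" and comp :: "rat \<Rightarrow> 's \<Rightarrow> 's"
  assumes G_subset: "G d \<subseteq> carrier S"
    and one_G: "\<one> \<in> G 0"
    and G_neg: "d < 0 \<Longrightarrow> G d \<subseteq> {\<zero>}"
    and comp_G: "x \<in> carrier S \<Longrightarrow> comp d x \<in> G d"
    and comp_of_G: "x \<in> G d \<Longrightarrow> comp e x = (if e = d then x else \<zero>)"
    and comp_add: "x \<in> carrier S \<Longrightarrow> y \<in> carrier S \<Longrightarrow> comp d (x \<oplus> y) = comp d x \<oplus> comp d y"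
    and comp_mult: "x \<in> G d \<Longrightarrow> y \<in> carrier S \<Longrightarrow> comp e (x \<otimes> y) = x \<otimes> comp (e - d) y"
    and comp_finite: "x \<in> carrier S \<Longrightarrow> finite {d. comp d x \<noteq> \<zero>}"
    and comp_sum: "x \<in> carrier S \<Longrightarrow> x = (\<Oplus>d\<in>{d. comp d x \<noteq> \<zero>}. comp d x)"
begin

lemma G_carrier [intro]: "x \<in> G d \<Longrightarrow> x \<in> carrier S"
  using G_subset by blast

lemma comp_closed [simp, intro]: "x \<in> carrier S \<Longrightarrow> comp d x \<in> carrier S"
  using comp_G by blast

lemma comp_zero [simp]: "comp d \<zero> = \<zero>"
  using comp_add[of \<zero> \<zero> d] by simp

lemma mem_G_iff: "x \<in> G d \<longleftrightarrow> x \<in> carrier S \<and> comp d x = x"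
  using comp_of_G[of x d d] comp_G[of x d] G_carrier[of x d] by auto

lemma zero_G [simp, intro]: "\<zero> \<in> G d"
  by (simp add: mem_G_iff)

lemma add_G [intro]: "x \<in> G d \<Longrightarrow> y \<in> G d \<Longrightarrow> x \<oplus> y \<in> G d"
  by (simp add: mem_G_iff comp_add)

lemma mult_G: "x \<in> G d \<Longrightarrow> y \<in> G e \<Longrightarrow> x \<otimes> y \<in> G (d + e)"
  using comp_mult[of x d y "d + e"] by (simp add: mem_G_iff)

lemma pow_G: "x \<in> G d \<Longrightarrow> x [^] (k::nat) \<in> G (of_nat k * d)"
proof (induction k)
  case (Suc k)
  then show ?case
    using mult_G[of "x [^] k" "of_nat k * d" x d] by (simp add: algebra_simps)
qed (simp add: one_G)

lemma comp_finsum: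
  assumes "finite A" "f \<in> A \<rightarrow> carrier S"
  shows "comp d (\<Oplus>i\<in>A. f i) = (\<Oplus>i\<in>A. comp d (f i))"
  using assms
proof (induction A rule: finite_induct)
  case (insert a A)
  then have "f a \<in> carrier S" "f \<in> A \<rightarrow> carrier S" by auto
  then show ?case
    using insert by (simp add: comp_add Pi_def)
qed simp

section \<open>Homogeneous elements and ideals that contain the components of their members\<close>

definition homogeneous :: "'s set" where "homogeneous = (\<Union>d. G d)"

lemma hom_carrier [intro]: "x \<in> homogeneous \<Longrightarrow> x \<in> carrier S"
  unfolding homogeneous_def by auto

lemma homI: "x \<in> G d \<Longrightarrow> x \<in> homogeneous"
  unfolding homogeneous_def by auto

lemma hom_mult: "x \<in> homogeneous \<Longrightarrow> y \<in> homogeneous \<Longrightarrow> x \<otimes> y \<in> homogeneous"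
  unfolding homogeneous_def using mult_G by blast

lemma one_hom: "\<one> \<in> homogeneous"
  using one_G homI by blast

lemma finsum_in_ideal:
  assumes "ideal I S" "finite A" "\<And>a. a \<in> A \<Longrightarrow> f a \<in> I"
  shows "(\<Oplus>a\<in>A. f a) \<in> I"
proof -
  interpret I: ideal I S by fact
  show ?thesis
    using assms(2,3)
  proof (induction A rule: finite_induct)
    case (insert a A)
    then have "f \<in> A \<rightarrow> carrier S" "f a \<in> carrier S" using I.a_subset by auto
    then show ?case
      using insert by simp
  qed simp
qed

lemma in_ideal_if_comps:
  assumes "ideal I S" "x \<in> carrier S" "\<And>d. comp d x \<in> I"
  shows "x \<in> I"
  by (subst comp_sum[OF assms(2)]) (rule finsum_in_ideal[OF assms(1) comp_finite[OF assms(2)] assms(3)])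

text \<open>The componentwise form of homogeneity. Generation by homogeneous elements, as in
  \<open>homogeneous_ideal\<close>, is awkward under unions of chains and sums of ideals; this form
  passes through both directly.\<close>

definition comp_closed_ideal :: "'s set \<Rightarrow> bool" where
  "comp_closed_ideal I \<longleftrightarrow> ideal I S \<and> (\<forall>x\<in>I. \<forall>d. comp d x \<in> I)"

text \<open>The elements all of whose components lie in the generated ideal themselves form an ideal
  containing \<open>T\<close>, so minimality of \<open>genideal\<close> applies.\<close>

lemma genideal_comp_closed:
  assumes T: "T \<subseteq> homogeneous"
  shows "comp_closed_ideal (genideal S T)"
proof -
  have Tc: "T \<subseteq> carrier S" using T by auto
  interpret I: ideal "genideal S T" S using genideal_ideal[OF Tc] .
  let ?J = "{x \<in> carrier S. \<forall>d. comp d x \<in> genideal S T}"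
  \<comment> \<open>The degree \<open>d\<close> component of \<open>b \<otimes> a\<close> is the sum
    over \<open>e\<close> of \<open>comp e b\<close> times \<open>comp (d - e) a\<close>.\<close>
  have J_mult: "a \<otimes> b \<in> ?J" if a: "a \<in> ?J" and b: "b \<in> carrier S" for a b
  proof -
    have "comp d (b \<otimes> a) \<in> genideal S T" for d
    proof -
      have "b \<otimes> a = (\<Oplus>e\<in>{e. comp e b \<noteq> \<zero>}. comp e b) \<otimes> a"
        using comp_sum[OF b] by simp
      also have "\<dots> = (\<Oplus>e\<in>{e. comp e b \<noteq> \<zero>}. comp e b \<otimes> a)"
        using a b by (intro finsum_ldistr comp_finite) auto
      finally have "comp d (b \<otimes> a) = (\<Oplus>e\<in>{e. comp e b \<noteq> \<zero>}. comp d (comp e b \<otimes> a))"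
        using a b by (simp add: comp_finsum comp_finite)
      also have "\<dots> \<in> genideal S T"
      proof (rule finsum_in_ideal[OF I.is_ideal comp_finite[OF b]])
        fix e
        have "comp d (comp e b \<otimes> a) = comp e b \<otimes> comp (d - e) a"
          using a b by (intro comp_mult comp_G) auto
        then show "comp d (comp e b \<otimes> a) \<in> genideal S T"
          using a b I.I_l_closed by simp
      qed
      finally show ?thesis .
    qed
    then show ?thesis using a b m_comm[of a b] by auto
  qed
  have "ideal ?J S"
  proof (rule idealI)
    show "ring S" by (rule ring_axioms)
    show "subgroup ?J (add_monoid S)"
    proof (rule add.subgroupI)
      fix a assume a: "a \<in> ?J"
      \<comment> \<open>Closure under negation is multiplication by -1.\<close>
      then have "a \<otimes> \<ominus> \<one> \<in> ?J" by (intro J_mult) auto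
      then show "\<ominus> a \<in> ?J" using a by (simp add: r_minus)
    next
      fix a b assume "a \<in> ?J" "b \<in> ?J"
      then show "a \<oplus> b \<in> ?J" by (auto simp: comp_add)
    next
      have "\<zero> \<in> ?J" by simp
      then show "?J \<noteq> {}" by blast
    qed auto
    fix a x assume "a \<in> ?J" "x \<in> carrier S"
    then show "a \<otimes> x \<in> ?J" "x \<otimes> a \<in> ?J"
      using J_mult[of a x] m_comm[of a x] by auto
  qed
  moreover have "T \<subseteq> ?J"
  proof
    fix t assume t: "t \<in> T"
    then obtain d where "t \<in> G d" using T unfolding homogeneous_def by blast
    then show "t \<in> ?J"
      using t genideal_self[OF Tc] by (auto simp: comp_of_G)
  qed
  ultimately have "genideal S T \<subseteq> ?J" by (rule genideal_minimal)
  then show ?thesis unfolding comp_closed_ideal_def using I.is_ideal by auto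
qed

text \<open>Each member is the sum of its components, which are homogeneous elements of
  \<open>I\<close>.\<close>

lemma comp_closed_imp_homogeneous:
  assumes "comp_closed_ideal I"
  shows "homogeneous_ideal S G I"
proof -
  interpret I: ideal I S using assms unfolding comp_closed_ideal_def by blast
  have sub: "I \<inter> homogeneous \<subseteq> carrier S" using I.a_subset by auto
  have "genideal S (I \<inter> homogeneous) \<subseteq> I"
    by (rule genideal_minimal[OF I.is_ideal]) auto
  moreover have "x \<in> genideal S (I \<inter> homogeneous)" if x: "x \<in> I" for x
  proof (rule in_ideal_if_comps[OF genideal_ideal[OF sub]])
    show xc: "x \<in> carrier S" using x I.a_subset by auto
    show "comp d x \<in> genideal S (I \<inter> homogeneous)" for d
      using assms x homI[OF comp_G[OF xc]] genideal_self[OF sub]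
      unfolding comp_closed_ideal_def by blast
  qed
  ultimately show ?thesis
    unfolding homogeneous_ideal_def homogeneous_def using I.is_ideal by blast
qed

text \<open>Leading-term argument: for \<open>x\<close> and \<open>y\<close> outside
  \<open>P\<close>, the product of their highest components outside \<open>P\<close> is, modulo
  \<open>P\<close>, a component of \<open>x \<otimes> y\<close>. Hence primality can be tested on
  homogeneous elements.\<close>

lemma comp_closed_prime:
  assumes P: "comp_closed_ideal P" and one: "\<one> \<notin> P"
    and prime: "\<And>x y. x \<in> homogeneous \<Longrightarrow> y \<in> homogeneous \<Longrightarrow> x \<otimes> y \<in> P \<Longrightarrow> x \<in> P \<or> y \<in> P"
  shows "primeideal P S"
proof (rule primeidealI)
  show idl: "ideal P S" using P unfolding comp_closed_ideal_def by blast
  then interpret P: ideal P S .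
  show "cring S" by (rule is_cring)
  show "carrier S \<noteq> P" using one by auto
  fix x y assume x: "x \<in> carrier S" and y: "y \<in> carrier S" and xy: "x \<otimes> y \<in> P"
  show "x \<in> P \<or> y \<in> P"
  proof (rule ccontr)
    assume contra: "\<not> (x \<in> P \<or> y \<in> P)"
    \<comment> \<open>Degrees are rational, but only finitely many components are nonzero, so
      \<open>A\<close> and \<open>B\<close> have maxima.\<close>
    define A where "A = {d. comp d x \<notin> P}"
    define B where "B = {d. comp d y \<notin> P}"
    have fin: "finite A" "finite B"
      unfolding A_def B_def
      by (rule finite_subset[OF _ comp_finite[OF x]], use P.zero_closed in auto)
        (rule finite_subset[OF _ comp_finite[OF y]], use P.zero_closed in auto)
    have ne: "A \<noteq> {}" "B \<noteq> {}"
      using in_ideal_if_comps[OF idl x] in_ideal_if_comps[OF idl y] contra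
      unfolding A_def B_def by auto
    define d where "d = Max A"
    define e where "e = Max B"
    have d: "comp d x \<notin> P" and e: "comp e y \<notin> P"
      using Max_in[OF fin(1) ne(1)] Max_in[OF fin(2) ne(2)] unfolding d_def e_def A_def B_def by auto
    have d_max: "comp i x \<in> P" if "i > d" for i
      using that Max_ge[OF fin(1), of i] unfolding d_def A_def by force
    have e_max: "comp i y \<in> P" if "i > e" for i
      using that Max_ge[OF fin(2), of i] unfolding e_def B_def by force
    let ?D = "{i. comp i x \<noteq> \<zero>}"
    \<comment> \<open>The summands of the degree \<open>d + e\<close> component of the product; the
      one with \<open>i = d\<close> is \<open>comp d x \<otimes> comp e y\<close>.\<close>
    let ?t = "\<lambda>i. comp i x \<otimes> comp (d + e - i) y"
    have finD: "finite ?D" by (rule comp_finite[OF x])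
    have dD: "d \<in> ?D" using d P.zero_closed by auto
    have "x \<otimes> y = (\<Oplus>i\<in>?D. comp i x) \<otimes> y"
      using comp_sum[OF x] by simp
    also have "\<dots> = (\<Oplus>i\<in>?D. comp i x \<otimes> y)"
      using x y by (intro finsum_ldistr finD) auto
    finally have "comp (d + e) (x \<otimes> y) = (\<Oplus>i\<in>?D. comp (d + e) (comp i x \<otimes> y))"
      using x y by (simp add: comp_finsum finD)
    also have "\<dots> = (\<Oplus>i\<in>?D. ?t i)"
      using x y by (intro finsum_cong' refl) (auto simp: comp_mult[OF comp_G])
    also have "\<dots> = (\<Oplus>i\<in>insert d (?D - {d}). ?t i)"
      using dD by (simp add: insert_absorb)
    also have "\<dots> = ?t d \<oplus> (\<Oplus>i\<in>?D - {d}. ?t i)"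
      using x y finD by (subst finsum_insert) auto
    finally have eq: "comp (d + e) (x \<otimes> y) = comp d x \<otimes> comp e y \<oplus> (\<Oplus>i\<in>?D - {d}. ?t i)"
      by simp
    have rest: "(\<Oplus>i\<in>?D - {d}. ?t i) \<in> P"
    proof (rule finsum_in_ideal[OF idl])
      fix i assume i: "i \<in> ?D - {d}"
      show "?t i \<in> P"
      proof (cases "i > d")
        case True
        then show ?thesis using d_max P.I_r_closed y by blast
      next
        case False
        \<comment> \<open>A smaller \<open>i\<close> pushes the partner degree above
          \<open>e\<close>, where the components of \<open>y\<close> lie in
          \<open>P\<close>.\<close>
        then have "d + e - i > e" using i by auto
        then show ?thesis using e_max P.I_l_closed x by blast
      qed
    qed (use finD in auto)
    have "comp (d + e) (x \<otimes> y) \<in> P"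
      using P xy unfolding comp_closed_ideal_def by blast
    then have "(comp d x \<otimes> comp e y \<oplus> (\<Oplus>i\<in>?D - {d}. ?t i)) \<ominus> (\<Oplus>i\<in>?D - {d}. ?t i) \<in> P"
      using P.a_closed[OF _ P.a_inv_closed[OF rest]] unfolding eq a_minus_def by blast
    moreover have "(\<Oplus>i\<in>?D - {d}. ?t i) \<in> carrier S"
      using rest P.a_subset by auto
    ultimately have "comp d x \<otimes> comp e y \<in> P"
      using x y by (simp add: a_minus_def a_assoc r_neg)
    then show False
      using prime homI[OF comp_G[OF x]] homI[OF comp_G[OF y]] d e by blast
  qed
qed

section \<open>Homogeneous ideals maximal with respect to avoiding the powers of an element\<close>

lemma G_deg_nonneg: "x \<in> G d \<Longrightarrow> x \<noteq> \<zero> \<Longrightarrow> 0 \<le> d"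
  using G_neg[of d] by force

text \<open>Stated for directed families because it serves both the chains in Zorn's lemma and the
  ideals generated by finite subsets of a given set.\<close>

lemma directed_Union_ideal:
  assumes "C \<noteq> {}" "\<And>I. I \<in> C \<Longrightarrow> ideal I S" "\<And>I J. I \<in> C \<Longrightarrow> J \<in> C \<Longrightarrow> \<exists>K\<in>C. I \<subseteq> K \<and> J \<subseteq> K"
  shows "ideal (\<Union>C) S"
proof (rule idealI)
  show "ring S" by (rule ring_axioms)
  show "subgroup (\<Union>C) (add_monoid S)"
  proof (rule add.subgroupI)
    show "\<Union>C \<subseteq> carrier S"
      using additive_subgroup.a_subset[OF ideal.axioms(1)[OF assms(2)]] by blast
    obtain I where "I \<in> C" using assms(1) by blast
    then show "\<Union>C \<noteq> {}"
      using additive_subgroup.zero_closed[OF ideal.axioms(1)[OF assms(2)]] by blast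
    fix a assume "a \<in> \<Union>C"
    then show "\<ominus> a \<in> \<Union>C"
      using additive_subgroup.a_inv_closed[OF ideal.axioms(1)[OF assms(2)]] by blast
  next
    fix a b assume "a \<in> \<Union>C" "b \<in> \<Union>C"
    then obtain K where "K \<in> C" "a \<in> K" "b \<in> K" using assms(3) by blast
    then show "a \<oplus> b \<in> \<Union>C"
      using additive_subgroup.a_closed[OF ideal.axioms(1)[OF assms(2)]] by blast
  qed
  fix a x assume "a \<in> \<Union>C" "x \<in> carrier S"
  then show "a \<otimes> x \<in> \<Union>C" "x \<otimes> a \<in> \<Union>C"
    using ideal.I_l_closed[OF assms(2)] ideal.I_r_closed[OF assms(2)] by blast+
qed

text \<open>The enlargement \<open>P + (a)\<close> remains closed under components because
  \<open>a\<close> has a single degree \<open>d\<close>: the degree \<open>e\<close> component of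
  \<open>b \<otimes> a\<close> is \<open>comp (e - d) b \<otimes> a\<close>.\<close>

lemma ideal_sum_cgenideal:
  assumes P: "comp_closed_ideal P" and a: "a \<in> homogeneous"
  defines "J \<equiv> {p \<oplus> b \<otimes> a | p b. p \<in> P \<and> b \<in> carrier S}"
  shows "comp_closed_ideal J" "P \<subseteq> J" "a \<in> J"
proof -
  interpret P: ideal P S using P unfolding comp_closed_ideal_def by blast
  have ac: "a \<in> carrier S" using a by auto
  have Pc: "p \<in> carrier S" if "p \<in> P" for p using that P.a_subset by auto
  obtain d where d: "a \<in> G d" using a unfolding homogeneous_def by auto
  have "J = P <+>\<^bsub>S\<^esub> (PIdl a)"
    unfolding J_def set_add_def' cgenideal_def by auto
  then have idl: "ideal J S" using add_ideals[OF P.is_ideal cgenideal_ideal[OF ac]] by simp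
  show "P \<subseteq> J"
  proof
    fix p assume "p \<in> P"
    moreover from this have "p = p \<oplus> \<zero> \<otimes> a" using ac Pc by simp
    ultimately show "p \<in> J" unfolding J_def by blast
  qed
  have "a = \<zero> \<oplus> \<one> \<otimes> a" using ac by simp
  then show "a \<in> J" unfolding J_def using P.zero_closed one_closed by blast
  have "comp e x \<in> J" if "x \<in> J" for x e
  proof -
    obtain p b where pb: "p \<in> P" "b \<in> carrier S" "x = p \<oplus> b \<otimes> a" using \<open>x \<in> J\<close> unfolding J_def by auto
    then have "comp e x = comp e p \<oplus> comp (e - d) b \<otimes> a"
      using comp_mult[OF d pb(2), of e] m_comm[OF pb(2) ac] m_comm[OF comp_closed[OF pb(2)] ac] ac Pc
      by (simp add: comp_add)
    moreover have "comp e p \<in> P" using P pb(1) unfolding comp_closed_ideal_def by blast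
    ultimately show ?thesis unfolding J_def using comp_closed[OF pb(2)] by blast
  qed
  then show "comp_closed_ideal J" unfolding comp_closed_ideal_def using idl by blast
qed

text \<open>An ideal maximal among the homogeneous ideals that contain \<open>T\<close> and miss all
  powers of \<open>f\<close> is prime, as in the usual construction of primes disjoint from a
  multiplicative set. Positivity of \<open>d\<close> puts \<open>f\<close> into the irrelevant
  ideal, so this prime is a point of \<open>Proj\<close>.\<close>

lemma exists_Proj_avoiding:
  assumes T: "T \<subseteq> homogeneous" and f: "f \<in> G d" "d > 0"
    and avoid: "\<And>k::nat. f [^] k \<notin> genideal S T"
  shows "\<exists>P\<in>Proj S G. T \<subseteq> P \<and> f \<notin> P"
proof -
  have Tc: "T \<subseteq> carrier S" using T by auto
  have fc: "f \<in> carrier S" using f by auto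
  define \<A> where "\<A> = {I. comp_closed_ideal I \<and> T \<subseteq> I \<and> (\<forall>k::nat. f [^] k \<notin> I)}"
  have "\<exists>P\<in>\<A>. \<forall>I\<in>\<A>. P \<subseteq> I \<longrightarrow> I = P"
  proof (rule subset_Zorn_nonempty)
    have "genideal S T \<in> \<A>"
      unfolding \<A>_def using genideal_comp_closed[OF T] genideal_self[OF Tc] avoid by blast
    then show "\<A> \<noteq> {}" by blast
    fix C assume C: "C \<noteq> {}" "subset.chain \<A> C"
    then have CA: "C \<subseteq> \<A>" and ch: "\<And>I J. I \<in> C \<Longrightarrow> J \<in> C \<Longrightarrow> I \<subseteq> J \<or> J \<subseteq> I"
      unfolding subset.chain_def by auto
    have "ideal (\<Union>C) S"
    proof (rule directed_Union_ideal[OF C(1)])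
      show "\<exists>K\<in>C. I \<subseteq> K \<and> J \<subseteq> K" if "I \<in> C" "J \<in> C" for I J
        using ch[OF that] that by blast
    qed (use CA in \<open>auto simp: \<A>_def comp_closed_ideal_def\<close>)
    then have "comp_closed_ideal (\<Union>C)"
      unfolding comp_closed_ideal_def using CA unfolding \<A>_def comp_closed_ideal_def by blast
    then show "\<Union>C \<in> \<A>" using CA C(1) unfolding \<A>_def by blast
  qed
  then obtain P where P: "P \<in> \<A>" and max: "\<And>I. I \<in> \<A> \<Longrightarrow> P \<subseteq> I \<Longrightarrow> I = P" by blast
  have Pcc: "comp_closed_ideal P" and TP: "T \<subseteq> P" and fP: "\<And>k::nat. f [^] k \<notin> P"
    using P unfolding \<A>_def by auto
  interpret P: ideal P S using Pcc unfolding comp_closed_ideal_def by blast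
  \<comment> \<open>By maximality, adjoining a homogeneous \<open>a\<close> outside \<open>P\<close>
    captures a power of \<open>f\<close>.\<close>
  have meets: "\<exists>(k::nat) p b. p \<in> P \<and> b \<in> carrier S \<and> f [^] k = p \<oplus> b \<otimes> a"
    if a: "a \<in> homogeneous" "a \<notin> P" for a
  proof (rule ccontr)
    let ?J = "{p \<oplus> b \<otimes> a | p b. p \<in> P \<and> b \<in> carrier S}"
    note J = ideal_sum_cgenideal[OF Pcc a(1)]
    assume "\<not> ?thesis"
    then have "f [^] (k::nat) \<notin> ?J" for k by blast
    then have "?J \<in> \<A>"
      unfolding \<A>_def using J(1) subset_trans[OF TP J(2)] by simp
    then have "?J = P" using J(2) by (rule max)
    then show False using J(3) a(2) by simp
  qed
  have "primeideal P S"
  proof (rule comp_closed_prime[OF Pcc])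
    show "\<one> \<notin> P" using fP[of 0] by simp
    fix x y assume x: "x \<in> homogeneous" and y: "y \<in> homogeneous" and xy: "x \<otimes> y \<in> P"
    show "x \<in> P \<or> y \<in> P"
    proof (rule ccontr)
      assume "\<not> (x \<in> P \<or> y \<in> P)"
      then obtain k l :: nat and p q b c where
        1: "p \<in> P" "b \<in> carrier S" "f [^] k = p \<oplus> b \<otimes> x" and
        2: "q \<in> P" "c \<in> carrier S" "f [^] l = q \<oplus> c \<otimes> y"
        using meets x y by metis
      have cl: "p \<in> carrier S" "q \<in> carrier S" "x \<in> carrier S" "y \<in> carrier S"
        using 1 2 P.a_subset x y by auto
      \<comment> \<open>The product of the two captured powers expands into terms with a factor
        \<open>p\<close>, \<open>q\<close> or \<open>x \<otimes> y\<close>, all in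
        \<open>P\<close>.\<close>
      have "f [^] (k + l) = (p \<oplus> b \<otimes> x) \<otimes> (q \<oplus> c \<otimes> y)"
        using 1 2 fc by (simp add: nat_pow_mult[symmetric])
      also have "\<dots> = p \<otimes> (q \<oplus> c \<otimes> y) \<oplus> ((b \<otimes> x) \<otimes> q \<oplus> (b \<otimes> c) \<otimes> (x \<otimes> y))"
        using cl 1(2) 2(2) by (simp add: l_distr r_distr m_ac a_ac)
      also have "\<dots> \<in> P"
        using cl 1 2 xy by (intro P.a_closed P.I_r_closed[OF 1(1)] P.I_l_closed[OF 2(1)] P.I_l_closed[OF xy]) auto
      finally show False using fP by blast
    qed
  qed
  moreover have "f \<in> irrelevant_ideal S G"
  proof -
    have "f = (\<Oplus>e\<in>{d}. f)" using fc by simp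
    then show ?thesis
      unfolding irrelevant_ideal_def
      by (intro CollectI exI[of _ "{d}"] exI[of _ "\<lambda>_. f"]) (use f in auto)
  qed
  moreover have "f \<notin> P" using fP[of 1] fc by simp
  ultimately have "P \<in> Proj S G"
    unfolding Proj_def using comp_closed_imp_homogeneous[OF Pcc] by blast
  then show ?thesis using TP \<open>f \<notin> P\<close> by blast
qed


text \<open>The ideals of the finite subsets form a directed family whose union is an ideal
  containing \<open>T\<close>.\<close>

lemma genideal_finite_subset:
  assumes T: "T \<subseteq> carrier S" and x: "x \<in> genideal S T"
  shows "\<exists>F\<subseteq>T. finite F \<and> x \<in> genideal S F"
proof -
  let ?C = "{genideal S F | F. F \<subseteq> T \<and> finite F}"
  have "ideal (\<Union>?C) S"
  proof (rule directed_Union_ideal)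
    show "ideal I S" if "I \<in> ?C" for I
      using that T genideal_ideal by auto
    show "\<exists>K\<in>?C. I \<subseteq> K \<and> J \<subseteq> K" if IJ: "I \<in> ?C" "J \<in> ?C" for I J
    proof -
      obtain A B where AB: "I = genideal S A" "J = genideal S B" "A \<subseteq> T" "B \<subseteq> T" "finite A" "finite B"
        using IJ by blast
      then have "genideal S A \<subseteq> genideal S (A \<union> B)" "genideal S B \<subseteq> genideal S (A \<union> B)"
        using T by (intro subset_Idl_subset; blast)+
      moreover have "genideal S (A \<union> B) \<in> ?C" using AB(3-6) by blast
      ultimately show ?thesis unfolding AB(1,2) by blast
    qed
  qed auto
  moreover have "T \<subseteq> \<Union>?C"
  proof
    fix t assume t: "t \<in> T"
    then have "t \<in> genideal S {t}" using T genideal_self' by auto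
    moreover have "genideal S {t} \<in> ?C" using t by blast
    ultimately show "t \<in> \<Union>?C" by blast
  qed
  ultimately have "genideal S T \<subseteq> \<Union>?C" by (rule genideal_minimal)
  then show ?thesis using x by blast
qed

text \<open>Contrapositive of \<open>exists_Proj_avoiding\<close>: a projective Nullstellensatz,
  from which the compactness of D_+(f) and the partitions of unity follow.\<close>

lemma D_plus_covered:
  assumes T: "T \<subseteq> homogeneous" and f: "f \<in> G d" "d > 0"
    and cov: "\<And>P. P \<in> D_plus S G f \<Longrightarrow> \<exists>t\<in>T. t \<notin> P"
  shows "\<exists>k::nat. f [^] k \<in> genideal S T"
  using exists_Proj_avoiding[OF T f] cov unfolding D_plus_def by blast

text \<open>The homogeneous annihilators of \<open>x\<close> have no common zero on D_+(f), so a
  power of \<open>f\<close> lies in the ideal they generate, and that ideal is contained in the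
  annihilator of \<open>x\<close>.\<close>

lemma annihilated_by_power:
  assumes x: "x \<in> carrier S" and f: "f \<in> G d" "d > 0"
    and loc: "\<And>P. P \<in> D_plus S G f \<Longrightarrow> \<exists>h\<in>homogeneous - P. h \<otimes> x = \<zero>"
  shows "\<exists>k::nat. f [^] k \<otimes> x = \<zero>"
proof -
  let ?T = "{h \<in> homogeneous. h \<otimes> x = \<zero>}"
  let ?A = "{y \<in> carrier S. y \<otimes> x = \<zero>}"
  obtain k :: nat where "f [^] k \<in> genideal S ?T"
    using D_plus_covered[of ?T f d] f loc by blast
  moreover have "ideal ?A S"
  proof (rule idealI)
    show "ring S" by (rule ring_axioms)
    show "subgroup ?A (add_monoid S)"
      by (rule add.subgroupI) (use x in \<open>auto simp: l_distr l_minus intro: exI[of _ \<zero>]\<close>)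
    fix a b assume ab: "a \<in> ?A" "b \<in> carrier S"
    then show "b \<otimes> a \<in> ?A" using x by (auto simp: m_assoc)
    then show "a \<otimes> b \<in> ?A" using ab m_comm by auto
  qed
  then have "genideal S ?T \<subseteq> ?A" by (rule genideal_minimal) auto
  ultimately show ?thesis by blast
qed

section \<open>Points of Proj as primes, and the basis of open sets D_+(h)\<close>

lemma Proj_primeideal: "P \<in> Proj S G \<Longrightarrow> primeideal P S"
  by (simp add: Proj_def)

lemma Proj_ideal: "P \<in> Proj S G \<Longrightarrow> ideal P S"
  by (rule primeideal.axioms(1)[OF Proj_primeideal])

lemma Proj_one:
  assumes "P \<in> Proj S G"
  shows "\<one> \<notin> P"
  using primeideal.I_notcarr[OF Proj_primeideal[OF assms]] ideal.one_imp_carrier[OF Proj_ideal[OF assms]]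
  by metis

lemma Proj_mult:
  assumes P: "P \<in> Proj S G" and c: "x \<in> carrier S" "y \<in> carrier S"
  shows "x \<otimes> y \<in> P \<longleftrightarrow> x \<in> P \<or> y \<in> P"
  using primeideal.I_prime[OF Proj_primeideal[OF P] c] ideal.I_l_closed[OF Proj_ideal[OF P] _ c(1), of y]
    ideal.I_r_closed[OF Proj_ideal[OF P] _ c(2), of x] by metis

lemma Proj_pow:
  "P \<in> Proj S G \<Longrightarrow> x \<in> carrier S \<Longrightarrow> x \<notin> P \<Longrightarrow> x [^] (k::nat) \<notin> P"
  by (induction k) (auto simp: Proj_mult Proj_one)

lemma Proj_open_D_plus:
  assumes f: "f \<in> homogeneous"
  shows "Proj_open S G (D_plus S G f)"
proof -
  have fc: "{f} \<subseteq> carrier S" using f by auto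
  have "homogeneous_ideal S G (genideal S {f})"
    by (rule comp_closed_imp_homogeneous[OF genideal_comp_closed]) (use f in auto)
  moreover have "genideal S {f} \<subseteq> P \<longleftrightarrow> f \<in> P" if "P \<in> Proj S G" for P
    using genideal_minimal[OF Proj_ideal[OF that], of "{f}"] genideal_self[OF fc] by blast
  then have "D_plus S G f = Proj S G - V_plus S G (genideal S {f})"
    unfolding D_plus_def V_plus_def by blast
  ultimately show ?thesis unfolding Proj_open_def by blast
qed

text \<open>If every homogeneous element of \<open>I\<close> lay in \<open>P\<close>, then so would
  \<open>I\<close>, which they generate.\<close>

lemma Proj_open_basis:
  assumes V: "Proj_open S G V" and P: "P \<in> V"
  shows "\<exists>h\<in>homogeneous. h \<notin> P \<and> D_plus S G h \<subseteq> V"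
proof -
  obtain I where I: "homogeneous_ideal S G I" "V = Proj S G - V_plus S G I"
    using V unfolding Proj_open_def by blast
  have P': "P \<in> Proj S G" "\<not> I \<subseteq> P" using P I(2) unfolding V_plus_def by auto
  have "genideal S (I \<inter> homogeneous) = I" using I(1) unfolding homogeneous_ideal_def homogeneous_def by blast
  then have "\<not> I \<inter> homogeneous \<subseteq> P"
    using genideal_minimal[OF Proj_ideal[OF P'(1)], of "I \<inter> homogeneous"] P'(2) by auto
  then obtain h where "h \<in> I" "h \<in> homogeneous" "h \<notin> P" by blast
  then show ?thesis unfolding I(2) D_plus_def V_plus_def by blast
qed


subsection \<open>Stalks of the twisting sheaves\<close>

lemma fractions_at_iff:
  "(a, f) \<in> fractions_at G m P \<longleftrightarrow> (\<exists>d. a \<in> G (m + d) \<and> f \<in> G d \<and> f \<notin> P)"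
  unfolding fractions_at_def shift_def by auto

lemma fractions_at_carrier:
  assumes "(a, f) \<in> fractions_at G m P"
  shows "a \<in> carrier S" "f \<in> carrier S" "f \<notin> P" "f \<in> homogeneous"
  using assms homI unfolding fractions_at_iff by auto

lemma mem_hfrac:
  "(b, g) \<in> hfrac S G m P a f \<longleftrightarrow>
    (b, g) \<in> fractions_at G m P \<and> (\<exists>h\<in>homogeneous - P. h \<otimes> (g \<otimes> a) = h \<otimes> (f \<otimes> b))"
  unfolding hfrac_def homogeneous_def by auto

lemma hfrac_refl:
  assumes "P \<in> Proj S G" "(a, f) \<in> fractions_at G m P"
  shows "(a, f) \<in> hfrac S G m P a f"
  unfolding mem_hfrac using assms one_hom Proj_one by blast

text \<open>Symmetry and transitivity in one form, which makes the sets \<open>hfrac\<close>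
  equivalence classes.\<close>

lemma hfrac_trans:
  assumes P: "P \<in> Proj S G"
    and 1: "(b, g) \<in> hfrac S G m P a f" and 2: "(c, l) \<in> hfrac S G m P a f"
    and a: "(a, f) \<in> fractions_at G m P"
  shows "(c, l) \<in> hfrac S G m P b g"
proof -
  obtain h k where h: "h \<in> homogeneous - P" "h \<otimes> (g \<otimes> a) = h \<otimes> (f \<otimes> b)"
    and k: "k \<in> homogeneous - P" "k \<otimes> (l \<otimes> a) = k \<otimes> (f \<otimes> c)"
    using 1 2 unfolding mem_hfrac by blast
  have [simp]: "a \<in> carrier S" "f \<in> carrier S" "b \<in> carrier S" "g \<in> carrier S"
    "c \<in> carrier S" "l \<in> carrier S" "h \<in> carrier S" "k \<in> carrier S"
    using 1 2 a h k fractions_at_carrier unfolding mem_hfrac by auto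
  \<comment> \<open>The witness is \<open>h \<otimes> k \<otimes> f\<close>: besides the two given
    witnesses, the factor \<open>f\<close> is needed to pass from \<open>b\<close> to
    \<open>c\<close> through \<open>a\<close>.\<close>
  have "(h \<otimes> k \<otimes> f) \<otimes> (l \<otimes> b) = (k \<otimes> l) \<otimes> (h \<otimes> (f \<otimes> b))" by (simp add: m_ac)
  also have "\<dots> = (h \<otimes> g) \<otimes> (k \<otimes> (l \<otimes> a))" unfolding h(2)[symmetric] by (simp add: m_ac)
  also have "\<dots> = (h \<otimes> k \<otimes> f) \<otimes> (g \<otimes> c)" unfolding k(2) by (simp add: m_ac)
  finally have "(h \<otimes> k \<otimes> f) \<otimes> (l \<otimes> b) = (h \<otimes> k \<otimes> f) \<otimes> (g \<otimes> c)" .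
  moreover have "h \<otimes> k \<otimes> f \<in> homogeneous - P"
    using h k fractions_at_carrier[OF a] P by (simp add: hom_mult Proj_mult)
  ultimately show ?thesis using 2 unfolding mem_hfrac by blast
qed

lemma hfrac_eq_iff:
  assumes P: "P \<in> Proj S G" and a: "(a, f) \<in> fractions_at G m P" and b: "(b, g) \<in> fractions_at G m P"
  shows "hfrac S G m P a f = hfrac S G m P b g \<longleftrightarrow>
    (\<exists>h\<in>homogeneous - P. h \<otimes> (g \<otimes> a) = h \<otimes> (f \<otimes> b))"
proof
  assume "hfrac S G m P a f = hfrac S G m P b g"
  then have "(b, g) \<in> hfrac S G m P a f" using hfrac_refl[OF P b] by simp
  then show "\<exists>h\<in>homogeneous - P. h \<otimes> (g \<otimes> a) = h \<otimes> (f \<otimes> b)" unfolding mem_hfrac by blast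
next
  assume "\<exists>h\<in>homogeneous - P. h \<otimes> (g \<otimes> a) = h \<otimes> (f \<otimes> b)"
  then have ba: "(b, g) \<in> hfrac S G m P a f" unfolding mem_hfrac using b by blast
  have ab: "(a, f) \<in> hfrac S G m P b g"
    using hfrac_trans[OF P ba hfrac_refl[OF P a] a] .
  show "hfrac S G m P a f = hfrac S G m P b g"
  proof (intro equalityI subsetI)
    fix x
    show "x \<in> hfrac S G m P b g" if "x \<in> hfrac S G m P a f"
      using that hfrac_trans[OF P ba _ a, of "fst x" "snd x"] by simp
    show "x \<in> hfrac S G m P a f" if "x \<in> hfrac S G m P b g"
      using that hfrac_trans[OF P ab _ b, of "fst x" "snd x"] by simp
  qed
qed

lemma hfrac_cancel:
  assumes P: "P \<in> Proj S G" and a: "(a, f) \<in> fractions_at G m P" and h: "h \<in> homogeneous" "h \<notin> P"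
  shows "(h \<otimes> a, h \<otimes> f) \<in> fractions_at G m P" "hfrac S G m P (h \<otimes> a) (h \<otimes> f) = hfrac S G m P a f"
proof -
  obtain e d where e: "h \<in> G e" and d: "a \<in> G (m + d)" "f \<in> G d" "f \<notin> P"
    using h a unfolding fractions_at_iff homogeneous_def by auto
  have c: "h \<in> carrier S" "a \<in> carrier S" "f \<in> carrier S" using e d by auto
  have "h \<otimes> a \<in> G (m + (e + d))" using mult_G[OF e d(1)] by (simp add: algebra_simps)
  then show fr: "(h \<otimes> a, h \<otimes> f) \<in> fractions_at G m P"
    unfolding fractions_at_iff using mult_G[OF e d(2)] d(3) h(2) P c by (auto simp: Proj_mult)
  have "\<one> \<otimes> (f \<otimes> (h \<otimes> a)) = \<one> \<otimes> ((h \<otimes> f) \<otimes> a)" using c by (simp add: m_ac)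
  then show "hfrac S G m P (h \<otimes> a) (h \<otimes> f) = hfrac S G m P a f"
    unfolding hfrac_eq_iff[OF P fr a] using one_hom Proj_one[OF P] by blast
qed

text \<open>The sum is a union over all pairs of representatives, so evaluating it is a matter of
  well-definedness: all members of the union are the same class, and reflexivity makes the union
  nonempty.\<close>

lemma twist_stalk_add:
  assumes P: "P \<in> Proj S G" and a: "(a, f) \<in> fractions_at G m P" and b: "(b, g) \<in> fractions_at G m P"
  shows "hfrac S G m P a f \<oplus>\<^bsub>twist_stalk S G m P\<^esub> hfrac S G m P b g =
    hfrac S G m P (g \<otimes> a \<oplus> f \<otimes> b) (f \<otimes> g)"
proof -
  have fr: "(g' \<otimes> a' \<oplus> f' \<otimes> b', f' \<otimes> g') \<in> fractions_at G m P"
    if fr: "(a', f') \<in> fractions_at G m P" "(b', g') \<in> fractions_at G m P" for a' b' f' g'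
  proof -
    obtain d e where d: "a' \<in> G (m + d)" "f' \<in> G d" "f' \<notin> P" and e: "b' \<in> G (m + e)" "g' \<in> G e" "g' \<notin> P"
      using fr unfolding fractions_at_iff by blast
    have "g' \<otimes> a' \<in> G (m + (d + e))" "f' \<otimes> b' \<in> G (m + (d + e))"
      using mult_G[OF e(2) d(1)] mult_G[OF d(2) e(1)] by (simp_all add: algebra_simps)
    moreover have "f' \<otimes> g' \<notin> P"
      using d(3) e(3) by (simp add: Proj_mult[OF P G_carrier[OF d(2)] G_carrier[OF e(2)]])
    ultimately show ?thesis unfolding fractions_at_iff using mult_G[OF d(2) e(2)] by blast
  qed
  have eq: "hfrac S G m P (g' \<otimes> a' \<oplus> f' \<otimes> b') (f' \<otimes> g') = hfrac S G m P (g \<otimes> a \<oplus> f \<otimes> b) (f \<otimes> g)"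
    if a': "(a', f') \<in> hfrac S G m P a f" and b': "(b', g') \<in> hfrac S G m P b g" for a' b' f' g'
  proof -
    obtain h k where h: "h \<in> homogeneous - P" "h \<otimes> (f' \<otimes> a) = h \<otimes> (f \<otimes> a')"
      and k: "k \<in> homogeneous - P" "k \<otimes> (g' \<otimes> b) = k \<otimes> (g \<otimes> b')"
      using a' b' unfolding mem_hfrac by blast
    have fr': "(a', f') \<in> fractions_at G m P" "(b', g') \<in> fractions_at G m P"
      using a' b' unfolding mem_hfrac by auto
    have [simp]: "a \<in> carrier S" "f \<in> carrier S" "b \<in> carrier S" "g \<in> carrier S"
      "a' \<in> carrier S" "f' \<in> carrier S" "b' \<in> carrier S" "g' \<in> carrier S" "h \<in> carrier S" "k \<in> carrier S"
      using a b fr' h k fractions_at_carrier by auto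
    have "(h \<otimes> k) \<otimes> ((f \<otimes> g) \<otimes> (g' \<otimes> a' \<oplus> f' \<otimes> b')) =
        (k \<otimes> g \<otimes> g') \<otimes> (h \<otimes> (f \<otimes> a')) \<oplus> (h \<otimes> f \<otimes> f') \<otimes> (k \<otimes> (g \<otimes> b'))"
      by (simp add: r_distr m_ac)
    also have "\<dots> = (h \<otimes> k) \<otimes> ((f' \<otimes> g') \<otimes> (g \<otimes> a \<oplus> f \<otimes> b))"
      unfolding h(2)[symmetric] k(2)[symmetric] by (simp add: r_distr m_ac)
    finally have "(h \<otimes> k) \<otimes> ((f \<otimes> g) \<otimes> (g' \<otimes> a' \<oplus> f' \<otimes> b')) = \<dots>" .
    moreover have "h \<otimes> k \<in> homogeneous - P" using h k P by (simp add: hom_mult Proj_mult)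
    ultimately show ?thesis
      unfolding hfrac_eq_iff[OF P fr[OF fr'] fr[OF a b]] by blast
  qed
  have "hfrac S G m P a f \<oplus>\<^bsub>twist_stalk S G m P\<^esub> hfrac S G m P b g =
      (\<Union>(a', f')\<in>hfrac S G m P a f. \<Union>(b', g')\<in>hfrac S G m P b g.
        hfrac S G m P (g' \<otimes> a' \<oplus> f' \<otimes> b') (f' \<otimes> g'))"
    by (simp add: twist_stalk_def)
  also have "\<dots> = (\<Union>(a', f')\<in>hfrac S G m P a f. \<Union>(b', g')\<in>hfrac S G m P b g.
        hfrac S G m P (g \<otimes> a \<oplus> f \<otimes> b) (f \<otimes> g))"
    using eq by (intro SUP_cong refl) (auto split: prod.splits)
  also have "\<dots> = hfrac S G m P (g \<otimes> a \<oplus> f \<otimes> b) (f \<otimes> g)"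
    using hfrac_refl[OF P a] hfrac_refl[OF P b] by fast
  finally show ?thesis .
qed

lemma twist_stalk_add_same_denominator:
  assumes P: "P \<in> Proj S G" and f: "f \<in> G d" "f \<notin> P" and a: "a \<in> G (m + d)" and b: "b \<in> G (m + d)"
  shows "hfrac S G m P a f \<oplus>\<^bsub>twist_stalk S G m P\<^esub> hfrac S G m P b f = hfrac S G m P (a \<oplus> b) f"
proof -
  have fr: "(a, f) \<in> fractions_at G m P" "(b, f) \<in> fractions_at G m P" "(a \<oplus> b, f) \<in> fractions_at G m P"
    unfolding fractions_at_iff using f a b by auto
  have "f \<otimes> a \<oplus> f \<otimes> b = f \<otimes> (a \<oplus> b)" using f a b by (simp add: r_distr G_carrier)
  then show ?thesis
    using twist_stalk_add[OF P fr(1,2)] hfrac_cancel(2)[OF P fr(3) homI[OF f(1)] f(2)] by simp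
qed

lemma twist_stalk_zero:
  assumes P: "P \<in> Proj S G" and f: "f \<in> G d" "f \<notin> P"
  shows "\<zero>\<^bsub>twist_stalk S G m P\<^esub> = hfrac S G m P \<zero> f"
proof -
  have fr: "(\<zero>, f) \<in> fractions_at G m P" "(\<zero>, \<one>) \<in> fractions_at G m P"
    unfolding fractions_at_iff using f one_G Proj_one[OF P] by auto
  have "hfrac S G m P \<zero> \<one> = hfrac S G m P \<zero> f"
    unfolding hfrac_eq_iff[OF P fr(2,1)] using one_hom Proj_one[OF P] f by (auto simp: G_carrier)
  then show ?thesis by (simp add: twist_stalk_def)
qed

text \<open>\<open>graded_ring\<close> has no base ring, so the compatibility of the scalar
  \<open>c\<close> with degrees and products enters as a hypothesis. The union over representatives
  is evaluated as for sums.\<close>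

lemma twist_stalk_smult:
  assumes P: "P \<in> Proj S G" and a: "(a, f) \<in> fractions_at G m P"
    and c: "\<And>d x. x \<in> G d \<Longrightarrow> c \<odot> x \<in> G d"
    and cm: "\<And>x y. x \<in> carrier S \<Longrightarrow> y \<in> carrier S \<Longrightarrow> c \<odot> (x \<otimes> y) = x \<otimes> (c \<odot> y)"
  shows "c \<odot>\<^bsub>twist_stalk S G m P\<^esub> hfrac S G m P a f = hfrac S G m P (c \<odot> a) f"
proof -
  have fr: "(c \<odot> a', f') \<in> fractions_at G m P" if "(a', f') \<in> fractions_at G m P" for a' f'
    using that c unfolding fractions_at_iff by blast
  have eq: "hfrac S G m P (c \<odot> a') f' = hfrac S G m P (c \<odot> a) f"
    if a': "(a', f') \<in> hfrac S G m P a f" for a' f'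
  proof -
    obtain h where h: "h \<in> homogeneous - P" "h \<otimes> (f' \<otimes> a) = h \<otimes> (f \<otimes> a')"
      using a' unfolding mem_hfrac by blast
    have fr': "(a', f') \<in> fractions_at G m P" using a' unfolding mem_hfrac by auto
    have [simp]: "a \<in> carrier S" "f \<in> carrier S" "a' \<in> carrier S" "f' \<in> carrier S" "h \<in> carrier S"
      using a fr' h fractions_at_carrier by auto
    have "h \<otimes> (f \<otimes> (c \<odot> a')) = c \<odot> (h \<otimes> (f \<otimes> a'))"
      by (simp add: cm)
    also have "\<dots> = h \<otimes> (f' \<otimes> (c \<odot> a))"
      unfolding h(2)[symmetric] by (simp add: cm)
    finally show ?thesis
      unfolding hfrac_eq_iff[OF P fr[OF fr'] fr[OF a]] using h(1) by blast
  qed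
  have "c \<odot>\<^bsub>twist_stalk S G m P\<^esub> hfrac S G m P a f =
      (\<Union>(a', f')\<in>hfrac S G m P a f. hfrac S G m P (c \<odot> a') f')"
    by (simp add: twist_stalk_def)
  also have "\<dots> = (\<Union>(a', f')\<in>hfrac S G m P a f. hfrac S G m P (c \<odot> a) f)"
    using eq by (intro SUP_cong refl) (auto split: prod.splits)
  also have "\<dots> = hfrac S G m P (c \<odot> a) f"
    using hfrac_refl[OF P a] by fast
  finally show ?thesis .
qed


subsection \<open>Sections over \<open>D\<^sub>+(f)\<close>\<close>

text \<open>At each point some homogeneous element outside the prime kills
  \<open>l \<otimes> a \<ominus> k \<otimes> b\<close>; by \<open>annihilated_by_power\<close> a
  single power of \<open>f\<close> then does so.\<close>

lemma hfrac_eq_on_D_plus: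
  assumes f: "f \<in> G d" "d > 0"
    and fr: "\<And>Q. Q \<in> D_plus S G f \<Longrightarrow> (a, k) \<in> fractions_at G m Q \<and> (b, l) \<in> fractions_at G m Q"
    and eq: "\<And>Q. Q \<in> D_plus S G f \<Longrightarrow> hfrac S G m Q a k = hfrac S G m Q b l"
    and c: "a \<in> carrier S" "b \<in> carrier S" "k \<in> carrier S" "l \<in> carrier S"
  shows "\<exists>N::nat. f [^] N \<otimes> (l \<otimes> a) = f [^] N \<otimes> (k \<otimes> b)"
proof -
  have fc: "f \<in> carrier S" using f by auto
  have minus_zero: "h \<otimes> (x \<ominus> y) = \<zero> \<longleftrightarrow> h \<otimes> x = h \<otimes> y"
    if "h \<in> carrier S" "x \<in> carrier S" "y \<in> carrier S" for h x y
  proof -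
    have "h \<otimes> (x \<ominus> y) = h \<otimes> x \<ominus> h \<otimes> y"
      using that by (simp add: a_minus_def r_distr r_minus)
    then show ?thesis using that r_right_minus_eq by simp
  qed
  have "\<exists>N::nat. f [^] N \<otimes> (l \<otimes> a \<ominus> k \<otimes> b) = \<zero>"
  proof (rule annihilated_by_power[OF _ f])
    fix Q assume Q: "Q \<in> D_plus S G f"
    then have "Q \<in> Proj S G" unfolding D_plus_def by blast
    then obtain h where "h \<in> homogeneous - Q" "h \<otimes> (l \<otimes> a) = h \<otimes> (k \<otimes> b)"
      using hfrac_eq_iff[of Q a k m b l] fr[OF Q] eq[OF Q] by auto
    then show "\<exists>h\<in>homogeneous - Q. h \<otimes> (l \<otimes> a \<ominus> k \<otimes> b) = \<zero>"
      using minus_zero[of h "l \<otimes> a" "k \<otimes> b"] c by auto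
  qed (use c in auto)
  then show ?thesis using minus_zero[of "f [^] _" "l \<otimes> a" "k \<otimes> b"] c fc by auto
qed


text \<open>Gluing over a finite subcover. Two points need care: local fractions agree only after
  multiplication by powers, which are absorbed by raising all denominators to a common power, and
  the numerator obtained from the partition of unity has to be cut down to the right degree.\<close>

lemma section_is_fraction:
  assumes f: "f \<in> G \<delta>" "\<delta> > 0" and s: "s \<in> carrier (twist_sheaf S G m (D_plus S G f))"
  shows "\<exists>(N::nat) a. a \<in> G (m + of_nat N * \<delta>) \<and> (\<forall>Q\<in>D_plus S G f. s Q = hfrac S G m Q a (f [^] N))"
proof -
  have fc [simp]: "f \<in> carrier S" using f by auto
  \<comment> \<open>The denominator \<open>k\<close> also cuts out the open set on which its
    fraction represents \<open>s\<close>. Its positive degree allows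
    \<open>hfrac_eq_on_D_plus\<close> to be applied to products of two denominators.\<close>
  define good where "good k a e \<longleftrightarrow> k \<in> G e \<and> a \<in> G (m + e) \<and> e > 0 \<and>
    (\<forall>Q\<in>D_plus S G k. s Q = hfrac S G m Q a k)" for k a e
  define T where "T = {k. \<exists>a e. good k a e}"
  have T_hom: "T \<subseteq> homogeneous" unfolding T_def good_def using homI by blast
  have local: "\<exists>k\<in>T. k \<notin> P" if P: "P \<in> D_plus S G f" for P
  proof -
    have PP: "P \<in> Proj S G" "f \<notin> P" using P unfolding D_plus_def by auto
    obtain V a g where V: "Proj_open S G V" "P \<in> V"
      and sV: "\<And>Q. Q \<in> V \<Longrightarrow> (a, g) \<in> fractions_at G m Q \<and> s Q = hfrac S G m Q a g"
      using s P unfolding twist_sheaf_def by auto metis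
    obtain h where h: "h \<in> homogeneous" "h \<notin> P" "D_plus S G h \<subseteq> V"
      using Proj_open_basis[OF V] by blast
    obtain d where d: "a \<in> G (m + d)" "g \<in> G d" "g \<notin> P"
      using sV[OF V(2)] unfolding fractions_at_iff by blast
    obtain e where e: "h \<in> G e" using h(1) unfolding homogeneous_def by blast
    have c [simp]: "h \<in> carrier S" "g \<in> carrier S" "a \<in> carrier S" using d e by auto
    have "\<zero> \<in> P" using Proj_ideal[OF PP(1)] ideal.axioms(1) additive_subgroup.zero_closed by blast
    then have "0 \<le> e" "0 \<le> d" using G_deg_nonneg[OF e] G_deg_nonneg[OF d(2)] h(2) d(3) by auto
    have fh: "f \<otimes> h \<in> G (\<delta> + e)" using mult_G[OF f(1) e] .
    \<comment> \<open>The local fraction is expanded by \<open>f \<otimes> h\<close>: the factor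
      \<open>h\<close> confines the open set to \<open>V\<close>, and \<open>f\<close> makes the
      degree positive.\<close>
    have "good ((f \<otimes> h) \<otimes> g) ((f \<otimes> h) \<otimes> a) (\<delta> + e + d)"
      unfolding good_def
    proof (intro conjI ballI)
      show "(f \<otimes> h) \<otimes> g \<in> G (\<delta> + e + d)" using mult_G[OF fh d(2)] .
      show "(f \<otimes> h) \<otimes> a \<in> G (m + (\<delta> + e + d))"
        using mult_G[OF fh d(1)] by (simp add: algebra_simps)
      show "0 < \<delta> + e + d" using f(2) \<open>0 \<le> e\<close> \<open>0 \<le> d\<close> by simp
      fix Q assume "Q \<in> D_plus S G ((f \<otimes> h) \<otimes> g)"
      then have Q: "Q \<in> Proj S G" "f \<otimes> h \<notin> Q" "h \<notin> Q"
        unfolding D_plus_def by (auto simp: Proj_mult)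
      then have "Q \<in> V" using h(3) unfolding D_plus_def by blast
      then show "s Q = hfrac S G m Q ((f \<otimes> h) \<otimes> a) ((f \<otimes> h) \<otimes> g)"
        using sV hfrac_cancel(2)[OF Q(1) _ homI[OF fh] Q(2)] by simp
    qed
    then have "(f \<otimes> h) \<otimes> g \<in> T" unfolding T_def by blast
    moreover have "(f \<otimes> h) \<otimes> g \<notin> P" using PP h(2) d(3) by (simp add: Proj_mult)
    ultimately show ?thesis by blast
  qed
  obtain N1 :: nat where "f [^] N1 \<in> genideal S T"
    using D_plus_covered[OF T_hom f local] by blast
  then obtain F where F: "F \<subseteq> T" "finite F" "f [^] N1 \<in> genideal S F"
    using genideal_finite_subset[of T "f [^] N1"] T_hom by blast
  \<comment> \<open>A prime containing \<open>F\<close> would contain a power of \<open>f\<close>,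
    hence \<open>f\<close>; so the finite set still covers D_+(f).\<close>
  have F_cover: "\<exists>k\<in>F. k \<notin> P" if "P \<in> D_plus S G f" for P
  proof (rule ccontr)
    assume "\<not> (\<exists>k\<in>F. k \<notin> P)"
    then have "F \<subseteq> P" by blast
    have P: "P \<in> Proj S G" "f \<notin> P" using that unfolding D_plus_def by auto
    have "genideal S F \<subseteq> P" by (rule genideal_minimal[OF Proj_ideal[OF P(1)] \<open>F \<subseteq> P\<close>])
    then show False using F(3) Proj_pow[OF P(1) fc P(2)] by blast
  qed
  have "\<forall>k\<in>F. \<exists>p. good k (fst p) (snd p)" using F(1) unfolding T_def by auto
  then obtain p where p: "\<And>k. k \<in> F \<Longrightarrow> good k (fst (p k)) (snd (p k))" by metis
  define \<alpha> where "\<alpha> k = fst (p k)" for k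
  define \<epsilon> where "\<epsilon> k = snd (p k)" for k
  have kG: "k \<in> G (\<epsilon> k)" and \<alpha>G: "\<alpha> k \<in> G (m + \<epsilon> k)" and \<epsilon>: "\<epsilon> k > 0"
    and sk: "\<And>Q. Q \<in> D_plus S G k \<Longrightarrow> s Q = hfrac S G m Q (\<alpha> k) k" if "k \<in> F" for k
    using p[OF that] unfolding good_def \<alpha>_def \<epsilon>_def by auto
  have kc [simp]: "k \<in> carrier S" and \<alpha>c [simp]: "\<alpha> k \<in> carrier S" if "k \<in> F" for k
    using kG[OF that] \<alpha>G[OF that] by auto
  \<comment> \<open>Both fractions represent \<open>s\<close> where \<open>k \<otimes> l\<close>
    does not vanish, so they agree up to a power of \<open>k \<otimes> l\<close>.\<close>
  have "\<exists>n::nat. (k \<otimes> l) [^] n \<otimes> (l \<otimes> \<alpha> k) = (k \<otimes> l) [^] n \<otimes> (k \<otimes> \<alpha> l)"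
    if k: "k \<in> F" and l: "l \<in> F" for k l
  proof (rule hfrac_eq_on_D_plus[OF mult_G[OF kG[OF k] kG[OF l]]])
    show "0 < \<epsilon> k + \<epsilon> l" using \<epsilon>[OF k] \<epsilon>[OF l] by simp
    fix Q assume "Q \<in> D_plus S G (k \<otimes> l)"
    then have Q: "Q \<in> Proj S G" "k \<notin> Q" "l \<notin> Q"
      using k l unfolding D_plus_def by (auto simp: Proj_mult)
    show "(\<alpha> k, k) \<in> fractions_at G m Q \<and> (\<alpha> l, l) \<in> fractions_at G m Q"
      unfolding fractions_at_iff using kG \<alpha>G k l Q by blast
    show "hfrac S G m Q (\<alpha> k) k = hfrac S G m Q (\<alpha> l) l"
      using sk[OF k, of Q] sk[OF l, of Q] Q unfolding D_plus_def by simp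
  qed (use k l in auto)
  then obtain n :: "'s \<Rightarrow> 's \<Rightarrow> nat" where n: "\<And>k l. k \<in> F \<Longrightarrow> l \<in> F \<Longrightarrow>
      (k \<otimes> l) [^] n k l \<otimes> (l \<otimes> \<alpha> k) = (k \<otimes> l) [^] n k l \<otimes> (k \<otimes> \<alpha> l)"
    by metis
  \<comment> \<open>A common exponent: the sum dominates every \<open>n k l\<close>.\<close>
  define M where "M = (\<Sum>k\<in>F. \<Sum>l\<in>F. n k l)"
  have n_le: "n k l \<le> M" if "k \<in> F" "l \<in> F" for k l
  proof -
    have "n k l \<le> (\<Sum>l\<in>F. n k l)" using member_le_sum[of l F "n k"] that F(2) by simp
    also have "\<dots> \<le> M"
      unfolding M_def using member_le_sum[of k F "\<lambda>k. \<Sum>l\<in>F. n k l"] that F(2) by simp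
    finally show ?thesis .
  qed
  \<comment> \<open>Expanding each fraction by \<open>k [^] M\<close> turns agreement up to powers
    into an exact identity between the new numerators, over the denominators
    \<open>k [^] Suc M\<close>.\<close>
  define \<alpha>' where "\<alpha>' k = k [^] M \<otimes> \<alpha> k" for k
  have \<alpha>'c [simp]: "\<alpha>' k \<in> carrier S" if "k \<in> F" for k
    unfolding \<alpha>'_def using that by simp
  have \<alpha>': "l [^] Suc M \<otimes> \<alpha>' k = k [^] Suc M \<otimes> \<alpha>' l" if k: "k \<in> F" and l: "l \<in> F" for k l
  proof -
    have split: "(k \<otimes> l) [^] M = (k \<otimes> l) [^] (M - n k l) \<otimes> (k \<otimes> l) [^] n k l"
      using k l n_le[OF k l] by (simp add: nat_pow_mult)
    have "(k \<otimes> l) [^] M \<otimes> (l \<otimes> \<alpha> k) = (k \<otimes> l) [^] M \<otimes> (k \<otimes> \<alpha> l)"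
      unfolding split using k l n[OF k l] by (simp add: m_assoc)
    moreover have "l [^] Suc M \<otimes> \<alpha>' k = (k \<otimes> l) [^] M \<otimes> (l \<otimes> \<alpha> k)"
      "k [^] Suc M \<otimes> \<alpha>' l = (k \<otimes> l) [^] M \<otimes> (k \<otimes> \<alpha> l)"
      unfolding \<alpha>'_def using k l by (simp_all add: nat_pow_distrib m_ac)
    ultimately show ?thesis by simp
  qed
  \<comment> \<open>A prime contains \<open>k [^] Suc M\<close> only if it contains
    \<open>k\<close>, so the new denominators cover D_+(f) as well.\<close>
  define F' where "F' = (\<lambda>k. k [^] Suc M) ` F"
  have powG: "k [^] j \<in> G (of_nat j * \<epsilon> k)" if "k \<in> F" for k and j :: nat
    using pow_G[OF kG[OF that]] .
  have "F' \<subseteq> homogeneous" unfolding F'_def using homI[OF powG] by blast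
  moreover have "\<exists>t\<in>F'. t \<notin> P" if P: "P \<in> D_plus S G f" for P
  proof -
    obtain k where k: "k \<in> F" "k \<notin> P" using F_cover[OF P] by blast
    have "P \<in> Proj S G" using P unfolding D_plus_def by blast
    then have "k [^] Suc M \<notin> P" using k by (intro Proj_pow) auto
    then show ?thesis unfolding F'_def using k(1) by blast
  qed
  ultimately obtain N :: nat where N: "f [^] N \<in> genideal S F'"
    using D_plus_covered[OF _ f, of F'] by blast
  \<comment> \<open>The \<open>x\<close> with \<open>x s\<close> represented by an element of \<open>S\<close> form an ideal.\<close>
  let ?J = "{x \<in> carrier S. \<exists>a\<in>carrier S. \<forall>l\<in>F. l [^] Suc M \<otimes> a = x \<otimes> \<alpha>' l}"
  have J_mult: "x \<otimes> y \<in> ?J" if x: "x \<in> ?J" and y: "y \<in> carrier S" for x y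
  proof -
    obtain a where a: "a \<in> carrier S" "\<And>l. l \<in> F \<Longrightarrow> l [^] Suc M \<otimes> a = x \<otimes> \<alpha>' l" using x by blast
    have "l [^] Suc M \<otimes> (a \<otimes> y) = x \<otimes> y \<otimes> \<alpha>' l" if l: "l \<in> F" for l
    proof -
      have "l [^] Suc M \<otimes> (a \<otimes> y) = (l [^] Suc M \<otimes> a) \<otimes> y"
        using a(1) y l by (simp add: m_assoc del: nat_pow_Suc)
      also have "\<dots> = x \<otimes> y \<otimes> \<alpha>' l"
        unfolding a(2)[OF l] using x y l m_comm[of "\<alpha>' l" y] by (simp add: m_assoc)
      finally show ?thesis .
    qed
    moreover have "a \<otimes> y \<in> carrier S" "x \<otimes> y \<in> carrier S" using a(1) x y by auto
    ultimately show ?thesis by blast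
  qed
  have "ideal ?J S"
  proof (rule idealI)
    show "ring S" by (rule ring_axioms)
    show "subgroup ?J (add_monoid S)"
    proof (rule add.subgroupI)
      have "\<zero> \<in> ?J" by (auto intro!: bexI[of _ \<zero>])
      then show "?J \<noteq> {}" by blast
      fix x assume x: "x \<in> ?J"
      then have "x \<otimes> \<ominus> \<one> \<in> ?J" by (intro J_mult) auto
      then show "\<ominus> x \<in> ?J" using x by (simp add: r_minus)
      fix y assume y: "y \<in> ?J"
      obtain a where a: "a \<in> carrier S" "\<And>l. l \<in> F \<Longrightarrow> l [^] Suc M \<otimes> a = x \<otimes> \<alpha>' l" using x by blast
      obtain b where b: "b \<in> carrier S" "\<And>l. l \<in> F \<Longrightarrow> l [^] Suc M \<otimes> b = y \<otimes> \<alpha>' l" using y by blast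
      have "l [^] Suc M \<otimes> (a \<oplus> b) = (x \<oplus> y) \<otimes> \<alpha>' l" if l: "l \<in> F" for l
        using a(1) b(1) a(2)[OF l] b(2)[OF l] l x y by (simp add: r_distr l_distr del: nat_pow_Suc)
      moreover have "a \<oplus> b \<in> carrier S" "x \<oplus> y \<in> carrier S" using a(1) b(1) x y by auto
      ultimately show "x \<oplus> y \<in> ?J" by blast
    qed auto
    fix x y assume xy: "x \<in> ?J" "y \<in> carrier S"
    show "x \<otimes> y \<in> ?J" using J_mult[OF xy] .
    moreover have "y \<otimes> x = x \<otimes> y" using xy by (intro m_comm) auto
    ultimately show "y \<otimes> x \<in> ?J" by (simp only:)
  qed
  moreover have "F' \<subseteq> ?J"
  proof
    fix t assume "t \<in> F'"
    then obtain k where k: "k \<in> F" "t = k [^] Suc M" unfolding F'_def by blast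
    \<comment> \<open>The exact identity says that \<open>\<alpha>' k\<close> is the numerator
      belonging to \<open>x = k [^] Suc M\<close>.\<close>
    then show "t \<in> ?J" using \<alpha>'[of k] by (intro CollectI conjI bexI[of _ "\<alpha>' k"] ballI) auto
  qed
  ultimately have "genideal S F' \<subseteq> ?J" by (rule genideal_minimal)
  then obtain a where a: "a \<in> carrier S" "\<And>l. l \<in> F \<Longrightarrow> l [^] Suc M \<otimes> a = f [^] N \<otimes> \<alpha>' l"
    using N by blast
  \<comment> \<open>\<open>a\<close> need not be homogeneous; its component in the degree of a
    numerator over \<open>f [^] N\<close> satisfies the same equations, because their right-hand
    sides are homogeneous.\<close>
  define b where "b = comp (m + of_nat N * \<delta>) a"
  have bG: "b \<in> G (m + of_nat N * \<delta>)" unfolding b_def by (rule comp_G[OF a(1)])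
  have fN: "f [^] N \<in> G (of_nat N * \<delta>)" by (rule pow_G[OF f(1)])
  have \<alpha>'G: "\<alpha>' l \<in> G (m + of_nat (Suc M) * \<epsilon> l)" if l: "l \<in> F" for l
    unfolding \<alpha>'_def using mult_G[OF powG[OF l, of M] \<alpha>G[OF l]] by (simp add: algebra_simps)
  have b: "l [^] Suc M \<otimes> b = f [^] N \<otimes> \<alpha>' l" if l: "l \<in> F" for l
  proof -
    let ?E = "of_nat N * \<delta> + (m + of_nat (Suc M) * \<epsilon> l)"
    have "comp ?E (l [^] Suc M \<otimes> a) = l [^] Suc M \<otimes> b"
      unfolding b_def comp_mult[OF powG[OF l] a(1)] by (simp add: algebra_simps)
    moreover have "comp ?E (f [^] N \<otimes> \<alpha>' l) = f [^] N \<otimes> \<alpha>' l"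
      using mult_G[OF fN \<alpha>'G[OF l]] unfolding mem_G_iff by blast
    ultimately show ?thesis using a(2)[OF l] by simp
  qed
  have "s Q = hfrac S G m Q b (f [^] N)" if Q: "Q \<in> D_plus S G f" for Q
  proof -
    obtain l where l: "l \<in> F" "l \<notin> Q" using F_cover[OF Q] by blast
    have QP: "Q \<in> Proj S G" "f \<notin> Q" using Q unfolding D_plus_def by auto
    have lM: "l [^] M \<in> homogeneous" "l [^] M \<notin> Q"
      using homI[OF powG[OF l(1)]] Proj_pow[OF QP(1) kc[OF l(1)] l(2)] by auto
    have fr0: "(\<alpha> l, l) \<in> fractions_at G m Q"
      unfolding fractions_at_iff using kG[OF l(1)] \<alpha>G[OF l(1)] l(2) by blast
    have l_pow: "l [^] Suc M = l [^] M \<otimes> l" by simp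
    have fr1: "(\<alpha>' l, l [^] Suc M) \<in> fractions_at G m Q"
      and eq1: "hfrac S G m Q (\<alpha>' l) (l [^] Suc M) = hfrac S G m Q (\<alpha> l) l"
      using hfrac_cancel[OF QP(1) fr0 lM] unfolding \<alpha>'_def l_pow by auto
    have fr2: "(b, f [^] N) \<in> fractions_at G m Q"
      unfolding fractions_at_iff using bG fN Proj_pow[OF QP(1) fc QP(2)] by blast
    have "\<one> \<otimes> (f [^] N \<otimes> \<alpha>' l) = \<one> \<otimes> (l [^] Suc M \<otimes> b)" using b[OF l(1)] by simp
    then have "hfrac S G m Q (\<alpha>' l) (l [^] Suc M) = hfrac S G m Q b (f [^] N)"
      unfolding hfrac_eq_iff[OF QP(1) fr1 fr2] using one_hom Proj_one[OF QP(1)] by blast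
    then show ?thesis using sk[OF l(1), of Q] eq1 QP(1) l(2) unfolding D_plus_def by simp
  qed
  then show ?thesis using bG by blast
qed

end


section \<open>Laurent polynomials with rational exponents\<close>

definition finsupp :: "('a, 'r) ring_scheme \<Rightarrow> (nat \<Rightarrow> rat) set \<Rightarrow> ((nat \<Rightarrow> rat) \<Rightarrow> 'a) set" where
  "finsupp R E = {p. range p \<subseteq> carrier R \<and> finite {r. p r \<noteq> \<zero>\<^bsub>R\<^esub>} \<and> {r. p r \<noteq> \<zero>\<^bsub>R\<^esub>} \<subseteq> E}"

text \<open>The operations of \<open>qpoly_ring\<close> do not depend on the number of variables, so
  the \<open>0\<close> is an arbitrary choice and all exponent sets share one product. An
  \<open>E\<close> closed under addition gives rings such as \<open>S\<close>; other sets, such as a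
  single degree, give only modules.\<close>

definition laurent :: "('a, 'r) ring_scheme \<Rightarrow> (nat \<Rightarrow> rat) set \<Rightarrow> ('a, (nat \<Rightarrow> rat) \<Rightarrow> 'a) module" where
  "laurent R E = (qpoly_ring R 0)\<lparr>carrier := finsupp R E\<rparr>"

lemma qpoly_ring_eq_laurent: "qpoly_ring R n = laurent R (exponents n)"
  by (simp add: qpoly_ring_def laurent_def finsupp_def)

lemma laurent_simps [simp]:
  "carrier (laurent R E) = finsupp R E"
  "\<zero>\<^bsub>laurent R E\<^esub> = (\<lambda>_. \<zero>\<^bsub>R\<^esub>)"
  "p \<oplus>\<^bsub>laurent R E\<^esub> q = (\<lambda>r. p r \<oplus>\<^bsub>R\<^esub> q r)"
  "c \<odot>\<^bsub>laurent R E\<^esub> p = (\<lambda>r. c \<otimes>\<^bsub>R\<^esub> p r)"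
  by (simp_all add: laurent_def qpoly_ring_def)

lemma laurent_one: "\<one>\<^bsub>laurent R E\<^esub> = (\<lambda>r. if r = (\<lambda>_. 0) then \<one>\<^bsub>R\<^esub> else \<zero>\<^bsub>R\<^esub>)"
  by (simp add: laurent_def qpoly_ring_def)

section \<open>Arithmetic of Laurent polynomials, reduced to shifts by monomials\<close>

context cring
begin

definition lmult (infixl "\<star>" 70) where "p \<star> q = p \<otimes>\<^bsub>laurent R UNIV\<^esub> q"

definition monom :: "'a \<Rightarrow> (nat \<Rightarrow> rat) \<Rightarrow> (nat \<Rightarrow> rat) \<Rightarrow> 'a" where
  "monom c s = (\<lambda>r. if r = s then c else \<zero>)"

lemma laurent_mult [simp]: "p \<otimes>\<^bsub>laurent R E\<^esub> q = p \<star> q"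
  by (simp add: lmult_def laurent_def)

lemma lmult_apply: "(p \<star> q) r = (\<Oplus>s\<in>{s. p s \<noteq> \<zero>}. p s \<otimes> q (\<lambda>i. r i - s i))"
  by (simp add: lmult_def laurent_def qpoly_ring_def)

lemma finsupp_closed [simp, intro]: "p \<in> finsupp R E \<Longrightarrow> p r \<in> carrier R"
  unfolding finsupp_def by auto

lemma finsupp_finite: "p \<in> finsupp R E \<Longrightarrow> finite {r. p r \<noteq> \<zero>}"
  unfolding finsupp_def by auto

lemma finsuppD: "p \<in> finsupp R E \<Longrightarrow> p r \<noteq> \<zero> \<Longrightarrow> r \<in> E"
  unfolding finsupp_def by auto

lemma finsuppI:
  assumes "\<And>r. p r \<in> carrier R" "finite {r. p r \<noteq> \<zero>}" "\<And>r. p r \<noteq> \<zero> \<Longrightarrow> r \<in> E"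
  shows "p \<in> finsupp R E"
  using assms unfolding finsupp_def by auto

lemma finsupp_mono: "p \<in> finsupp R E \<Longrightarrow> E \<subseteq> E' \<Longrightarrow> p \<in> finsupp R E'"
  unfolding finsupp_def by auto

lemma finsupp_UNIV: "p \<in> finsupp R E \<Longrightarrow> p \<in> finsupp R UNIV"
  by (rule finsupp_mono) auto

lemma finsupp_zero [simp]: "(\<lambda>_. \<zero>) \<in> finsupp R E"
  by (rule finsuppI) auto

lemma finsupp_map2:
  assumes p: "p \<in> finsupp R E" and q: "q \<in> finsupp R E"
    and f: "\<And>x y. x \<in> carrier R \<Longrightarrow> y \<in> carrier R \<Longrightarrow> f x y \<in> carrier R" "f \<zero> \<zero> = \<zero>"
  shows "(\<lambda>r. f (p r) (q r)) \<in> finsupp R E"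
proof (rule finsuppI)
  have sub: "{r. f (p r) (q r) \<noteq> \<zero>} \<subseteq> {r. p r \<noteq> \<zero>} \<union> {r. q r \<noteq> \<zero>}" using f(2) by auto
  then show "finite {r. f (p r) (q r) \<noteq> \<zero>}"
    by (rule finite_subset) (use finsupp_finite p q in auto)
  show "f (p r) (q r) \<in> carrier R" for r using p q f(1) by auto
  show "r \<in> E" if "f (p r) (q r) \<noteq> \<zero>" for r
    using that sub finsuppD[OF p, of r] finsuppD[OF q, of r] by auto
qed

lemma finsupp_add: "p \<in> finsupp R E \<Longrightarrow> q \<in> finsupp R E \<Longrightarrow> (\<lambda>r. p r \<oplus> q r) \<in> finsupp R E"
  by (rule finsupp_map2) auto

lemma finsupp_neg: "p \<in> finsupp R E \<Longrightarrow> (\<lambda>r. \<ominus> p r) \<in> finsupp R E"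
  by (rule finsupp_map2[of p E p "\<lambda>x y. \<ominus> x"]) auto

lemma finsupp_smult: "c \<in> carrier R \<Longrightarrow> p \<in> finsupp R E \<Longrightarrow> (\<lambda>r. c \<otimes> p r) \<in> finsupp R E"
  by (rule finsupp_map2[of p E p "\<lambda>x y. c \<otimes> x"]) auto

lemma finsupp_restrict:
  assumes p: "p \<in> finsupp R E"
  shows "(\<lambda>r. if Q r then p r else \<zero>) \<in> finsupp R {r \<in> E. Q r}"
proof (rule finsuppI)
  show "finite {r. (if Q r then p r else \<zero>) \<noteq> \<zero>}"
    by (rule finite_subset[OF _ finsupp_finite[OF p]]) auto
qed (use p finsuppD in \<open>auto split: if_splits\<close>)

lemma monom_finsupp: "c \<in> carrier R \<Longrightarrow> s \<in> E \<Longrightarrow> monom c s \<in> finsupp R E"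
  by (rule finsuppI) (auto simp: monom_def split: if_splits)

lemma finsupp_induct [consumes 1, case_names zero add]:
  assumes "p \<in> finsupp R E" and zero: "P (\<lambda>_. \<zero>)"
    and add: "\<And>c s p. c \<in> carrier R \<Longrightarrow> s \<in> E \<Longrightarrow> p \<in> finsupp R E \<Longrightarrow> P p \<Longrightarrow> P (\<lambda>r. monom c s r \<oplus> p r)"
  shows "P p"
  using assms(1)
proof (induction "card {r. p r \<noteq> \<zero>}" arbitrary: p)
  case 0
  then have "{r. p r \<noteq> \<zero>} = {}" using finsupp_finite by simp
  then have "p = (\<lambda>_. \<zero>)" by auto
  then show ?case using zero by simp
next
  case (Suc k)
  have "{r. p r \<noteq> \<zero>} \<noteq> {}" using Suc.hyps(2) by (metis card.empty nat.distinct(1))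
  then obtain s where s: "p s \<noteq> \<zero>" by blast
  let ?q = "\<lambda>r. if r \<noteq> s then p r else \<zero>"
  have q: "?q \<in> finsupp R E"
    using finsupp_restrict[OF Suc.prems, of "\<lambda>r. r \<noteq> s"] by (rule finsupp_mono) auto
  have "{r. p r \<noteq> \<zero>} = insert s {r. ?q r \<noteq> \<zero>}" using s by auto
  then have "Suc k = Suc (card {r. ?q r \<noteq> \<zero>})"
    using Suc.hyps(2) finsupp_finite[OF q] by (simp add: card_insert_disjoint)
  then have "P ?q" by (intro Suc.hyps(1) q) simp
  moreover have "p = (\<lambda>r. monom (p s) s r \<oplus> ?q r)"
  proof
    fix r
    show "p r = monom (p s) s r \<oplus> ?q r"
      using Suc.prems by (cases "r = s") (auto simp: monom_def)
  qed
  ultimately show ?case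
    using add[of "p s" s ?q] finsuppD[OF Suc.prems s] q Suc.prems by auto
qed

text \<open>Enlarging the range of summation allows products whose left factors have different
  supports to be compared termwise.\<close>

lemma lmult_superset:
  assumes "p \<in> finsupp R UNIV" "q \<in> finsupp R UNIV" "finite A" "{s. p s \<noteq> \<zero>} \<subseteq> A"
  shows "(p \<star> q) r = (\<Oplus>s\<in>A. p s \<otimes> q (\<lambda>i. r i - s i))"
  unfolding lmult_apply
  by (rule add.finprod_mono_neutral_cong_left) (use assms in auto)

lemma lmult_finsupp:
  assumes p: "p \<in> finsupp R E" and q: "q \<in> finsupp R E'"
    and E: "\<And>s t. s \<in> E \<Longrightarrow> t \<in> E' \<Longrightarrow> (\<lambda>i. s i + t i) \<in> E''"
  shows "p \<star> q \<in> finsupp R E''"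
proof (rule finsuppI)
  let ?A = "(\<lambda>(s, t). \<lambda>i. s i + t i) ` ({s. p s \<noteq> \<zero>} \<times> {t. q t \<noteq> \<zero>})"
  have supp: "r \<in> ?A" if nz: "(p \<star> q) r \<noteq> \<zero>" for r
  proof -
    have "\<exists>s. p s \<noteq> \<zero> \<and> q (\<lambda>i. r i - s i) \<noteq> \<zero>"
    proof (rule ccontr)
      assume "\<not> ?thesis"
      then have "(p \<star> q) r = (\<Oplus>s\<in>{s. p s \<noteq> \<zero>}. \<zero>)"
        unfolding lmult_apply using p by (intro finsum_cong') auto
      then show False using nz by simp
    qed
    then obtain s where "p s \<noteq> \<zero>" "q (\<lambda>i. r i - s i) \<noteq> \<zero>" by blast
    then show ?thesis by (intro image_eqI[of _ _ "(s, \<lambda>i. r i - s i)"]) auto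
  qed
  show "(p \<star> q) r \<in> carrier R" for r
    unfolding lmult_apply using p q by (intro finsum_closed) auto
  show "finite {r. (p \<star> q) r \<noteq> \<zero>}"
    by (rule finite_subset[of _ ?A]) (use supp finsupp_finite[OF p] finsupp_finite[OF q] in auto)
  show "r \<in> E''" if "(p \<star> q) r \<noteq> \<zero>" for r
    using supp[OF that] E finsuppD[OF p] finsuppD[OF q] by auto
qed

lemma lmult_closed: "p \<in> finsupp R UNIV \<Longrightarrow> q \<in> finsupp R UNIV \<Longrightarrow> p \<star> q \<in> finsupp R UNIV"
  by (rule lmult_finsupp) auto

lemma lmult_l_distr:
  assumes "p \<in> finsupp R UNIV" "p' \<in> finsupp R UNIV" "q \<in> finsupp R UNIV"
  shows "(\<lambda>r. p r \<oplus> p' r) \<star> q = (\<lambda>r. (p \<star> q) r \<oplus> (p' \<star> q) r)"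
proof
  fix r
  let ?A = "{s. p s \<noteq> \<zero>} \<union> {s. p' s \<noteq> \<zero>}"
  have fin: "finite ?A" using finsupp_finite assms by blast
  have "((\<lambda>r. p r \<oplus> p' r) \<star> q) r = (\<Oplus>s\<in>?A. (p s \<oplus> p' s) \<otimes> q (\<lambda>i. r i - s i))"
    by (rule lmult_superset) (use assms fin finsupp_add in auto)
  also have "\<dots> = (\<Oplus>s\<in>?A. p s \<otimes> q (\<lambda>i. r i - s i) \<oplus> p' s \<otimes> q (\<lambda>i. r i - s i))"
    using assms by (intro finsum_cong' refl) (auto simp: l_distr)
  also have "\<dots> = (\<Oplus>s\<in>?A. p s \<otimes> q (\<lambda>i. r i - s i)) \<oplus> (\<Oplus>s\<in>?A. p' s \<otimes> q (\<lambda>i. r i - s i))"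
    using assms by (intro finsum_addf) auto
  also have "(\<Oplus>s\<in>?A. p s \<otimes> q (\<lambda>i. r i - s i)) = (p \<star> q) r"
    using assms fin by (intro lmult_superset[symmetric]) auto
  also have "(\<Oplus>s\<in>?A. p' s \<otimes> q (\<lambda>i. r i - s i)) = (p' \<star> q) r"
    using assms fin by (intro lmult_superset[symmetric]) auto
  finally show "((\<lambda>r. p r \<oplus> p' r) \<star> q) r = (p \<star> q) r \<oplus> (p' \<star> q) r" .
qed

lemma lmult_r_distr:
  assumes "p \<in> finsupp R UNIV" "q \<in> finsupp R UNIV" "q' \<in> finsupp R UNIV"
  shows "p \<star> (\<lambda>r. q r \<oplus> q' r) = (\<lambda>r. (p \<star> q) r \<oplus> (p \<star> q') r)"
proof
  fix r
  let ?A = "{s. p s \<noteq> \<zero>}"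
  have "(p \<star> (\<lambda>r. q r \<oplus> q' r)) r = (\<Oplus>s\<in>?A. p s \<otimes> q (\<lambda>i. r i - s i) \<oplus> p s \<otimes> q' (\<lambda>i. r i - s i))"
    unfolding lmult_apply using assms by (intro finsum_cong' refl) (auto simp: r_distr)
  also have "\<dots> = (p \<star> q) r \<oplus> (p \<star> q') r"
    unfolding lmult_apply using assms by (intro finsum_addf) auto
  finally show "(p \<star> (\<lambda>r. q r \<oplus> q' r)) r = (p \<star> q) r \<oplus> (p \<star> q') r" .
qed

lemma lmult_zero [simp]:
  shows "(\<lambda>_. \<zero>) \<star> q = (\<lambda>_. \<zero>)"
    and "p \<in> finsupp R UNIV \<Longrightarrow> p \<star> (\<lambda>_. \<zero>) = (\<lambda>_. \<zero>)"
proof -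
  show "(\<lambda>_. \<zero>) \<star> q = (\<lambda>_. \<zero>)" by (simp add: lmult_apply fun_eq_iff)
  assume p: "p \<in> finsupp R UNIV"
  have "(p \<star> (\<lambda>_. \<zero>)) r = (\<Oplus>s\<in>{s. p s \<noteq> \<zero>}. \<zero>)" for r
    unfolding lmult_apply using p by (intro finsum_cong') auto
  then show "p \<star> (\<lambda>_. \<zero>) = (\<lambda>_. \<zero>)" by (simp add: fun_eq_iff)
qed

lemma monom_lmult:
  assumes "c \<in> carrier R" "q \<in> finsupp R UNIV"
  shows "monom c s \<star> q = (\<lambda>r. c \<otimes> q (\<lambda>i. r i - s i))"
proof
  fix r
  have "(monom c s \<star> q) r = (\<Oplus>t\<in>{s}. monom c s t \<otimes> q (\<lambda>i. r i - t i))"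
    by (rule lmult_superset) (use assms monom_finsupp in \<open>auto simp: monom_def\<close>)
  then show "(monom c s \<star> q) r = c \<otimes> q (\<lambda>i. r i - s i)"
    using assms by (simp add: monom_def finsupp_closed)
qed

lemma lmult_monom:
  assumes "c \<in> carrier R" "q \<in> finsupp R UNIV"
  shows "q \<star> monom c s = (\<lambda>r. c \<otimes> q (\<lambda>i. r i - s i))"
proof
  fix r
  let ?t = "\<lambda>i. r i - s i"
  have iff: "(\<lambda>i. r i - t i) = s \<longleftrightarrow> t = ?t" for t by (auto simp: fun_eq_iff algebra_simps)
  have "(q \<star> monom c s) r = (\<Oplus>t\<in>insert ?t {t. q t \<noteq> \<zero>}. q t \<otimes> monom c s (\<lambda>i. r i - t i))"
    by (rule lmult_superset) (use assms finsupp_finite[OF assms(2)] in \<open>auto intro: monom_finsupp\<close>)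
  also have "\<dots> = (\<Oplus>t\<in>insert ?t {t. q t \<noteq> \<zero>}. if ?t = t then c \<otimes> q t else \<zero>)"
    unfolding monom_def iff using assms by (intro finsum_cong' refl) (auto simp: m_comm)
  also have "\<dots> = c \<otimes> q ?t"
    using assms finsupp_finite[OF assms(2)] by (subst finsum_singleton) auto
  finally show "(q \<star> monom c s) r = c \<otimes> q ?t" .
qed

text \<open>The convolution sums over the support of the left factor, so symmetry is not visible. On
  monomials both products are shifts, and additivity does the rest.\<close>

lemma lmult_comm:
  assumes "p \<in> finsupp R UNIV" "q \<in> finsupp R UNIV"
  shows "p \<star> q = q \<star> p"
  using assms(1)
proof (induction rule: finsupp_induct)
  case (add c s p)
  then show ?case
    using assms(2) monom_finsupp[of c s UNIV]
    by (simp add: lmult_l_distr lmult_r_distr monom_lmult lmult_monom)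
qed (use assms in simp)

text \<open>Additivity in the first two factors reduces the identity to monomials, where shifts
  compose.\<close>

lemma lmult_assoc:
  assumes p: "p \<in> finsupp R UNIV" and q: "q \<in> finsupp R UNIV" and w: "w \<in> finsupp R UNIV"
  shows "(p \<star> q) \<star> w = p \<star> (q \<star> w)"
proof -
  have diff: "(\<lambda>i. r i - s i - t i) = (\<lambda>i. r i - (t i + s i))" for r s t :: "nat \<Rightarrow> rat"
    by (simp add: algebra_simps)
  have mono: "(monom c s \<star> q) \<star> w = monom c s \<star> (q \<star> w)" if c: "c \<in> carrier R" for c s
    using q
  proof (induction rule: finsupp_induct)
    case zero
    show ?case using c w by (simp add: monom_finsupp)
  next
    case (add d t q)
    have m: "monom c s \<in> finsupp R UNIV" "monom d t \<in> finsupp R UNIV"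
      using c add.hyps(1) by (auto intro: monom_finsupp)
    have "monom c s \<star> monom d t = monom (c \<otimes> d) (\<lambda>i. t i + s i)"
      unfolding monom_lmult[OF c m(2)] using c by (auto simp: monom_def fun_eq_iff algebra_simps)
    then have "(monom c s \<star> monom d t) \<star> w = monom c s \<star> (monom d t \<star> w)"
      using c add.hyps(1) w lmult_closed[OF m(2) w]
      by (simp add: monom_lmult diff m_assoc finsupp_closed)
    then show ?case
      using add m w lmult_closed by (simp add: lmult_l_distr lmult_r_distr)
  qed
  show ?thesis
    using p
  proof (induction rule: finsupp_induct)
    case (add c s p)
    then show ?case
      using monom_finsupp[of c s UNIV] q w lmult_closed mono by (simp add: lmult_l_distr)
  qed simp
qed

lemma laurent_abelian_group: "abelian_group (laurent R E)"
proof (rule abelian_groupI)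
  fix p assume "p \<in> carrier (laurent R E)"
  then show "\<exists>q\<in>carrier (laurent R E). q \<oplus>\<^bsub>laurent R E\<^esub> p = \<zero>\<^bsub>laurent R E\<^esub>"
    by (intro bexI[of _ "\<lambda>r. \<ominus> p r"]) (auto simp: finsupp_neg l_neg)
next
  fix p q w assume "p \<in> carrier (laurent R E)" "q \<in> carrier (laurent R E)" "w \<in> carrier (laurent R E)"
  then show "p \<oplus>\<^bsub>laurent R E\<^esub> q \<oplus>\<^bsub>laurent R E\<^esub> w = p \<oplus>\<^bsub>laurent R E\<^esub> (q \<oplus>\<^bsub>laurent R E\<^esub> w)"
    by (simp add: a_assoc finsupp_closed)
qed (auto simp: finsupp_add a_comm)

lemma laurent_module: "module R (laurent R E)"
proof (rule moduleI[OF is_cring laurent_abelian_group])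
qed (auto simp: finsupp_smult l_distr r_distr m_assoc)

lemma laurent_a_inv:
  assumes "p \<in> finsupp R E"
  shows "\<ominus>\<^bsub>laurent R E\<^esub> p = (\<lambda>r. \<ominus> p r)"
proof -
  interpret L: abelian_group "laurent R E" by (rule laurent_abelian_group)
  show ?thesis
    by (rule L.minus_equality) (use assms in \<open>auto simp: finsupp_neg l_neg\<close>)
qed

lemma laurent_cring:
  assumes E: "(\<lambda>_. 0) \<in> E" "\<And>s t. s \<in> E \<Longrightarrow> t \<in> E \<Longrightarrow> (\<lambda>i. s i + t i) \<in> E"
  shows "cring (laurent R E)"
proof (rule cringI[OF laurent_abelian_group])
  have one: "\<one>\<^bsub>laurent R E\<^esub> = monom \<one> (\<lambda>_. 0)" by (simp add: laurent_one monom_def)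
  show "comm_monoid (laurent R E)"
  proof (rule comm_monoidI)
    show "\<one>\<^bsub>laurent R E\<^esub> \<in> carrier (laurent R E)"
      unfolding one using E by (simp add: monom_finsupp)
    show "\<one>\<^bsub>laurent R E\<^esub> \<otimes>\<^bsub>laurent R E\<^esub> p = p" if "p \<in> carrier (laurent R E)" for p
      unfolding one using that finsupp_UNIV[of p E] by (simp add: monom_lmult)
  qed (use E finsupp_UNIV in \<open>auto intro: lmult_finsupp lmult_assoc lmult_comm\<close>)
qed (use finsupp_UNIV in \<open>auto simp: lmult_l_distr\<close>)

text \<open>Scalar multiplication is multiplication by a constant monomial.\<close>

lemma smult_lmult:
  assumes "c \<in> carrier R" "p \<in> finsupp R UNIV" "q \<in> finsupp R UNIV"
  shows "p \<star> (\<lambda>r. c \<otimes> q r) = (\<lambda>r. c \<otimes> (p \<star> q) r)"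
proof -
  have sm: "(\<lambda>r. c \<otimes> q r) = monom c (\<lambda>_. 0) \<star> q" if "q \<in> finsupp R UNIV" for q
    using monom_lmult[OF assms(1) that] by simp
  have m: "monom c (\<lambda>_. 0) \<in> finsupp R UNIV" using assms(1) by (simp add: monom_finsupp)
  show ?thesis
    using assms lmult_comm[OF assms(2) m] lmult_assoc[OF assms(2) m assms(3)]
      lmult_assoc[OF m assms(2,3)]
    by (simp add: sm lmult_closed)
qed

lemma laurent_finsum:
  assumes "finite A" "\<And>i. i \<in> A \<Longrightarrow> f i \<in> finsupp R E"
  shows "(\<Oplus>\<^bsub>laurent R E\<^esub>i\<in>A. f i) = (\<lambda>r. \<Oplus>i\<in>A. f i r)"
proof -
  interpret L: abelian_group "laurent R E" by (rule laurent_abelian_group)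
  show ?thesis
    using assms
  proof (induction A rule: finite_induct)
    case (insert a A)
    then have "f \<in> A \<rightarrow> carrier (laurent R E)" "f a \<in> carrier (laurent R E)" by auto
    moreover have "(\<lambda>i. f i r) \<in> A \<rightarrow> carrier R" "f a r \<in> carrier R" for r
      using insert.prems by (auto intro: finsupp_closed)
    ultimately show ?case
      using insert by (simp add: L.finsum_insert finsum_insert)
  qed simp
qed

end


subsection \<open>The grading\<close>

definition qcomp :: "('a, 'r) ring_scheme \<Rightarrow> nat \<Rightarrow> rat \<Rightarrow> ((nat \<Rightarrow> rat) \<Rightarrow> 'a) \<Rightarrow> ((nat \<Rightarrow> rat) \<Rightarrow> 'a)" where
  "qcomp R n d p = (\<lambda>r. if (\<Sum>i\<le>n. r i) = d then p r else \<zero>\<^bsub>R\<^esub>)"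

lemma qpoly_grading_eq: "qpoly_grading R n d = finsupp R {r \<in> exponents n. (\<Sum>i\<le>n. r i) = d}"
  unfolding qpoly_grading_def by (auto simp: qpoly_ring_eq_laurent finsupp_def)

context cring
begin

lemma qpoly_graded_ring: "graded_ring (qpoly_ring R n) (qpoly_grading R n) (qcomp R n)"
  unfolding qpoly_ring_eq_laurent qpoly_grading_eq
proof (rule graded_ring.intro)
  let ?E = "exponents n" and ?deg = "\<lambda>r :: nat \<Rightarrow> rat. \<Sum>i\<le>n. r i"
  let ?L = "laurent R ?E"
  show "cring ?L"
    by (rule laurent_cring) (auto simp: exponents_def)
  then interpret L: cring ?L .
  have cF: "qcomp R n d p \<in> finsupp R {r \<in> ?E. ?deg r = d}" if "p \<in> finsupp R ?E" for d p
    unfolding qcomp_def using finsupp_restrict[OF that] .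
  have cF': "qcomp R n d p \<in> finsupp R ?E" if "p \<in> finsupp R ?E" for d p
    using finsupp_mono[OF cF[OF that]] by blast
  have fin: "finite {d. qcomp R n d p \<noteq> (\<lambda>_. \<zero>)}" if "p \<in> finsupp R ?E" for p
  proof (rule finite_subset)
    show "finite (?deg ` {r. p r \<noteq> \<zero>})" using finsupp_finite[OF that] by blast
    show "{d. qcomp R n d p \<noteq> (\<lambda>_. \<zero>)} \<subseteq> ?deg ` {r. p r \<noteq> \<zero>}"
      by (auto simp: qcomp_def fun_eq_iff split: if_splits)
  qed
  show "graded_ring_axioms ?L (\<lambda>d. finsupp R {r \<in> ?E. ?deg r = d}) (qcomp R n)"
  proof (rule graded_ring_axioms.intro)
    show "finsupp R {r \<in> ?E. ?deg r = d} \<subseteq> carrier ?L" for d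
      using finsupp_mono by fastforce
    show "\<one>\<^bsub>?L\<^esub> \<in> finsupp R {r \<in> ?E. ?deg r = 0}"
      unfolding laurent_one by (rule finsuppI) (auto simp: exponents_def split: if_splits)
    show "finsupp R {r \<in> ?E. ?deg r = d} \<subseteq> {\<zero>\<^bsub>?L\<^esub>}" if "d < 0" for d
    proof
      fix p assume p: "p \<in> finsupp R {r \<in> ?E. ?deg r = d}"
      have "p r = \<zero>" for r
      proof (rule ccontr)
        assume "p r \<noteq> \<zero>"
        then have "r \<in> ?E" "?deg r = d" using finsuppD[OF p] by auto
        moreover from this have "?deg r \<ge> 0" unfolding exponents_def by (intro sum_nonneg) auto
        ultimately show False using that by simp
      qed
      then show "p \<in> {\<zero>\<^bsub>?L\<^esub>}" by auto
    qed
    show "qcomp R n d p \<in> finsupp R {r \<in> ?E. ?deg r = d}" if "p \<in> carrier ?L" for d p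
      using cF that by simp
    show "qcomp R n e p = (if e = d then p else \<zero>\<^bsub>?L\<^esub>)"
      if p: "p \<in> finsupp R {r \<in> ?E. ?deg r = d}" for e d p
    proof
      fix r
      show "qcomp R n e p r = (if e = d then p else \<zero>\<^bsub>?L\<^esub>) r"
        using finsuppD[OF p, of r] by (cases "p r = \<zero>") (auto simp: qcomp_def)
    qed
    show "qcomp R n d (p \<oplus>\<^bsub>?L\<^esub> q) = qcomp R n d p \<oplus>\<^bsub>?L\<^esub> qcomp R n d q" for d p q
      by (auto simp: qcomp_def)
    show "qcomp R n e (p \<otimes>\<^bsub>?L\<^esub> q) = p \<otimes>\<^bsub>?L\<^esub> qcomp R n (e - d) q"
      if p: "p \<in> finsupp R {r \<in> ?E. ?deg r = d}" and q: "q \<in> carrier ?L" for e d p q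
    proof
      fix r
      \<comment> \<open>Subtracting an exponent of \<open>p\<close> lowers the degree by exactly
        \<open>d\<close>, so selecting degree \<open>e\<close> in the product selects degree
        \<open>e - d\<close> in \<open>q\<close>.\<close>
      have deg: "?deg (\<lambda>i. r i - s i) = ?deg r - d" if "p s \<noteq> \<zero>" for s
        using finsuppD[OF p that] by (simp add: sum_subtractf)
      have "(p \<star> qcomp R n (e - d) q) r =
          (\<Oplus>s\<in>{s. p s \<noteq> \<zero>}. if ?deg r = e then p s \<otimes> q (\<lambda>i. r i - s i) else \<zero>)"
        unfolding lmult_apply qcomp_def using p q deg
        by (intro finsum_cong' refl) (auto simp: finsupp_closed)
      also have "\<dots> = qcomp R n e (p \<star> q) r"
        by (simp add: qcomp_def lmult_apply)
      finally show "qcomp R n e (p \<otimes>\<^bsub>?L\<^esub> q) r = (p \<otimes>\<^bsub>?L\<^esub> qcomp R n (e - d) q) r" by simp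
    qed
    show "finite {d. qcomp R n d p \<noteq> \<zero>\<^bsub>?L\<^esub>}" if "p \<in> carrier ?L" for p
      using fin that by simp
    show "p = (\<Oplus>\<^bsub>?L\<^esub>d\<in>{d. qcomp R n d p \<noteq> \<zero>\<^bsub>?L\<^esub>}. qcomp R n d p)" if p: "p \<in> carrier ?L" for p
    proof
      fix r
      let ?D = "{d. qcomp R n d p \<noteq> (\<lambda>_. \<zero>)}"
      have p': "p \<in> finsupp R ?E" using p by simp
      \<comment> \<open>The coefficient at \<open>r\<close> survives only in the component whose
        degree is that of \<open>r\<close>.\<close>
      have "(\<Oplus>\<^bsub>?L\<^esub>d\<in>?D. qcomp R n d p) r = (\<Oplus>d\<in>?D. if ?deg r = d then p r else \<zero>)"
        using laurent_finsum[OF fin[OF p'], of "\<lambda>d. qcomp R n d p" ?E] cF'[OF p']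
        by (simp add: qcomp_def)
      also have "\<dots> = p r"
      proof (cases "?deg r \<in> ?D")
        case True
        then show ?thesis using p' fin[OF p'] by (subst finsum_singleton) auto
      next
        case False
        then have "qcomp R n (?deg r) p r = \<zero>" by simp
        then have "p r = \<zero>" by (simp add: qcomp_def)
        then show ?thesis by (simp cong: if_cong)
      qed
      finally show "p r = (\<Oplus>\<^bsub>?L\<^esub>d\<in>{d. qcomp R n d p \<noteq> \<zero>\<^bsub>?L\<^esub>}. qcomp R n d p) r" by simp
    qed
  qed
qed

end


section \<open>Sections of the twisting sheaves on projective space\<close>

text \<open>The exponent of the \<open>N\<close>-th power of the product of the variables with index
  in \<open>\<sigma>\<close>.\<close>

definition indicator_exp :: "nat \<Rightarrow> nat set \<Rightarrow> nat \<Rightarrow> rat" where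
  "indicator_exp N \<sigma> = (\<lambda>i. if i \<in> \<sigma> then of_nat N else 0)"

text \<open>The exponents in degree \<open>m\<close> of \<open>S\<close> localized at the product of
  the variables in \<open>\<sigma>\<close>. The empty set gives the polynomials of degree
  \<open>m\<close>, and \<open>{..n}\<close> all Laurent polynomials of degree
  \<open>m\<close>.\<close>

definition laurent_exps :: "nat \<Rightarrow> nat set \<Rightarrow> rat \<Rightarrow> (nat \<Rightarrow> rat) set" where
  "laurent_exps n \<sigma> m = {r. (\<forall>i\<le>n. i \<notin> \<sigma> \<longrightarrow> 0 \<le> r i) \<and> (\<forall>i>n. r i = 0) \<and> (\<Sum>i\<le>n. r i) = m}"

lemma finite_le_of_nat:
  assumes "finite (A :: rat set)"
  shows "\<exists>N::nat. \<forall>x\<in>A. x \<le> of_nat N"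
proof (cases "A = {}")
  case False
  obtain N :: nat where "Max A \<le> of_nat N" using real_arch_simple by blast
  then show ?thesis using Max_ge[OF assms] order_trans by blast
qed simp

lemma sum_indicator_exp:
  assumes "\<sigma> \<subseteq> {..n}"
  shows "(\<Sum>i\<le>n. indicator_exp N \<sigma> i) = of_nat N * of_nat (card \<sigma>)"
proof -
  have "(\<Sum>i\<le>n. indicator_exp N \<sigma> i) = (\<Sum>i\<in>\<sigma>. of_nat N)"
    unfolding indicator_exp_def using assms by (simp add: sum.If_cases Int_absorb1)
  then show ?thesis by simp
qed

locale proj_space = cring R for R :: "('a, 'r) ring_scheme" (structure) +
  fixes n :: nat
begin

abbreviation "S \<equiv> qpoly_ring R n"
abbreviation "G \<equiv> qpoly_grading R n"
abbreviation "X \<equiv> monom \<one>"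
abbreviation "U \<equiv> (\<lambda>i. D_plus S G (qpoly_var R i))"
abbreviation "W \<sigma> \<equiv> (\<Inter>i\<in>\<sigma>. U i)"
abbreviation "F m \<equiv> twist_sheaf S G m"

sublocale S: graded_ring S G "qcomp R n"
  by (rule qpoly_graded_ring)

lemma S_simps [simp]:
  "carrier S = finsupp R (exponents n)"
  "\<zero>\<^bsub>S\<^esub> = (\<lambda>_. \<zero>)"
  "p \<oplus>\<^bsub>S\<^esub> q = (\<lambda>r. p r \<oplus> q r)"
  "p \<otimes>\<^bsub>S\<^esub> q = p \<star> q"
  "c \<odot>\<^bsub>S\<^esub> p = (\<lambda>r. c \<otimes> p r)"
  by (simp_all add: qpoly_ring_eq_laurent)

lemma one_S: "\<one>\<^bsub>S\<^esub> = X (\<lambda>_. 0)"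
  by (simp add: qpoly_ring_eq_laurent laurent_one monom_def)

lemma G_UNIV: "p \<in> G d \<Longrightarrow> p \<in> finsupp R UNIV"
  unfolding qpoly_grading_eq by (rule finsupp_UNIV)

lemma hom_UNIV: "p \<in> S.homogeneous \<Longrightarrow> p \<in> finsupp R UNIV"
  unfolding S.homogeneous_def using G_UNIV by blast

lemma lmult_lcomm:
  assumes "p \<in> finsupp R UNIV" "q \<in> finsupp R UNIV" "w \<in> finsupp R UNIV"
  shows "p \<star> (q \<star> w) = q \<star> (p \<star> w)"
  using assms lmult_assoc[of p q w] lmult_assoc[of q p w] lmult_comm[of p q] by simp

lemmas lmult_ac = lmult_assoc lmult_comm lmult_lcomm

lemma X_UNIV [simp]: "X u \<in> finsupp R UNIV"
  by (simp add: monom_finsupp)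

lemma X_carrier: "u \<in> exponents n \<Longrightarrow> X u \<in> finsupp R (exponents n)"
  by (simp add: monom_finsupp)

lemma X_lmult_apply:
  assumes "p \<in> finsupp R UNIV"
  shows "X u \<star> p = (\<lambda>r. p (\<lambda>i. r i - u i))"
  using assms by (simp add: monom_lmult finsupp_closed)

lemma X_lmult_X: "X u \<star> X v = X (\<lambda>i. u i + v i)"
proof
  fix r
  have "(\<lambda>i. r i - u i) = v \<longleftrightarrow> r = (\<lambda>i. u i + v i)"
    by (auto simp: fun_eq_iff algebra_simps)
  then show "(X u \<star> X v) r = X (\<lambda>i. u i + v i) r"
    unfolding X_lmult_apply[OF X_UNIV] by (simp add: monom_def)
qed

text \<open>Monomials are invertible among Laurent polynomials, so they cancel over every
  \<open>R\<close>.\<close>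

lemma X_lmult_inj:
  assumes p: "p \<in> finsupp R UNIV" and q: "q \<in> finsupp R UNIV" and eq: "X u \<star> p = X u \<star> q"
  shows "p = q"
proof
  fix r
  have "(X u \<star> p) (\<lambda>i. r i + u i) = (X u \<star> q) (\<lambda>i. r i + u i)" using eq by simp
  then show "p r = q r" by (simp add: X_lmult_apply p q)
qed

lemma X_G: "u \<in> exponents n \<Longrightarrow> (\<Sum>i\<le>n. u i) = d \<Longrightarrow> X u \<in> G d"
  unfolding qpoly_grading_eq by (rule monom_finsupp) auto

lemma qpoly_var_eq: "qpoly_var R i = X (indicator_exp (Suc 0) {i})"
  unfolding qpoly_var_def monom_def indicator_exp_def by (simp cong: if_cong)

lemma indicator_exp_exponents: "\<sigma> \<subseteq> {..n} \<Longrightarrow> indicator_exp N \<sigma> \<in> exponents n"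
  unfolding indicator_exp_def exponents_def by auto

lemma X_indicator_G: "\<sigma> \<subseteq> {..n} \<Longrightarrow> X (indicator_exp N \<sigma>) \<in> G (of_nat N * of_nat (card \<sigma>))"
  by (rule X_G[OF indicator_exp_exponents sum_indicator_exp])

lemma X_indicator_pow:
  "X (indicator_exp (Suc 0) \<sigma>) [^]\<^bsub>S\<^esub> N = X (indicator_exp N \<sigma>)"
proof (induction N)
  case 0
  show ?case by (simp add: one_S indicator_exp_def cong: if_cong)
next
  case (Suc N)
  have "(\<lambda>i. indicator_exp N \<sigma> i + indicator_exp (Suc 0) \<sigma> i) = indicator_exp (Suc N) \<sigma>"
    by (auto simp: indicator_exp_def)
  then show ?case using Suc by (simp add: X_lmult_X)
qed

lemma X_indicator_insert:
  "i \<notin> \<tau> \<Longrightarrow> X (indicator_exp (Suc 0) (insert i \<tau>)) = qpoly_var R i \<star> X (indicator_exp (Suc 0) \<tau>)"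
  unfolding qpoly_var_eq X_lmult_X by (rule arg_cong[of _ _ X]) (auto simp: indicator_exp_def)

text \<open>A prime misses the product exactly when it misses each factor. For empty
  \<open>\<sigma>\<close> the intersection would be the whole type, not
  \<open>Proj S G\<close>.\<close>

lemma W_eq_D_plus:
  assumes "\<sigma> \<noteq> {}" "\<sigma> \<subseteq> {..n}"
  shows "W \<sigma> = D_plus S G (X (indicator_exp (Suc 0) \<sigma>))"
proof -
  have fin: "finite \<sigma>" using assms(2) finite_subset by blast
  have "X (indicator_exp (Suc 0) \<sigma>) \<notin> Q \<longleftrightarrow> (\<forall>i\<in>\<sigma>. qpoly_var R i \<notin> Q)" if Q: "Q \<in> Proj S G" for Q
    using fin assms(2)
  proof (induction \<sigma> rule: finite_induct)
    case empty
    show ?case using S.Proj_one[OF Q] by (simp add: one_S indicator_exp_def)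
  next
    case (insert i \<tau>)
    have c: "qpoly_var R i \<in> carrier S" "X (indicator_exp (Suc 0) \<tau>) \<in> carrier S"
      using insert.prems indicator_exp_exponents[of "{i}" 1] indicator_exp_exponents[of \<tau> 1]
      by (auto simp: qpoly_var_eq X_carrier)
    show ?case
      using insert S.Proj_mult[OF Q c] by (simp add: X_indicator_insert)
  qed
  then show ?thesis unfolding D_plus_def using assms(1) by auto
qed

lemma W_Proj: "Q \<in> W \<sigma> \<Longrightarrow> \<sigma> \<noteq> {} \<Longrightarrow> Q \<in> Proj S G"
  unfolding D_plus_def by auto

lemma W_X_notin:
  assumes "\<sigma> \<noteq> {}" "\<sigma> \<subseteq> {..n}" "Q \<in> W \<sigma>"
  shows "X (indicator_exp N \<sigma>) \<notin> Q"
proof -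
  have "Q \<in> Proj S G" "X (indicator_exp (Suc 0) \<sigma>) \<notin> Q"
    using assms(3)[unfolded W_eq_D_plus[OF assms(1,2)]] by (auto simp: D_plus_def)
  then show ?thesis
    using S.Proj_pow[of Q "X (indicator_exp (Suc 0) \<sigma>)" N] X_carrier[OF indicator_exp_exponents[OF assms(2)]]
    by (simp add: X_indicator_pow)
qed

lemma laurent_exps_mono: "\<sigma> \<subseteq> \<tau> \<Longrightarrow> laurent_exps n \<sigma> m \<subseteq> laurent_exps n \<tau> m"
  unfolding laurent_exps_def by auto

text \<open>The support of \<open>p\<close> is finite and its negative exponents sit at positions in
  \<open>\<sigma>\<close>. The claim covers all large \<open>N\<close> so that two Laurent
  polynomials can share a denominator.\<close>

lemma clear_denominators:
  assumes p: "p \<in> finsupp R (laurent_exps n \<sigma> m)" and \<sigma>: "\<sigma> \<subseteq> {..n}"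
  shows "\<exists>N0. \<forall>N\<ge>N0. X (indicator_exp N \<sigma>) \<star> p \<in> G (m + of_nat N * of_nat (card \<sigma>))"
proof -
  let ?A = "(\<lambda>(r, i). - r i) ` ({r. p r \<noteq> \<zero>} \<times> \<sigma>)"
  have "finite ?A" using finsupp_finite[OF p] \<sigma> finite_subset by blast
  then obtain N0 :: nat where N0: "\<forall>x\<in>?A. x \<le> of_nat N0" using finite_le_of_nat by blast
  have "X (indicator_exp N \<sigma>) \<star> p \<in> G (m + of_nat N * of_nat (card \<sigma>))" if N: "N \<ge> N0" for N
  proof -
    let ?u = "indicator_exp N \<sigma>"
    have pU: "p \<in> finsupp R UNIV" using p by (rule finsupp_UNIV)
    have "X ?u \<star> p \<in> finsupp R UNIV" using pU by (simp add: lmult_closed)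
    moreover have "r \<in> {r \<in> exponents n. (\<Sum>i\<le>n. r i) = m + of_nat N * of_nat (card \<sigma>)}"
      if "(X ?u \<star> p) r \<noteq> \<zero>" for r
    proof -
      let ?s = "\<lambda>i. r i - ?u i"
      have s: "p ?s \<noteq> \<zero>" using that by (simp add: X_lmult_apply pU)
      then have s': "?s \<in> laurent_exps n \<sigma> m" using finsuppD[OF p] by blast
      have "(\<Sum>i\<le>n. r i) = m + of_nat N * of_nat (card \<sigma>)"
        using s' by (simp add: laurent_exps_def sum_subtractf sum_indicator_exp[OF \<sigma>] algebra_simps)
      moreover have "0 \<le> r i" if i: "i \<le> n" for i
      proof (cases "i \<in> \<sigma>")
        case True
        then have "- ?s i \<in> ?A" using s by (intro image_eqI[of _ _ "(?s, i)"]) auto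
        then have "- ?s i \<le> of_nat N0" using N0 by blast
        also have "\<dots> \<le> of_nat N" using N by simp
        finally show ?thesis using True by (simp add: indicator_exp_def)
      next
        case False
        then show ?thesis using s' i by (simp add: laurent_exps_def indicator_exp_def)
      qed
      moreover have "r i = 0" if "i > n" for i
        using s' \<sigma> that by (auto simp: laurent_exps_def indicator_exp_def split: if_splits)
      ultimately show ?thesis unfolding exponents_def by auto
    qed
    ultimately show ?thesis
      unfolding qpoly_grading_eq by (auto simp: finsupp_def)
  qed
  then show ?thesis by blast
qed

text \<open>A Laurent polynomial \<open>p\<close> is regarded as the fraction \<open>b / g\<close> for every \<open>b\<close>, \<open>g\<close> with \<open>g p = b\<close>.\<close>

definition germ :: "rat \<Rightarrow> ((nat \<Rightarrow> rat) \<Rightarrow> 'a) \<Rightarrow> ((nat \<Rightarrow> rat) \<Rightarrow> 'a) set \<Rightarrow> _" where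
  "germ m p Q = {(b, g) \<in> fractions_at G m Q. \<exists>h\<in>S.homogeneous - Q. h \<star> (g \<star> p) = h \<star> b}"

definition sec where
  "sec m V p = (\<lambda>Q\<in>V. germ m p Q)"

text \<open>A germ is defined without choosing a denominator. Since \<open>Q\<close> is prime, a
  homogeneous factor \<open>f\<close> outside \<open>Q\<close> can be moved into the witness
  \<open>h\<close>, which exhibits the germ as a fraction.\<close>

lemma germ_eq_hfrac:
  assumes Q: "Q \<in> Proj S G" and f: "f \<in> G d" "f \<notin> Q" and p: "p \<in> finsupp R UNIV"
  shows "germ m p Q = hfrac S G m Q (f \<star> p) f"
proof -
  have fU: "f \<in> finsupp R UNIV" using f G_UNIV by blast
  have "(\<exists>h\<in>S.homogeneous - Q. h \<star> (g \<star> p) = h \<star> b) \<longleftrightarrow> (\<exists>h\<in>S.homogeneous - Q. h \<star> (g \<star> (f \<star> p)) = h \<star> (f \<star> b))"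
    (is "?L \<longleftrightarrow> ?R") if bg: "(b, g) \<in> fractions_at G m Q" for b g
  proof -
    have U: "b \<in> finsupp R UNIV" "g \<in> finsupp R UNIV"
      using bg G_UNIV unfolding S.fractions_at_iff by blast+
    note [simp] = U fU p lmult_closed
    show ?thesis
    proof
      assume ?L
      then obtain h where h: "h \<in> S.homogeneous - Q" "h \<star> (g \<star> p) = h \<star> b" by blast
      have [simp]: "h \<in> finsupp R UNIV" using h hom_UNIV by blast
      have "h \<star> (g \<star> (f \<star> p)) = f \<star> (h \<star> (g \<star> p))" by (simp add: lmult_ac)
      also have "\<dots> = h \<star> (f \<star> b)" unfolding h(2) by (simp add: lmult_ac)
      finally show ?R using h(1) by blast
    next
      assume ?R
      then obtain h where h: "h \<in> S.homogeneous - Q" "h \<star> (g \<star> (f \<star> p)) = h \<star> (f \<star> b)" by blast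
      have [simp]: "h \<in> finsupp R UNIV" using h hom_UNIV by blast
      have "(h \<star> f) \<star> (g \<star> p) = h \<star> (g \<star> (f \<star> p))" by (simp add: lmult_ac)
      also have "\<dots> = (h \<star> f) \<star> b" unfolding h(2) by (simp add: lmult_ac)
      finally have "(h \<star> f) \<star> (g \<star> p) = (h \<star> f) \<star> b" .
      moreover have "h \<star> f \<in> S.homogeneous - Q"
        using S.hom_mult[of h f] S.Proj_mult[OF Q, of h f] h(1) f S.homI[OF f(1)] S.hom_carrier by auto
      ultimately show ?L by blast
    qed
  qed
  then have "x \<in> germ m p Q \<longleftrightarrow> x \<in> hfrac S G m Q (f \<star> p) f" for x
    by (cases x) (auto simp: germ_def S.mem_hfrac)
  then show ?thesis by blast
qed

lemma sec_extensional: "sec m V p \<in> extensional V"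
  unfolding sec_def by simp

text \<open>Immediate because a germ does not depend on the open set. The restriction maps of the
  Cech complex thus leave the Laurent polynomial unchanged.\<close>

lemma sec_restrict: "V' \<subseteq> V \<Longrightarrow> restrict (sec m V p) V' = sec m V' p"
  unfolding sec_def by (auto simp: fun_eq_iff)

context
  fixes \<sigma> :: "nat set" and m :: rat
  assumes \<sigma>: "\<sigma> \<noteq> {}" "\<sigma> \<subseteq> {..n}"
begin

text \<open>Here \<open>N\<close> is free: for small \<open>N\<close> the pair may fail to lie in
  \<open>fractions_at\<close>, yet the same set of fractions results. This permits a later choice of
  a common \<open>N\<close>.\<close>

lemma sec_apply:
  assumes p: "p \<in> finsupp R (laurent_exps n \<sigma> m)" and Q: "Q \<in> W \<sigma>"
  shows "sec m (W \<sigma>) p Q = hfrac S G m Q (X (indicator_exp N \<sigma>) \<star> p) (X (indicator_exp N \<sigma>))"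
  using Q germ_eq_hfrac[OF W_Proj[OF Q \<sigma>(1)] X_indicator_G[OF \<sigma>(2)] W_X_notin[OF \<sigma> Q] finsupp_UNIV[OF p]]
  unfolding sec_def by simp

lemma fraction_W:
  assumes "X (indicator_exp N \<sigma>) \<star> p \<in> G (m + of_nat N * of_nat (card \<sigma>))" "Q \<in> W \<sigma>"
  shows "(X (indicator_exp N \<sigma>) \<star> p, X (indicator_exp N \<sigma>)) \<in> fractions_at G m Q"
  unfolding S.fractions_at_iff using assms X_indicator_G[OF \<sigma>(2)] W_X_notin[OF \<sigma>] by blast

lemma W_open: "Proj_open S G (W \<sigma>)"
  unfolding W_eq_D_plus[OF \<sigma>] by (rule S.Proj_open_D_plus[OF S.homI[OF X_indicator_G[OF \<sigma>(2)]]])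

lemma sec_in_sheaf:
  assumes p: "p \<in> finsupp R (laurent_exps n \<sigma> m)"
  shows "sec m (W \<sigma>) p \<in> carrier (F m (W \<sigma>))"
proof -
  obtain N where N: "X (indicator_exp N \<sigma>) \<star> p \<in> G (m + of_nat N * of_nat (card \<sigma>))"
    using clear_denominators[OF p \<sigma>(2)] by blast
  note fr = fraction_W[OF N] and ap = sec_apply[OF p, of _ N]
  have "sec m (W \<sigma>) p \<in> (\<Pi>\<^sub>E Q\<in>W \<sigma>. carrier (twist_stalk S G m Q))"
  proof (rule PiE_I)
    fix Q assume "Q \<in> W \<sigma>"
    then show "sec m (W \<sigma>) p Q \<in> carrier (twist_stalk S G m Q)"
      using fr[of Q] ap[of Q] unfolding twist_stalk_def by auto
  qed (rule extensional_arb[OF sec_extensional])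
  moreover have "\<exists>V a f. Proj_open S G V \<and> P \<in> V \<and> V \<subseteq> W \<sigma> \<and>
      (\<forall>Q\<in>V. (a, f) \<in> fractions_at G m Q \<and> sec m (W \<sigma>) p Q = hfrac S G m Q a f)"
    if "P \<in> W \<sigma>" for P
    using that W_open fr ap by blast
  ultimately show ?thesis
    unfolding twist_sheaf_def direct_prod_def by simp
qed

text \<open>Over a common power of the product of the variables, addition of germs is addition of
  numerators.\<close>

lemma sec_add:
  assumes p: "p \<in> finsupp R (laurent_exps n \<sigma> m)" and q: "q \<in> finsupp R (laurent_exps n \<sigma> m)"
  shows "sec m (W \<sigma>) (\<lambda>r. p r \<oplus> q r) = sec m (W \<sigma>) p \<oplus>\<^bsub>F m (W \<sigma>)\<^esub> sec m (W \<sigma>) q"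
proof -
  obtain N1 N2 where N1: "\<forall>N\<ge>N1. X (indicator_exp N \<sigma>) \<star> p \<in> G (m + of_nat N * of_nat (card \<sigma>))"
    and N2: "\<forall>N\<ge>N2. X (indicator_exp N \<sigma>) \<star> q \<in> G (m + of_nat N * of_nat (card \<sigma>))"
    using clear_denominators[OF p \<sigma>(2)] clear_denominators[OF q \<sigma>(2)] by blast
  define N where "N = max N1 N2"
  let ?f = "X (indicator_exp N \<sigma>)"
  have N: "?f \<star> p \<in> G (m + of_nat N * of_nat (card \<sigma>))" "?f \<star> q \<in> G (m + of_nat N * of_nat (card \<sigma>))"
    using N1 N2 unfolding N_def by auto
  have "sec m (W \<sigma>) (\<lambda>r. p r \<oplus> q r) Q = sec m (W \<sigma>) p Q \<oplus>\<^bsub>twist_stalk S G m Q\<^esub> sec m (W \<sigma>) q Q"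
    if Q: "Q \<in> W \<sigma>" for Q
    unfolding sec_apply[OF p Q, of N] sec_apply[OF q Q, of N] sec_apply[OF finsupp_add[OF p q] Q, of N]
      lmult_r_distr[OF X_UNIV finsupp_UNIV[OF p] finsupp_UNIV[OF q]]
    using S.twist_stalk_add_same_denominator[OF W_Proj[OF Q \<sigma>(1)] X_indicator_G[OF \<sigma>(2)] W_X_notin[OF \<sigma> Q] N]
    by simp
  then show ?thesis
    unfolding twist_sheaf_def direct_prod_def sec_def by (auto simp: fun_eq_iff)
qed

lemma sec_zero: "sec m (W \<sigma>) (\<lambda>_. \<zero>) = \<zero>\<^bsub>F m (W \<sigma>)\<^esub>"
proof -
  have "sec m (W \<sigma>) (\<lambda>_. \<zero>) Q = \<zero>\<^bsub>twist_stalk S G m Q\<^esub>" if Q: "Q \<in> W \<sigma>" for Q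
    using S.twist_stalk_zero[OF W_Proj[OF Q \<sigma>(1)] X_indicator_G[OF \<sigma>(2)] W_X_notin[OF \<sigma> Q], of m 1]
      sec_apply[OF finsupp_zero Q, of 1] by simp
  then show ?thesis
    unfolding twist_sheaf_def direct_prod_def sec_def by (auto simp: fun_eq_iff)
qed

lemma sec_smult:
  assumes c: "c \<in> carrier R" and p: "p \<in> finsupp R (laurent_exps n \<sigma> m)"
  shows "sec m (W \<sigma>) (\<lambda>r. c \<otimes> p r) = c \<odot>\<^bsub>F m (W \<sigma>)\<^esub> sec m (W \<sigma>) p"
proof -
  obtain N where N: "X (indicator_exp N \<sigma>) \<star> p \<in> G (m + of_nat N * of_nat (card \<sigma>))"
    using clear_denominators[OF p \<sigma>(2)] by blast
  have "sec m (W \<sigma>) (\<lambda>r. c \<otimes> p r) Q = c \<odot>\<^bsub>twist_stalk S G m Q\<^esub> sec m (W \<sigma>) p Q" if Q: "Q \<in> W \<sigma>" for Q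
  proof -
    have "c \<odot>\<^bsub>S\<^esub> x \<in> G d" if "x \<in> G d" for d x
      using that c unfolding qpoly_grading_eq by (simp add: finsupp_smult)
    moreover have "c \<odot>\<^bsub>S\<^esub> (x \<otimes>\<^bsub>S\<^esub> y) = x \<otimes>\<^bsub>S\<^esub> (c \<odot>\<^bsub>S\<^esub> y)" if "x \<in> carrier S" "y \<in> carrier S" for x y
      using that c finsupp_UNIV smult_lmult by simp
    ultimately have "c \<odot>\<^bsub>twist_stalk S G m Q\<^esub> hfrac S G m Q (X (indicator_exp N \<sigma>) \<star> p) (X (indicator_exp N \<sigma>)) =
        hfrac S G m Q (c \<odot>\<^bsub>S\<^esub> (X (indicator_exp N \<sigma>) \<star> p)) (X (indicator_exp N \<sigma>))"
      by (intro S.twist_stalk_smult[OF W_Proj[OF Q \<sigma>(1)] fraction_W[OF N Q]])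
    then show ?thesis
      unfolding sec_apply[OF p Q, of N] sec_apply[OF finsupp_smult[OF c p] Q, of N]
        smult_lmult[OF c X_UNIV finsupp_UNIV[OF p]] by simp
  qed
  then show ?thesis
    unfolding twist_sheaf_def direct_prod_def sec_def by (auto simp: fun_eq_iff)
qed

text \<open>Equal sections have numerators that agree after multiplication by a power of the
  monomial \<open>?g\<close>, and monomials cancel.\<close>

lemma sec_inj:
  assumes p: "p \<in> finsupp R (laurent_exps n \<sigma> m)" and q: "q \<in> finsupp R (laurent_exps n \<sigma> m)"
    and eq: "sec m (W \<sigma>) p = sec m (W \<sigma>) q"
  shows "p = q"
proof -
  obtain N1 N2 where N1: "\<forall>N\<ge>N1. X (indicator_exp N \<sigma>) \<star> p \<in> G (m + of_nat N * of_nat (card \<sigma>))"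
    and N2: "\<forall>N\<ge>N2. X (indicator_exp N \<sigma>) \<star> q \<in> G (m + of_nat N * of_nat (card \<sigma>))"
    using clear_denominators[OF p \<sigma>(2)] clear_denominators[OF q \<sigma>(2)] by blast
  define N where "N = max N1 N2"
  let ?f = "X (indicator_exp N \<sigma>)" and ?g = "X (indicator_exp (Suc 0) \<sigma>)"
  have N: "?f \<star> p \<in> G (m + of_nat N * of_nat (card \<sigma>))" "?f \<star> q \<in> G (m + of_nat N * of_nat (card \<sigma>))"
    using N1 N2 unfolding N_def by auto
  have pU: "p \<in> finsupp R UNIV" and qU: "q \<in> finsupp R UNIV" using p q finsupp_UNIV by auto
  have card: "0 < card \<sigma>" using \<sigma> finite_subset card_gt_0_iff by blast
  have "\<exists>k::nat. ?g [^]\<^bsub>S\<^esub> k \<otimes>\<^bsub>S\<^esub> (?f \<otimes>\<^bsub>S\<^esub> (?f \<star> p)) = ?g [^]\<^bsub>S\<^esub> k \<otimes>\<^bsub>S\<^esub> (?f \<otimes>\<^bsub>S\<^esub> (?f \<star> q))"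
  proof (rule S.hfrac_eq_on_D_plus[OF X_indicator_G[OF \<sigma>(2)]])
    show "0 < of_nat (Suc 0) * (of_nat (card \<sigma>) :: rat)" using card by simp
    fix Q assume "Q \<in> D_plus S G ?g"
    then have Q: "Q \<in> W \<sigma>" using W_eq_D_plus[OF \<sigma>] by simp
    show "(?f \<star> p, ?f) \<in> fractions_at G m Q \<and> (?f \<star> q, ?f) \<in> fractions_at G m Q"
      using fraction_W N Q by blast
    show "hfrac S G m Q (?f \<star> p) ?f = hfrac S G m Q (?f \<star> q) ?f"
      using fun_cong[OF eq, of Q] sec_apply[OF p Q, of N] sec_apply[OF q Q, of N] by simp
  qed (use N X_indicator_G[OF \<sigma>(2)] in blast)+
  then obtain k :: nat where
    "X (indicator_exp k \<sigma>) \<star> (?f \<star> (?f \<star> p)) = X (indicator_exp k \<sigma>) \<star> (?f \<star> (?f \<star> q))"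
    unfolding X_indicator_pow S_simps by blast
  then show ?thesis
    using X_lmult_inj lmult_closed[OF X_UNIV] pU qU by meson
qed

text \<open>\<open>section_is_fraction\<close> provides a power of a monomial as denominator, and
  division by it is a shift of exponents.\<close>

lemma sec_surj:
  assumes s: "s \<in> carrier (F m (W \<sigma>))"
  shows "\<exists>p\<in>finsupp R (laurent_exps n \<sigma> m). s = sec m (W \<sigma>) p"
proof -
  let ?g = "X (indicator_exp (Suc 0) \<sigma>)" and ?c = "of_nat (card \<sigma>) :: rat"
  have card: "0 < card \<sigma>" using \<sigma> finite_subset card_gt_0_iff by blast
  have g: "?g \<in> G ?c" using X_indicator_G[OF \<sigma>(2), of 1] by simp
  have "s \<in> carrier (F m (D_plus S G ?g))" using s W_eq_D_plus[OF \<sigma>] by simp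
  then obtain N a where a: "a \<in> G (m + of_nat N * ?c)"
    and sQ: "\<And>Q. Q \<in> D_plus S G ?g \<Longrightarrow> s Q = hfrac S G m Q a (?g [^]\<^bsub>S\<^esub> N)"
    using S.section_is_fraction[OF g, of s m] card by auto
  let ?u = "indicator_exp N \<sigma>"
  have aU: "a \<in> finsupp R UNIV" using a G_UNIV by blast
  define p where "p = X (\<lambda>i. - ?u i) \<star> a"
  have pU: "p \<in> finsupp R UNIV" unfolding p_def using aU by (simp add: lmult_closed)
  have "r \<in> laurent_exps n \<sigma> m" if "p r \<noteq> \<zero>" for r
  proof -
    have "a (\<lambda>i. r i + ?u i) \<noteq> \<zero>" using that unfolding p_def X_lmult_apply[OF aU] by simp
    then have r: "(\<lambda>i. r i + ?u i) \<in> exponents n" "(\<Sum>i\<le>n. r i + ?u i) = m + of_nat N * ?c"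
      using a finsuppD unfolding qpoly_grading_eq by blast+
    have "(\<Sum>i\<le>n. r i) = m" using r(2) by (simp add: sum.distrib sum_indicator_exp[OF \<sigma>(2)])
    moreover have "0 \<le> r i" if "i \<le> n" "i \<notin> \<sigma>" for i
      using r(1) that by (auto simp: exponents_def indicator_exp_def split: if_splits)
    moreover have "r i = 0" if "i > n" for i
      using r(1) that \<sigma>(2) by (auto simp: exponents_def indicator_exp_def split: if_splits)
    ultimately show ?thesis unfolding laurent_exps_def by blast
  qed
  then have p: "p \<in> finsupp R (laurent_exps n \<sigma> m)"
    using pU by (auto simp: finsupp_def)
  have "X ?u \<star> p = a"
    unfolding X_lmult_apply[OF pU] unfolding p_def X_lmult_apply[OF aU] by simp
  then have "s Q = sec m (W \<sigma>) p Q" if "Q \<in> W \<sigma>" for Q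
    using that sQ[of Q] sec_apply[OF p that, of N] W_eq_D_plus[OF \<sigma>] by (simp add: X_indicator_pow)
  moreover have "s \<in> extensional (W \<sigma>)"
    using s unfolding twist_sheaf_def direct_prod_def by (auto simp: PiE_def)
  moreover note sec_extensional[of m "W \<sigma>" p]
  ultimately have "s = sec m (W \<sigma>) p" by (intro extensionalityI)
  then show ?thesis using p by blast
qed

end

end


section \<open>Modules\<close>

text \<open>Preservation of zero is listed separately because the target is often a bare record, not
  yet known to be a group.\<close>

definition module_map ::
  "('a, 'r) ring_scheme \<Rightarrow> ('a, 'b) module \<Rightarrow> ('a, 'c) module \<Rightarrow> ('b \<Rightarrow> 'c) \<Rightarrow> bool" where
  "module_map R M N h \<longleftrightarrow> h \<in> carrier M \<rightarrow> carrier N \<and> h \<zero>\<^bsub>M\<^esub> = \<zero>\<^bsub>N\<^esub> \<and>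
    (\<forall>x\<in>carrier M. \<forall>y\<in>carrier M. h (x \<oplus>\<^bsub>M\<^esub> y) = h x \<oplus>\<^bsub>N\<^esub> h y) \<and>
    (\<forall>c\<in>carrier R. \<forall>x\<in>carrier M. h (c \<odot>\<^bsub>M\<^esub> x) = c \<odot>\<^bsub>N\<^esub> h x)"

lemma module_mapI:
  assumes "\<And>x. x \<in> carrier M \<Longrightarrow> h x \<in> carrier N" "h \<zero>\<^bsub>M\<^esub> = \<zero>\<^bsub>N\<^esub>"
    "\<And>x y. x \<in> carrier M \<Longrightarrow> y \<in> carrier M \<Longrightarrow> h (x \<oplus>\<^bsub>M\<^esub> y) = h x \<oplus>\<^bsub>N\<^esub> h y"
    "\<And>c x. c \<in> carrier R \<Longrightarrow> x \<in> carrier M \<Longrightarrow> h (c \<odot>\<^bsub>M\<^esub> x) = c \<odot>\<^bsub>N\<^esub> h x"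
  shows "module_map R M N h"
  using assms unfolding module_map_def by blast

lemma module_mapD:
  assumes "module_map R M N h"
  shows "x \<in> carrier M \<Longrightarrow> h x \<in> carrier N" "h \<zero>\<^bsub>M\<^esub> = \<zero>\<^bsub>N\<^esub>"
    "x \<in> carrier M \<Longrightarrow> y \<in> carrier M \<Longrightarrow> h (x \<oplus>\<^bsub>M\<^esub> y) = h x \<oplus>\<^bsub>N\<^esub> h y"
    "c \<in> carrier R \<Longrightarrow> x \<in> carrier M \<Longrightarrow> h (c \<odot>\<^bsub>M\<^esub> x) = c \<odot>\<^bsub>N\<^esub> h x"
  using assms unfolding module_map_def by blast+

text \<open>Sections, cocycles and quotients are defined as records only; their module axioms are
  inherited along a surjective structure-preserving map.\<close>

lemma module_image:
  assumes M: "module R M" and h: "module_map R M N h" and onto: "carrier N \<subseteq> h ` carrier M"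
  shows "module R N"
proof -
  interpret M: module R M by fact
  note hD = module_mapD[OF h]
  have pre: "\<exists>a\<in>carrier M. x = h a" if "x \<in> carrier N" for x using that onto by blast
  have "abelian_group N"
  proof (rule abelian_groupI)
    fix x y assume x: "x \<in> carrier N" and y: "y \<in> carrier N"
    obtain a b where "a \<in> carrier M" "x = h a" "b \<in> carrier M" "y = h b"
      using pre[OF x] pre[OF y] by blast
    then show "x \<oplus>\<^bsub>N\<^esub> y \<in> carrier N" "x \<oplus>\<^bsub>N\<^esub> y = y \<oplus>\<^bsub>N\<^esub> x"
      using hD(1)[of "a \<oplus>\<^bsub>M\<^esub> b"] by (simp_all add: hD(3)[symmetric] M.a_comm)
  next
    fix x y z assume x: "x \<in> carrier N" and y: "y \<in> carrier N" and z: "z \<in> carrier N"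
    obtain a b c where "a \<in> carrier M" "x = h a" "b \<in> carrier M" "y = h b" "c \<in> carrier M" "z = h c"
      using pre[OF x] pre[OF y] pre[OF z] by blast
    then show "x \<oplus>\<^bsub>N\<^esub> y \<oplus>\<^bsub>N\<^esub> z = x \<oplus>\<^bsub>N\<^esub> (y \<oplus>\<^bsub>N\<^esub> z)"
      by (simp add: hD(3)[symmetric] M.a_assoc)
  next
    show "\<zero>\<^bsub>N\<^esub> \<in> carrier N" using hD(1)[OF M.zero_closed] hD(2) by simp
  next
    fix x assume "x \<in> carrier N"
    then obtain a where a: "a \<in> carrier M" "x = h a" using pre by blast
    then show "\<zero>\<^bsub>N\<^esub> \<oplus>\<^bsub>N\<^esub> x = x"
      using hD(3)[OF M.zero_closed a(1)] by (simp add: hD(2))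
    have "h (\<ominus>\<^bsub>M\<^esub> a) \<oplus>\<^bsub>N\<^esub> x = \<zero>\<^bsub>N\<^esub>"
      using a hD(3)[of "\<ominus>\<^bsub>M\<^esub> a" a] by (simp add: hD(2) M.l_neg)
    then show "\<exists>y\<in>carrier N. y \<oplus>\<^bsub>N\<^esub> x = \<zero>\<^bsub>N\<^esub>"
      using a hD(1)[of "\<ominus>\<^bsub>M\<^esub> a"] by blast
  qed
  then show ?thesis
  proof (rule moduleI[OF M.is_cring])
    fix c x assume "c \<in> carrier R" "x \<in> carrier N"
    moreover from this obtain a where "a \<in> carrier M" "x = h a" using pre by blast
    ultimately show "c \<odot>\<^bsub>N\<^esub> x \<in> carrier N"
      using hD(1)[of "c \<odot>\<^bsub>M\<^esub> a"] by (simp add: hD(4))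
  next
    fix c d x assume cd: "c \<in> carrier R" "d \<in> carrier R" and "x \<in> carrier N"
    then obtain a where "a \<in> carrier M" "x = h a" using pre by blast
    then show "(c \<oplus>\<^bsub>R\<^esub> d) \<odot>\<^bsub>N\<^esub> x = c \<odot>\<^bsub>N\<^esub> x \<oplus>\<^bsub>N\<^esub> d \<odot>\<^bsub>N\<^esub> x"
      "(c \<otimes>\<^bsub>R\<^esub> d) \<odot>\<^bsub>N\<^esub> x = c \<odot>\<^bsub>N\<^esub> (d \<odot>\<^bsub>N\<^esub> x)"
      using cd by (simp_all add: hD(3,4)[symmetric] M.smult_l_distr M.smult_assoc1)
  next
    fix c x y assume c: "c \<in> carrier R" and x: "x \<in> carrier N" and y: "y \<in> carrier N"
    obtain a b where "a \<in> carrier M" "x = h a" "b \<in> carrier M" "y = h b"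
      using pre[OF x] pre[OF y] by blast
    then show "c \<odot>\<^bsub>N\<^esub> (x \<oplus>\<^bsub>N\<^esub> y) = c \<odot>\<^bsub>N\<^esub> x \<oplus>\<^bsub>N\<^esub> c \<odot>\<^bsub>N\<^esub> y"
      using c by (simp add: hD(3,4)[symmetric] M.smult_r_distr)
  next
    fix x assume "x \<in> carrier N"
    then obtain a where "a \<in> carrier M" "x = h a" using pre by blast
    then show "\<one>\<^bsub>R\<^esub> \<odot>\<^bsub>N\<^esub> x = x" by (simp add: hD(4)[symmetric])
  qed
qed

lemma module_isoI:
  assumes M: "module R M" and h: "module_map R M N h"
    and inj: "inj_on h (carrier M)" and onto: "carrier N \<subseteq> h ` carrier M"
  shows "h \<in> module_iso R M N"
proof -
  have "bij_betw h (carrier M) (carrier N)"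
    using inj onto module_mapD(1)[OF h] unfolding bij_betw_def by blast
  then show ?thesis
    using M module_image[OF M h onto] module_mapD(3,4)[OF h] unfolding module_iso_def by blast
qed

lemma module_iso_map:
  assumes h: "h \<in> module_iso R M N"
  shows "module_map R M N h"
proof (rule module_mapI)
  have bij: "bij_betw h (carrier M) (carrier N)" and mods: "module R M" "module R N"
    and add: "\<And>x y. x \<in> carrier M \<Longrightarrow> y \<in> carrier M \<Longrightarrow> h (x \<oplus>\<^bsub>M\<^esub> y) = h x \<oplus>\<^bsub>N\<^esub> h y"
    using h unfolding module_iso_def by auto
  interpret M: module R M by fact
  interpret N: module R N by fact
  show closed: "h x \<in> carrier N" if "x \<in> carrier M" for x
    using bij that by (rule bij_betwE[rule_format])
  have "h \<zero>\<^bsub>M\<^esub> \<oplus>\<^bsub>N\<^esub> h \<zero>\<^bsub>M\<^esub> = h \<zero>\<^bsub>M\<^esub>" using add[of "\<zero>\<^bsub>M\<^esub>" "\<zero>\<^bsub>M\<^esub>"] by simp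
  then show "h \<zero>\<^bsub>M\<^esub> = \<zero>\<^bsub>N\<^esub>" using closed by (simp add: N.add.l_cancel_one)
qed (use h in \<open>auto simp: module_iso_def\<close>)

lemma module_iso_inv:
  assumes h: "h \<in> module_iso R M N"
  shows "inv_into (carrier M) h \<in> module_iso R N M"
proof -
  let ?k = "inv_into (carrier M) h"
  have bij: "bij_betw h (carrier M) (carrier N)" and mods: "module R M" "module R N"
    using h unfolding module_iso_def by auto
  note hD = module_mapD[OF module_iso_map[OF h]]
  interpret M: module R M by fact
  have k: "?k x \<in> carrier M" "h (?k x) = x" if "x \<in> carrier N" for x
    using bij that unfolding bij_betw_def by (auto intro: inv_into_into f_inv_into_f)
  have kh: "?k (h a) = a" if "a \<in> carrier M" for a
    using bij that unfolding bij_betw_def by (simp add: inv_into_f_f)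
  have "?k (x \<oplus>\<^bsub>N\<^esub> y) = ?k x \<oplus>\<^bsub>M\<^esub> ?k y" if "x \<in> carrier N" "y \<in> carrier N" for x y
    using kh[of "?k x \<oplus>\<^bsub>M\<^esub> ?k y"] hD(3)[of "?k x" "?k y"] k that by simp
  moreover have "?k (c \<odot>\<^bsub>N\<^esub> x) = c \<odot>\<^bsub>M\<^esub> ?k x" if "c \<in> carrier R" "x \<in> carrier N" for c x
    using kh[of "c \<odot>\<^bsub>M\<^esub> ?k x"] hD(4)[of c "?k x"] k that by simp
  ultimately show ?thesis
    unfolding module_iso_def using mods bij_betw_inv_into[OF bij] by blast
qed

lemma module_iso_comp:
  assumes h: "h \<in> module_iso R M N" and k: "k \<in> module_iso R N P"
  shows "k \<circ> h \<in> module_iso R M P"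
proof -
  have "bij_betw (k \<circ> h) (carrier M) (carrier P)"
    using h k bij_betw_trans unfolding module_iso_def by blast
  then show ?thesis
    using h k module_mapD(1)[OF module_iso_map[OF h]] unfolding module_iso_def by simp
qed

lemma module_map_uminus:
  assumes "module R M" "module R N" and h: "module_map R M N h" and x: "x \<in> carrier M"
  shows "h (\<ominus>\<^bsub>M\<^esub> x) = \<ominus>\<^bsub>N\<^esub> h x"
proof -
  interpret M: module R M by fact
  interpret N: module R N by fact
  show ?thesis
    using N.minus_equality[of "h (\<ominus>\<^bsub>M\<^esub> x)" "h x"] module_mapD[OF h] x
    by (metis M.M.add.inv_closed M.M.add.l_inv)
qed

lemma module_map_finsum:
  assumes "module R M" "module R N" and h: "module_map R M N h"
    and A: "finite A" "\<And>a. a \<in> A \<Longrightarrow> f a \<in> carrier M"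
  shows "h (\<Oplus>\<^bsub>M\<^esub>a\<in>A. f a) = (\<Oplus>\<^bsub>N\<^esub>a\<in>A. h (f a))"
proof -
  interpret M: module R M by fact
  interpret N: module R N by fact
  show ?thesis
    using A
  proof (induction A rule: finite_induct)
    case empty
    show ?case by (simp add: module_mapD(2)[OF h])
  next
    case (insert a A)
    then have "f \<in> A \<rightarrow> carrier M" "f a \<in> carrier M" "(\<lambda>a. h (f a)) \<in> A \<rightarrow> carrier N" "h (f a) \<in> carrier N"
      using module_mapD(1)[OF h] by auto
    then show ?case
      using insert module_mapD(3)[OF h] by simp
  qed
qed

text \<open>\<open>K\<close> is mapped onto a complement of \<open>N\<close>: by \<open>surj\<close>
  the two images span \<open>M\<close>, and by \<open>inj\<close> distinct elements of
  \<open>K\<close> stay distinct modulo \<open>N\<close>. The module axioms of the quotient come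
  along with the isomorphism.\<close>

lemma quot_module_iso:
  assumes "module R M" "module R K" "module R K'" and k: "module_map R K M k" and k': "module_map R K' M k'"
    and N: "N = k' ` carrier K'"
    and surj: "\<And>x. x \<in> carrier M \<Longrightarrow> \<exists>c\<in>carrier K. \<exists>d\<in>carrier K'. x = k' d \<oplus>\<^bsub>M\<^esub> k c"
    and inj: "\<And>c c' d. c \<in> carrier K \<Longrightarrow> c' \<in> carrier K \<Longrightarrow> d \<in> carrier K' \<Longrightarrow>
      k c = k' d \<oplus>\<^bsub>M\<^esub> k c' \<Longrightarrow> c = c'"
  shows "(\<lambda>c. N +>\<^bsub>M\<^esub> k c) \<in> module_iso R K (quot_module M N)"
proof -
  interpret M: module R M by fact
  interpret K: module R K by fact
  interpret K': module R K' by fact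
  note kD = module_mapD[OF k] and k'D = module_mapD[OF k']
  have "additive_subgroup N M"
  proof (rule additive_subgroupI, rule M.M.add.subgroupI)
    show "N \<subseteq> carrier M" unfolding N using k'D(1) by blast
    show "N \<noteq> {}" unfolding N using K'.zero_closed by blast
    show "\<ominus>\<^bsub>M\<^esub> x \<in> N" if x: "x \<in> N" for x
    proof -
      obtain d where d: "d \<in> carrier K'" "x = k' d" using x unfolding N by blast
      then have "\<ominus>\<^bsub>M\<^esub> x = k' (\<ominus>\<^bsub>K'\<^esub> d)"
        using module_map_uminus[OF \<open>module R K'\<close> \<open>module R M\<close> k'] by simp
      then show ?thesis using K'.a_inv_closed[OF d(1)] unfolding N by blast
    qed
    show "x \<oplus>\<^bsub>M\<^esub> y \<in> N" if xy: "x \<in> N" "y \<in> N" for x y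
    proof -
      obtain d e where d: "d \<in> carrier K'" "x = k' d" and e: "e \<in> carrier K'" "y = k' e"
        using xy unfolding N by blast
      then have "x \<oplus>\<^bsub>M\<^esub> y = k' (d \<oplus>\<^bsub>K'\<^esub> e)" using k'D(3) by simp
      then show ?thesis using K'.a_closed[OF d(1) e(1)] unfolding N by blast
    qed
  qed
  then interpret N: abelian_subgroup N M
    by (intro abelian_subgroupI3 M.M.abelian_group_axioms)
  have absorb: "N +>\<^bsub>M\<^esub> (y \<oplus>\<^bsub>M\<^esub> x) = N +>\<^bsub>M\<^esub> x" if "y \<in> N" "x \<in> carrier M" for x y
  proof -
    have "y \<oplus>\<^bsub>M\<^esub> x \<in> N +>\<^bsub>M\<^esub> x" using that unfolding a_r_coset_def' by blast
    then show ?thesis using N.a_repr_independence'[OF _ that(2)] by simp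
  qed
  have smult_N: "c \<odot>\<^bsub>M\<^esub> y \<in> N" if c: "c \<in> carrier R" and y: "y \<in> N" for c y
  proof -
    obtain d where d: "d \<in> carrier K'" "y = k' d" using y unfolding N by blast
    then have "c \<odot>\<^bsub>M\<^esub> y = k' (c \<odot>\<^bsub>K'\<^esub> d)" using k'D(4) c by simp
    then show ?thesis using K'.smult_closed[OF c d(1)] unfolding N by blast
  qed
  have smult: "c \<odot>\<^bsub>quot_module M N\<^esub> (N +>\<^bsub>M\<^esub> x) = N +>\<^bsub>M\<^esub> (c \<odot>\<^bsub>M\<^esub> x)"
    if c: "c \<in> carrier R" and x: "x \<in> carrier M" for c x
  proof -
    \<comment> \<open>A scalar multiple of a coset is a union over representatives; all members of
      the union coincide.\<close>
    have eq: "N +>\<^bsub>M\<^esub> (c \<odot>\<^bsub>M\<^esub> z) = N +>\<^bsub>M\<^esub> (c \<odot>\<^bsub>M\<^esub> x)" if "z \<in> N +>\<^bsub>M\<^esub> x" for z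
    proof -
      obtain y where y: "y \<in> N" "z = y \<oplus>\<^bsub>M\<^esub> x" using \<open>z \<in> N +>\<^bsub>M\<^esub> x\<close> unfolding a_r_coset_def' by blast
      then have "c \<odot>\<^bsub>M\<^esub> z = c \<odot>\<^bsub>M\<^esub> y \<oplus>\<^bsub>M\<^esub> c \<odot>\<^bsub>M\<^esub> x"
        using c x N.a_Hcarr by (simp add: M.smult_r_distr)
      then show ?thesis using absorb[OF smult_N[OF c y(1)]] c x by simp
    qed
    have "c \<odot>\<^bsub>quot_module M N\<^esub> (N +>\<^bsub>M\<^esub> x) = (\<Union>z\<in>N +>\<^bsub>M\<^esub> x. N +>\<^bsub>M\<^esub> (c \<odot>\<^bsub>M\<^esub> z))"
      by (simp add: quot_module_def)
    also have "\<dots> = (\<Union>z\<in>N +>\<^bsub>M\<^esub> x. N +>\<^bsub>M\<^esub> (c \<odot>\<^bsub>M\<^esub> x))"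
      by (rule SUP_cong[OF refl eq])
    also have "\<dots> = N +>\<^bsub>M\<^esub> (c \<odot>\<^bsub>M\<^esub> x)"
      using N.a_rcos_self[OF x] by blast
    finally show ?thesis .
  qed
  show ?thesis
  proof (rule module_isoI[OF \<open>module R K\<close>])
    show "module_map R K (quot_module M N) (\<lambda>c. N +>\<^bsub>M\<^esub> k c)"
    proof (rule module_mapI)
      show "N +>\<^bsub>M\<^esub> k c \<in> carrier (quot_module M N)" if "c \<in> carrier K" for c
        using kD(1)[OF that] M.a_rcosetsI[OF N.a_subset] by (simp add: quot_module_def)
      show "N +>\<^bsub>M\<^esub> k \<zero>\<^bsub>K\<^esub> = \<zero>\<^bsub>quot_module M N\<^esub>"
        using N.a_subset by (simp add: kD(2) quot_module_def)
      show "N +>\<^bsub>M\<^esub> k (x \<oplus>\<^bsub>K\<^esub> y) = (N +>\<^bsub>M\<^esub> k x) \<oplus>\<^bsub>quot_module M N\<^esub> (N +>\<^bsub>M\<^esub> k y)"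
        if "x \<in> carrier K" "y \<in> carrier K" for x y
        using N.a_rcos_sum[of "k x" "k y"] kD(1,3) that by (simp add: quot_module_def)
      show "N +>\<^bsub>M\<^esub> k (c \<odot>\<^bsub>K\<^esub> x) = c \<odot>\<^bsub>quot_module M N\<^esub> (N +>\<^bsub>M\<^esub> k x)"
        if "c \<in> carrier R" "x \<in> carrier K" for c x
        using smult[of c "k x"] kD(1,4) that by simp
    qed
    show "inj_on (\<lambda>c. N +>\<^bsub>M\<^esub> k c) (carrier K)"
    proof (rule inj_onI)
      fix c c' assume c: "c \<in> carrier K" "c' \<in> carrier K" and eq: "N +>\<^bsub>M\<^esub> k c = N +>\<^bsub>M\<^esub> k c'"
      have "k c \<in> N +>\<^bsub>M\<^esub> k c'" using N.a_rcos_self[OF kD(1)[OF c(1)]] eq by simp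
      then obtain y where "y \<in> N" "k c = y \<oplus>\<^bsub>M\<^esub> k c'" unfolding a_r_coset_def' by blast
      then show "c = c'" using inj[OF c] unfolding N by blast
    qed
    show "carrier (quot_module M N) \<subseteq> (\<lambda>c. N +>\<^bsub>M\<^esub> k c) ` carrier K"
    proof
      fix Y assume "Y \<in> carrier (quot_module M N)"
      then obtain x where x: "x \<in> carrier M" "Y = N +>\<^bsub>M\<^esub> x"
        unfolding quot_module_def A_RCOSETS_def' by auto
      then obtain c d where cd: "c \<in> carrier K" "d \<in> carrier K'" "x = k' d \<oplus>\<^bsub>M\<^esub> k c"
        using surj by blast
      then have "Y = N +>\<^bsub>M\<^esub> k c" using x absorb[of "k' d" "k c"] kD(1) unfolding N by blast
      then show "Y \<in> (\<lambda>c. N +>\<^bsub>M\<^esub> k c) ` carrier K" using cd(1) by blast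
    qed
  qed
qed

section \<open>Direct products, direct sums and bases of monomials\<close>

lemma direct_prod_simps [simp]:
  "carrier (direct_prod I M) = (\<Pi>\<^sub>E i\<in>I. carrier (M i))"
  "\<zero>\<^bsub>direct_prod I M\<^esub> = (\<lambda>i\<in>I. \<zero>\<^bsub>M i\<^esub>)"
  "x \<oplus>\<^bsub>direct_prod I M\<^esub> y = (\<lambda>i\<in>I. x i \<oplus>\<^bsub>M i\<^esub> y i)"
  "c \<odot>\<^bsub>direct_prod I M\<^esub> x = (\<lambda>i\<in>I. c \<odot>\<^bsub>M i\<^esub> x i)"
  by (simp_all add: direct_prod_def)

lemma direct_sum_simps [simp]:
  "carrier (direct_sum I M) = {x \<in> \<Pi>\<^sub>E i\<in>I. carrier (M i). finite {i \<in> I. x i \<noteq> \<zero>\<^bsub>M i\<^esub>}}"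
  "\<zero>\<^bsub>direct_sum I M\<^esub> = (\<lambda>i\<in>I. \<zero>\<^bsub>M i\<^esub>)"
  "x \<oplus>\<^bsub>direct_sum I M\<^esub> y = (\<lambda>i\<in>I. x i \<oplus>\<^bsub>M i\<^esub> y i)"
  "c \<odot>\<^bsub>direct_sum I M\<^esub> x = (\<lambda>i\<in>I. c \<odot>\<^bsub>M i\<^esub> x i)"
  by (simp_all add: direct_sum_def direct_prod_def)

lemma self_module_simps [simp]:
  "carrier (self_module R) = carrier R"
  "\<zero>\<^bsub>self_module R\<^esub> = \<zero>\<^bsub>R\<^esub>"
  "x \<oplus>\<^bsub>self_module R\<^esub> y = x \<oplus>\<^bsub>R\<^esub> y"
  "c \<odot>\<^bsub>self_module R\<^esub> x = c \<otimes>\<^bsub>R\<^esub> x"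
  by (simp_all add: self_module_def)

text \<open>Coefficients are coordinates. The relabelling \<open>e\<close> moves the index set into
  a prescribed type, as the definition of freeness requires.\<close>

lemma (in cring) laurent_iso_direct_sum:
  assumes e: "inj_on e E"
  shows "(\<lambda>p. \<lambda>i\<in>e ` E. p (inv_into E e i)) \<in>
    module_iso R (laurent R E) (direct_sum (e ` E) (\<lambda>_. self_module R))" (is "?h \<in> _")
proof (rule module_isoI[OF laurent_module])
  have h_e: "?h p (e r) = p r" if "r \<in> E" for p r
    using that e by (simp add: inv_into_f_f)
  have h_closed: "?h p \<in> carrier (direct_sum (e ` E) (\<lambda>_. self_module R))" if p: "p \<in> finsupp R E" for p
  proof -
    have "{i \<in> e ` E. ?h p i \<noteq> \<zero>} \<subseteq> e ` {r. p r \<noteq> \<zero>}"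
      using h_e by (auto simp: inv_into_f_f[OF e])
    then have "finite {i \<in> e ` E. ?h p i \<noteq> \<zero>}"
      by (rule finite_subset) (use finsupp_finite[OF p] in blast)
    then show ?thesis using p by auto
  qed
  show "module_map R (laurent R E) (direct_sum (e ` E) (\<lambda>_. self_module R)) ?h"
    by (rule module_mapI) (use h_closed in \<open>auto simp: fun_eq_iff\<close>)
  show "inj_on ?h (carrier (laurent R E))"
  proof (rule inj_onI, rule ext)
    fix p q r assume pq: "p \<in> carrier (laurent R E)" "q \<in> carrier (laurent R E)" and eq: "?h p = ?h q"
    show "p r = q r"
    proof (cases "r \<in> E")
      case True
      then show ?thesis using h_e[OF True, of p] h_e[OF True, of q] fun_cong[OF eq, of "e r"] by simp
    next
      case False
      then show ?thesis using pq finsuppD[of p E r] finsuppD[of q E r] by (metis laurent_simps(1))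
    qed
  qed
  show "carrier (direct_sum (e ` E) (\<lambda>_. self_module R)) \<subseteq> ?h ` carrier (laurent R E)"
  proof
    fix x assume x: "x \<in> carrier (direct_sum (e ` E) (\<lambda>_. self_module R))"
    define p where "p r = (if r \<in> E then x (e r) else \<zero>)" for r
    have "p \<in> finsupp R E"
    proof (rule finsuppI)
      show "p r \<in> carrier R" for r using x unfolding p_def by (auto simp: PiE_iff)
      have "e ` {r. p r \<noteq> \<zero>} \<subseteq> {i \<in> e ` E. x i \<noteq> \<zero>}" unfolding p_def by auto
      then have "finite (e ` {r. p r \<noteq> \<zero>})" by (rule finite_subset) (use x in auto)
      moreover have "inj_on e {r. p r \<noteq> \<zero>}"
        by (rule inj_on_subset[OF e]) (auto simp: p_def split: if_splits)
      ultimately show "finite {r. p r \<noteq> \<zero>}" by (rule finite_imageD)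
      show "r \<in> E" if "p r \<noteq> \<zero>" for r using that unfolding p_def by (auto split: if_splits)
    qed
    moreover have "x = ?h p"
    proof
      fix i
      show "x i = ?h p i"
      proof (cases "i \<in> e ` E")
        case True
        then show ?thesis using h_e by (auto simp: p_def inv_into_f_f[OF e])
      next
        case False
        then show ?thesis using x by (auto simp: PiE_iff extensional_def)
      qed
    qed
    ultimately show "x \<in> ?h ` carrier (laurent R E)" by auto
  qed
qed


section \<open>Cech cohomology of the twisting sheaves\<close>

lemma cech_simplicesD:
  assumes "\<sigma> \<in> cech_simplices n q"
  shows "\<sigma> \<noteq> {}" "\<sigma> \<subseteq> {..n}" "finite \<sigma>" "card \<sigma> = Suc q"
  using assms unfolding cech_simplices_def by (auto intro: finite_subset)

lemma cech_simplices_0: "cech_simplices n 0 = {{i} | i. i \<le> n}"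
  unfolding cech_simplices_def by (auto simp: card_1_singleton_iff)

lemma cech_simplices_top: "cech_simplices n n = {{..n}}"
proof -
  have "\<sigma> = {..n}" if "\<sigma> \<subseteq> {..n}" "card \<sigma> = Suc n" for \<sigma> :: "nat set"
    using that card_subset_eq[of "{..n}" \<sigma>] by simp
  then show ?thesis unfolding cech_simplices_def by auto
qed

lemma cech_simplices_above_top: "cech_simplices n (Suc n) = {}"
proof -
  have "\<not> (\<sigma> \<subseteq> {..n} \<and> card \<sigma> = Suc (Suc n))" for \<sigma> :: "nat set"
    using card_mono[of "{..n}" \<sigma>] by auto
  then show ?thesis by (simp add: cech_simplices_def)
qed

lemma cech_simplices_remove:
  "\<sigma> \<in> cech_simplices n (Suc q) \<Longrightarrow> i \<in> \<sigma> \<Longrightarrow> \<sigma> - {i} \<in> cech_simplices n q"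
  unfolding cech_simplices_def by (auto simp: finite_subset)

lemma (in cring) laurent_module_map_subset:
  "module_map R (laurent R E) M h \<Longrightarrow> E' \<subseteq> E \<Longrightarrow> module_map R (laurent R E') M h"
  using finsupp_mono[of _ E' E] unfolding module_map_def by auto

context proj_space
begin

section \<open>Cech cochains described by families of Laurent polynomials\<close>

lemma sec_module_map:
  assumes "\<sigma> \<noteq> {}" "\<sigma> \<subseteq> {..n}"
  shows "module_map R (laurent R (laurent_exps n \<sigma> m)) (F m (W \<sigma>)) (sec m (W \<sigma>))"
  by (rule module_mapI)
    (use sec_in_sheaf[OF assms] sec_zero[OF assms] sec_add[OF assms] sec_smult[OF assms] in simp_all)

lemma sheaf_module:
  assumes "\<sigma> \<noteq> {}" "\<sigma> \<subseteq> {..n}"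
  shows "module R (F m (W \<sigma>))"
  using sec_surj[OF assms] by (intro module_image[OF laurent_module sec_module_map[OF assms]]) auto

definition cochain where
  "cochain m q p = (\<lambda>\<rho>\<in>cech_simplices n q. sec m (W \<rho>) (p \<rho>))"

text \<open>The Cech differential on coefficients; no restriction maps appear, since restriction
  does not change the Laurent polynomial.\<close>

definition signed_sum :: "(nat set \<Rightarrow> (nat \<Rightarrow> rat) \<Rightarrow> 'a) \<Rightarrow> nat set \<Rightarrow> (nat \<Rightarrow> rat) \<Rightarrow> 'a" where
  "signed_sum p \<sigma> r =
    (\<Oplus>i\<in>\<sigma>. if even (card {j \<in> \<sigma>. j < i}) then p (\<sigma> - {i}) r else \<ominus> p (\<sigma> - {i}) r)"

lemma cochain_carrier:
  assumes "\<And>\<rho>. \<rho> \<in> cech_simplices n q \<Longrightarrow> p \<rho> \<in> finsupp R (laurent_exps n \<rho> m)"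
  shows "cochain m q p \<in> carrier (cech_cochains (F m) U n q)"
  unfolding cochain_def cech_cochains_def direct_prod_simps
  using sec_in_sheaf[OF cech_simplicesD(1,2) assms] by (intro restrict_PiE_iff[THEN iffD2]) blast

lemma cochain_exists:
  assumes c: "c \<in> carrier (cech_cochains (F m) U n q)"
  obtains p where "\<And>\<rho>. \<rho> \<in> cech_simplices n q \<Longrightarrow> p \<rho> \<in> finsupp R (laurent_exps n \<rho> m)"
    "c = cochain m q p"
proof -
  have cE: "c \<in> (\<Pi>\<^sub>E \<rho>\<in>cech_simplices n q. carrier (F m (W \<rho>)))"
    using c unfolding cech_cochains_def by simp
  have "\<forall>\<rho>\<in>cech_simplices n q. \<exists>p. p \<in> finsupp R (laurent_exps n \<rho> m) \<and> c \<rho> = sec m (W \<rho>) p"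
    using sec_surj[OF cech_simplicesD(1,2)] PiE_mem[OF cE] by blast
  then obtain p where p: "\<And>\<rho>. \<rho> \<in> cech_simplices n q \<Longrightarrow>
      p \<rho> \<in> finsupp R (laurent_exps n \<rho> m) \<and> c \<rho> = sec m (W \<rho>) (p \<rho>)"
    by metis
  have "c = cochain m q p"
  proof
    fix \<rho>
    show "c \<rho> = cochain m q p \<rho>"
      using p PiE_arb[OF cE, of \<rho>] unfolding cochain_def by simp
  qed
  then show ?thesis using that p by blast
qed

lemma signed_sum_eq:
  assumes "finite \<sigma>" "\<And>i. i \<in> \<sigma> \<Longrightarrow> p (\<sigma> - {i}) \<in> finsupp R E"
  shows "signed_sum p \<sigma> = (\<Oplus>\<^bsub>laurent R E\<^esub>i\<in>\<sigma>.
    if even (card {j \<in> \<sigma>. j < i}) then p (\<sigma> - {i}) else (\<lambda>r. \<ominus> p (\<sigma> - {i}) r))"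
proof -
  have "(\<Oplus>\<^bsub>laurent R E\<^esub>i\<in>\<sigma>.
      if even (card {j \<in> \<sigma>. j < i}) then p (\<sigma> - {i}) else (\<lambda>r. \<ominus> p (\<sigma> - {i}) r)) =
      (\<lambda>r. \<Oplus>i\<in>\<sigma>. (if even (card {j \<in> \<sigma>. j < i}) then p (\<sigma> - {i}) else (\<lambda>r. \<ominus> p (\<sigma> - {i}) r)) r)"
    using assms finsupp_neg by (intro laurent_finsum) auto
  then show ?thesis by (simp add: signed_sum_def fun_eq_iff if_distribR)
qed

lemma signed_sum_finsupp:
  assumes "finite \<sigma>" "\<And>i. i \<in> \<sigma> \<Longrightarrow> p (\<sigma> - {i}) \<in> finsupp R E"
  shows "signed_sum p \<sigma> \<in> finsupp R E"
proof -
  interpret L: abelian_group "laurent R E" by (rule laurent_abelian_group)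
  have "(\<Oplus>\<^bsub>laurent R E\<^esub>i\<in>\<sigma>.
    if even (card {j \<in> \<sigma>. j < i}) then p (\<sigma> - {i}) else (\<lambda>r. \<ominus> p (\<sigma> - {i}) r)) \<in> carrier (laurent R E)"
    using assms finsupp_neg by (intro L.finsum_closed) auto
  then show ?thesis using signed_sum_eq[of \<sigma> p E, OF assms] by simp
qed

text \<open>\<open>sec\<close> is additive and commutes with restriction, so the differential can be
  computed on Laurent polynomials.\<close>

lemma cech_diff_cochain:
  assumes p: "\<And>\<rho>. \<rho> \<in> cech_simplices n q \<Longrightarrow> p \<rho> \<in> finsupp R (laurent_exps n \<rho> m)"
  shows "cech_diff (F m) U n q (cochain m q p) = cochain m (Suc q) (signed_sum p)"
proof
  fix \<sigma>
  show "cech_diff (F m) U n q (cochain m q p) \<sigma> = cochain m (Suc q) (signed_sum p) \<sigma>"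
  proof (cases "\<sigma> \<in> cech_simplices n (Suc q)")
    case True
    note \<sigma> = cech_simplicesD[OF True]
    let ?L = "laurent R (laurent_exps n \<sigma> m)"
    let ?t = "\<lambda>i. if even (card {j \<in> \<sigma>. j < i}) then p (\<sigma> - {i}) else (\<lambda>r. \<ominus> p (\<sigma> - {i}) r)"
    interpret FM: module R "F m (W \<sigma>)" by (rule sheaf_module[OF \<sigma>(1,2)])
    \<comment> \<open>A face inverts fewer variables, so its exponents are admissible on the whole
      simplex.\<close>
    have pi: "p (\<sigma> - {i}) \<in> finsupp R (laurent_exps n \<sigma> m)" if "i \<in> \<sigma>" for i
      using p[OF cech_simplices_remove[OF True that]] by (rule finsupp_mono) (rule laurent_exps_mono, blast)
    have t: "?t i \<in> carrier ?L" if "i \<in> \<sigma>" for i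
      using pi[OF that] finsupp_neg by simp
    have sec_t: "(let s = restrict (cochain m q p (\<sigma> - {i})) (W \<sigma>)
        in if even (card {j \<in> \<sigma>. j < i}) then s else \<ominus>\<^bsub>F m (W \<sigma>)\<^esub> s) = sec m (W \<sigma>) (?t i)"
      if i: "i \<in> \<sigma>" for i
    proof -
      have "restrict (cochain m q p (\<sigma> - {i})) (W \<sigma>) = sec m (W \<sigma>) (p (\<sigma> - {i}))"
        unfolding cochain_def using cech_simplices_remove[OF True i] by (simp add: sec_restrict INF_superset_mono)
      moreover have "sec m (W \<sigma>) (\<lambda>r. \<ominus> p (\<sigma> - {i}) r) = \<ominus>\<^bsub>F m (W \<sigma>)\<^esub> sec m (W \<sigma>) (p (\<sigma> - {i}))"
        using module_map_uminus[OF laurent_module FM.module_axioms sec_module_map[OF \<sigma>(1,2)], of "p (\<sigma> - {i})"]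
          pi[OF i] by (simp add: laurent_a_inv)
      ultimately show ?thesis by simp
    qed
    have "cech_diff (F m) U n q (cochain m q p) \<sigma> = (\<Oplus>\<^bsub>F m (W \<sigma>)\<^esub>i\<in>\<sigma>.
        let s = restrict (cochain m q p (\<sigma> - {i})) (W \<sigma>)
        in if even (card {j \<in> \<sigma>. j < i}) then s else \<ominus>\<^bsub>F m (W \<sigma>)\<^esub> s)"
      unfolding cech_diff_def using True by (simp only: restrict_apply if_True Let_def)
    also have "\<dots> = (\<Oplus>\<^bsub>F m (W \<sigma>)\<^esub>i\<in>\<sigma>. sec m (W \<sigma>) (?t i))"
      by (rule FM.finsum_cong'[OF refl _ sec_t]) (use module_mapD(1)[OF sec_module_map[OF \<sigma>(1,2)] t] in blast)
    also have "\<dots> = sec m (W \<sigma>) (\<Oplus>\<^bsub>?L\<^esub>i\<in>\<sigma>. ?t i)"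
      using module_map_finsum[OF laurent_module FM.module_axioms sec_module_map[OF \<sigma>(1,2)] \<sigma>(3) t] by simp
    also have "\<dots> = sec m (W \<sigma>) (signed_sum p \<sigma>)"
      using signed_sum_eq[of \<sigma> p "laurent_exps n \<sigma> m", OF \<sigma>(3) pi] by simp
    finally show ?thesis unfolding cochain_def using True by simp
  next
    case False
    then show ?thesis unfolding cech_diff_def cochain_def by simp
  qed
qed

text \<open>A Laurent polynomial with denominators in \<open>\<tau>\<close> is a section on every
  simplex containing \<open>\<tau>\<close>. The cases of interest are \<open>\<tau> = {}\<close> in
  degree 0 and \<open>\<tau> = {..n}\<close> in degree \<open>n\<close>.\<close>

lemma constant_cochain_module_map:
  assumes "\<And>\<rho>. \<rho> \<in> cech_simplices n q \<Longrightarrow> \<tau> \<subseteq> \<rho>"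
  shows "module_map R (laurent R (laurent_exps n \<tau> m)) (cech_cochains (F m) U n q) (\<lambda>p. cochain m q (\<lambda>_. p))"
proof -
  note sm = module_mapD[OF laurent_module_map_subset[OF sec_module_map[OF cech_simplicesD(1,2)]
    laurent_exps_mono[OF assms]]]
  have mono: "p \<in> finsupp R (laurent_exps n \<rho> m)"
    if "p \<in> finsupp R (laurent_exps n \<tau> m)" "\<rho> \<in> cech_simplices n q" for p \<rho>
    using finsupp_mono[OF that(1) laurent_exps_mono[OF assms[OF that(2)]]] .
  show ?thesis
  proof (rule module_mapI)
    show "cochain m q (\<lambda>_. p) \<in> carrier (cech_cochains (F m) U n q)"
      if "p \<in> carrier (laurent R (laurent_exps n \<tau> m))" for p
      using that mono by (intro cochain_carrier) auto
  qed (unfold cochain_def cech_cochains_def direct_prod_simps, (rule restrict_ext, insert sm, force)+)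
qed

lemma constant_cochain_inj:
  assumes "\<rho> \<in> cech_simplices n q" "\<tau> \<subseteq> \<rho>" "p \<in> finsupp R (laurent_exps n \<tau> m)"
    "p' \<in> finsupp R (laurent_exps n \<tau> m)" "cochain m q (\<lambda>_. p) = cochain m q (\<lambda>_. p')"
  shows "p = p'"
proof (rule sec_inj[OF cech_simplicesD(1,2)[OF assms(1)]])
  show "p \<in> finsupp R (laurent_exps n \<rho> m)" "p' \<in> finsupp R (laurent_exps n \<rho> m)"
    using finsupp_mono[OF _ laurent_exps_mono[OF assms(2)]] assms(3,4) by auto
  show "sec m (W \<rho>) p = sec m (W \<rho>) p'"
    using fun_cong[OF assms(5), of \<rho>] assms(1) by (simp add: cochain_def)
qed

text \<open>\<open>A\<close> collects the exponents of the coboundaries and \<open>B\<close> the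
  remaining ones. Splitting a polynomial by its exponents shows that its \<open>B\<close> part
  represents the class, and does so uniquely. For \<open>H0_iso\<close> the set \<open>A\<close> is
  empty; for \<open>Hn_iso\<close> it consists of the exponents with a nonnegative entry.\<close>

lemma cohomology_iso:
  assumes \<tau>: "\<And>\<rho>. \<rho> \<in> cech_simplices n q \<Longrightarrow> \<tau> \<subseteq> \<rho>" and ne: "cech_simplices n q \<noteq> {}"
    and E: "laurent_exps n \<tau> m = A \<union> B" "A \<inter> B = {}"
    and cocycles: "carrier (cech_cocycles (F m) U n q) = (\<lambda>p. cochain m q (\<lambda>_. p)) ` finsupp R (A \<union> B)"
    and coboundaries: "cech_coboundaries (F m) U n q = (\<lambda>p. cochain m q (\<lambda>_. p)) ` finsupp R A"
  shows "\<exists>\<phi>. \<phi> \<in> module_iso R (laurent R B) (cech_cohomology (F m) U n q)"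
proof -
  let ?M = "cech_cocycles (F m) U n q" and ?k = "\<lambda>p. cochain m q (\<lambda>_. p)"
  have ops: "\<zero>\<^bsub>?M\<^esub> = \<zero>\<^bsub>cech_cochains (F m) U n q\<^esub>" "x \<oplus>\<^bsub>?M\<^esub> y = x \<oplus>\<^bsub>cech_cochains (F m) U n q\<^esub> y"
    "c \<odot>\<^bsub>?M\<^esub> x = c \<odot>\<^bsub>cech_cochains (F m) U n q\<^esub> x" for x y c
    by (simp_all add: cech_cocycles_def)
  have k: "module_map R (laurent R (A \<union> B)) ?M ?k"
    using constant_cochain_module_map[OF \<tau>, of q m] cocycles
    unfolding module_map_def ops E(1) by auto
  have kA: "module_map R (laurent R A) ?M ?k" and kB: "module_map R (laurent R B) ?M ?k"
    by (rule laurent_module_map_subset[OF k]; blast)+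
  have M: "module R ?M"
    by (rule module_image[OF laurent_module k]) (simp add: cocycles)
  have "(\<lambda>c. cech_coboundaries (F m) U n q +>\<^bsub>?M\<^esub> ?k c) \<in>
      module_iso R (laurent R B) (quot_module ?M (cech_coboundaries (F m) U n q))"
  proof (rule quot_module_iso[OF M laurent_module laurent_module kB kA])
    show "cech_coboundaries (F m) U n q = ?k ` carrier (laurent R A)" using coboundaries by simp
    fix x assume "x \<in> carrier ?M"
    then obtain p where p: "p \<in> finsupp R (A \<union> B)" "x = ?k p" using cocycles by blast
    let ?a = "\<lambda>r. if r \<in> A then p r else \<zero>" and ?b = "\<lambda>r. if r \<in> B then p r else \<zero>"
    have ab: "?a \<in> finsupp R A" "?b \<in> finsupp R B"
      using finsupp_restrict[OF p(1), of "\<lambda>r. r \<in> A"] finsupp_restrict[OF p(1), of "\<lambda>r. r \<in> B"]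
      by (auto elim: finsupp_mono)
    have "p = (\<lambda>r. ?a r \<oplus> ?b r)"
    proof
      fix r
      show "p r = ?a r \<oplus> ?b r"
        using p(1) finsuppD[OF p(1), of r] E(2) by (cases "p r = \<zero>") auto
    qed
    moreover have "?k (\<lambda>r. ?a r \<oplus> ?b r) = ?k ?a \<oplus>\<^bsub>?M\<^esub> ?k ?b"
      using module_mapD(3)[OF k, of ?a ?b] ab finsupp_mono[of _ A "A \<union> B"] finsupp_mono[of _ B "A \<union> B"] by simp
    ultimately have "x = ?k ?a \<oplus>\<^bsub>?M\<^esub> ?k ?b" using p(2) by metis
    then show "\<exists>c\<in>carrier (laurent R B). \<exists>d\<in>carrier (laurent R A). x = ?k d \<oplus>\<^bsub>?M\<^esub> ?k c"
      using ab by (intro bexI[of _ ?b] bexI[of _ ?a]) auto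
  next
    fix c c' d assume "c \<in> carrier (laurent R B)" "c' \<in> carrier (laurent R B)" "d \<in> carrier (laurent R A)"
      and eq: "?k c = ?k d \<oplus>\<^bsub>?M\<^esub> ?k c'"
    then have c: "c \<in> finsupp R B" "c' \<in> finsupp R B" "d \<in> finsupp R A" by auto
    have c': "c \<in> finsupp R (A \<union> B)" "c' \<in> finsupp R (A \<union> B)" "d \<in> finsupp R (A \<union> B)"
      using c by (auto intro: finsupp_mono)
    have "?k c = ?k (\<lambda>r. d r \<oplus> c' r)" using eq module_mapD(3)[OF k, of d c'] c' by simp
    moreover obtain \<rho> where "\<rho> \<in> cech_simplices n q" using ne by blast
    ultimately have cd: "c = (\<lambda>r. d r \<oplus> c' r)"
      using constant_cochain_inj[of \<rho> q \<tau> c m "\<lambda>r. d r \<oplus> c' r"] \<tau> c' finsupp_add E(1) by simp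
    show "c = c'"
    proof
      fix r
      show "c r = c' r"
      \<comment> \<open>On \<open>A\<close> both \<open>c\<close> and \<open>c'\<close> vanish; off
        \<open>A\<close> the coboundary part \<open>d\<close> does.\<close>
      proof (cases "r \<in> A")
        case True
        then have "r \<notin> B" using E(2) by blast
        then show ?thesis using finsuppD[OF c(1), of r] finsuppD[OF c(2), of r] by metis
      next
        case False
        then have "d r = \<zero>" using finsuppD[OF c(3), of r] by blast
        then show ?thesis using fun_cong[OF cd, of r] c(2) by simp
      qed
    qed
  qed
  then show ?thesis unfolding cech_cohomology_def by blast
qed

section \<open>The zeroth and the top cohomology\<close>

lemma signed_sum_pair:
  assumes "i < j" "p {i} r \<in> carrier R" "p {j} r \<in> carrier R"
  shows "signed_sum p {i, j} r = p {j} r \<oplus> \<ominus> p {i} r"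
proof -
  define f where "f k = (if even (card {l \<in> {i, j}. l < k}) then p ({i, j} - {k}) r
    else \<ominus> p ({i, j} - {k}) r)" for k
  \<comment> \<open>Deleting the smaller vertex \<open>i\<close> leaves \<open>{j}\<close> with sign
    plus; deleting \<open>j\<close> leaves \<open>{i}\<close> with sign minus.\<close>
  have faces: "{i, j} - {i} = {j}" "{i, j} - {j} = {i}" "{k \<in> {i, j}. k < i} = {}" "{k \<in> {i, j}. k < j} = {i}"
    using assms(1) by auto
  have f: "f i = p {j} r" "f j = \<ominus> p {i} r" by (simp_all only: f_def faces) simp_all
  then have fc: "f i \<in> carrier R" "f j \<in> carrier R" using assms by simp_all
  have "signed_sum p {i, j} r = finsum R f (insert i (insert j {}))"
    unfolding signed_sum_def f_def ..
  also have "\<dots> = f i \<oplus> f j"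
    using assms(1) fc by simp
  finally show ?thesis unfolding f .
qed

lemma cech_cocycles_carrier:
  "carrier (cech_cocycles (F m) U n q) =
    {c \<in> carrier (cech_cochains (F m) U n q). cech_diff (F m) U n q c = \<zero>\<^bsub>cech_cochains (F m) U n (Suc q)\<^esub>}"
  by (simp add: cech_cocycles_def a_kernel_def')

lemma H0_iso:
  assumes n: "n \<ge> 1"
  shows "\<exists>\<phi>. \<phi> \<in> module_iso R (laurent R (laurent_exps n {} m)) (H_twist R n 0 m)"
  unfolding H_twist_def
proof (rule cohomology_iso[where A = "{}" and \<tau> = "{}"])
  let ?k = "\<lambda>p. cochain m 0 (\<lambda>_. p)"
  have zero1: "\<zero>\<^bsub>cech_cochains (F m) U n (Suc 0)\<^esub> = cochain m (Suc 0) (\<lambda>_ _. \<zero>)"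
    unfolding cochain_def cech_cochains_def direct_prod_simps
    using sec_zero[OF cech_simplicesD(1,2)] by (intro restrict_ext) simp
  show "carrier (cech_cocycles (F m) U n 0) = ?k ` finsupp R ({} \<union> laurent_exps n {} m)"
  proof (intro equalityI subsetI)
    fix c assume "c \<in> carrier (cech_cocycles (F m) U n 0)"
    then have c: "c \<in> carrier (cech_cochains (F m) U n 0)"
      and dc: "cech_diff (F m) U n 0 c = \<zero>\<^bsub>cech_cochains (F m) U n (Suc 0)\<^esub>"
      unfolding cech_cocycles_carrier by auto
    obtain p where p: "\<And>\<rho>. \<rho> \<in> cech_simplices n 0 \<Longrightarrow> p \<rho> \<in> finsupp R (laurent_exps n \<rho> m)"
      and cp: "c = cochain m 0 p"
      using cochain_exists[OF c] by blast
    have pi: "p {i} \<in> finsupp R (laurent_exps n {i} m)" if "i \<le> n" for i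
      using p that cech_simplices_0 by blast
    have eq_less: "p {i} = p {j}" if ij: "i < j" "j \<le> n" for i j
    proof
      fix r
      have \<sigma>: "{i, j} \<in> cech_simplices n (Suc 0)" using ij by (simp add: cech_simplices_def)
      have "cochain m (Suc 0) (signed_sum p) = cochain m (Suc 0) (\<lambda>_ _. \<zero>)"
        using dc cech_diff_cochain[of 0 p m, OF p] by (simp only: cp zero1)
      from fun_cong[OF this, of "{i, j}"]
      have "sec m (W {i, j}) (signed_sum p {i, j}) = sec m (W {i, j}) (\<lambda>_. \<zero>)"
        by (simp only: cochain_def restrict_apply \<sigma> if_True)
      moreover have "signed_sum p {i, j} \<in> finsupp R (laurent_exps n {i, j} m)"
      proof (rule signed_sum_finsupp)
        show "p ({i, j} - {k}) \<in> finsupp R (laurent_exps n {i, j} m)" if "k \<in> {i, j}" for k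
          using p[OF cech_simplices_remove[OF \<sigma> that]]
          by (rule finsupp_mono[OF _ laurent_exps_mono]) blast
      qed simp
      \<comment> \<open>Injectivity of \<open>sec\<close> on the overlap of two charts turns a
        vanishing section into a vanishing polynomial.\<close>
      ultimately have "signed_sum p {i, j} = (\<lambda>_. \<zero>)"
        using sec_inj[OF cech_simplicesD(1,2)[OF \<sigma>]] finsupp_zero by blast
      then have "p {j} r \<oplus> \<ominus> p {i} r = \<zero>"
        using signed_sum_pair[of i j p r] pi[of i] pi[of j] ij by simp
      then show "p {i} r = p {j} r"
        using r_right_minus_eq[of "p {j} r" "p {i} r"] pi[of i] pi[of j] ij by (simp add: a_minus_def)
    qed
    have eq: "p {i} = p {0}" if "i \<le> n" for i
      using eq_less[of 0 i] that by (cases "i = 0") auto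
    have "p {0} \<in> finsupp R (laurent_exps n {} m)"
    proof (rule finsuppI)
      show "p {0} r \<in> carrier R" for r using pi[of 0] by simp
      show "finite {r. p {0} r \<noteq> \<zero>}" using finsupp_finite[OF pi[of 0]] by simp
      fix r assume "p {0} r \<noteq> \<zero>"
      \<comment> \<open>In the chart of index 0 only \<open>r 0\<close> may be negative, in that of
        index 1 only \<open>r 1\<close>; since \<open>p {0} = p {1}\<close>, neither is. The chart
        of index 1 exists because \<open>n \<ge> 1\<close>.\<close>
      then have "r \<in> laurent_exps n {0} m" "r \<in> laurent_exps n {1} m"
        using finsuppD[OF pi[of 0]] finsuppD[OF pi[of 1]] eq[of 1] n by auto
      then show "r \<in> laurent_exps n {} m" unfolding laurent_exps_def by auto
    qed
    moreover have "c = ?k (p {0})"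
      unfolding cp cochain_def
    proof (rule restrict_ext)
      fix \<rho> assume "\<rho> \<in> cech_simplices n 0"
      then obtain i where i: "\<rho> = {i}" "i \<le> n" using cech_simplices_0 by blast
      show "sec m (W \<rho>) (p \<rho>) = sec m (W \<rho>) (p {0})" by (simp only: i(1) eq[OF i(2)])
    qed
    ultimately show "c \<in> ?k ` finsupp R ({} \<union> laurent_exps n {} m)" by simp
  next
    fix c assume "c \<in> ?k ` finsupp R ({} \<union> laurent_exps n {} m)"
    then obtain p where p: "p \<in> finsupp R (laurent_exps n {} m)" "c = ?k p" by auto
    have p': "p \<in> finsupp R (laurent_exps n \<rho> m)" for \<rho>
      using finsupp_mono[OF p(1) laurent_exps_mono] by blast
    have "sec m (W \<sigma>) (signed_sum (\<lambda>_. p) \<sigma>) = sec m (W \<sigma>) (\<lambda>_. \<zero>)" if "\<sigma> \<in> cech_simplices n (Suc 0)" for \<sigma>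
    proof -
      have "card \<sigma> = 2" using that by (simp add: cech_simplices_def)
      then obtain i j where "\<sigma> = {i, j}" "i < j"
        by (metis card_2_iff insert_commute linorder_neqE_nat)
      then have "signed_sum (\<lambda>_. p) \<sigma> = (\<lambda>_. \<zero>)"
        using signed_sum_pair[of i j "\<lambda>_. p"] p(1) by (auto simp: r_neg)
      then show ?thesis by simp
    qed
    then have "cochain m (Suc 0) (signed_sum (\<lambda>_. p)) = cochain m (Suc 0) (\<lambda>_ _. \<zero>)"
      unfolding cochain_def by (rule restrict_ext)
    then have "cech_diff (F m) U n 0 c = cochain m (Suc 0) (\<lambda>_ _. \<zero>)"
      using cech_diff_cochain[of 0 "\<lambda>_. p" m, OF p'] by (simp only: p(2))
    then show "c \<in> carrier (cech_cocycles (F m) U n 0)"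
      unfolding cech_cocycles_carrier zero1 using cochain_carrier[of 0 "\<lambda>_. p", OF p'] p(2) by simp
  qed
  \<comment> \<open>In degree 0 the only coboundary is zero, which matches the empty exponent
    set.\<close>
  have "finsupp R {} = {\<lambda>_. \<zero>}"
    by (auto simp: finsupp_def)
  moreover have "\<zero>\<^bsub>cech_cochains (F m) U n 0\<^esub> = ?k (\<lambda>_. \<zero>)"
    unfolding cochain_def cech_cochains_def direct_prod_simps
    using sec_zero[OF cech_simplicesD(1,2)] by (intro restrict_ext) simp
  ultimately show "cech_coboundaries (F m) U n 0 = ?k ` finsupp R {}"
    by (simp add: cech_coboundaries_def)
  show "cech_simplices n 0 \<noteq> {}" by (auto simp: cech_simplices_0)
qed auto

text \<open>There is a single top simplex and none above it, so top cochains are single Laurent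
  polynomials and all of them are cocycles. The face omitting \<open>i\<close> admits exactly the
  exponents that are nonnegative at \<open>i\<close>, so the images of the faces together span the
  exponents with some nonnegative entry.\<close>

lemma Hn_iso:
  assumes n: "n \<ge> 1"
  shows "\<exists>\<phi>. \<phi> \<in> module_iso R (laurent R {r \<in> laurent_exps n {..n} m. \<forall>i\<le>n. r i < 0}) (H_twist R n n m)"
  unfolding H_twist_def
proof (rule cohomology_iso[where \<tau> = "{..n}"])
  let ?k = "\<lambda>p. cochain m n (\<lambda>_. p)"
  let ?A = "{r \<in> laurent_exps n {..n} m. \<exists>i\<le>n. 0 \<le> r i}"
    and ?B = "{r \<in> laurent_exps n {..n} m. \<forall>i\<le>n. r i < 0}"
  \<comment> \<open>The coboundaries come from degree \<open>q = n - 1\<close>, whose simplices are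
    the faces \<open>{..n} - {i}\<close>.\<close>
  obtain q where q: "n = Suc q" using n by (cases n) auto
  show AB: "laurent_exps n {..n} m = ?A \<union> ?B" "?A \<inter> ?B = {}" by force+
  show "{..n} \<subseteq> \<rho>" if "\<rho> \<in> cech_simplices n n" for \<rho> using that cech_simplices_top by simp
  show "cech_simplices n n \<noteq> {}" by (simp add: cech_simplices_top)
  have k_const: "cochain m n p = ?k (p {..n})" for p
    unfolding cochain_def by (intro restrict_ext) (simp add: cech_simplices_top)
  have "cech_diff (F m) U n n c = \<zero>\<^bsub>cech_cochains (F m) U n (Suc n)\<^esub>" for c
    by (simp add: cech_diff_def cech_cochains_def cech_simplices_above_top restrict_def)
  then have "carrier (cech_cocycles (F m) U n n) = carrier (cech_cochains (F m) U n n)"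
    unfolding cech_cocycles_carrier by simp
  also have "\<dots> = ?k ` finsupp R (laurent_exps n {..n} m)"
  proof (intro equalityI subsetI)
    fix c assume "c \<in> carrier (cech_cochains (F m) U n n)"
    then obtain p where "\<And>\<rho>. \<rho> \<in> cech_simplices n n \<Longrightarrow> p \<rho> \<in> finsupp R (laurent_exps n \<rho> m)"
      "c = cochain m n p"
      using cochain_exists by blast
    then show "c \<in> ?k ` finsupp R (laurent_exps n {..n} m)"
      using k_const[of p] by (simp add: cech_simplices_top)
  next
    fix c assume "c \<in> ?k ` finsupp R (laurent_exps n {..n} m)"
    then show "c \<in> carrier (cech_cochains (F m) U n n)"
      using cochain_carrier[of n _ m] by (auto simp: cech_simplices_top)
  qed
  finally show "carrier (cech_cocycles (F m) U n n) = ?k ` finsupp R (?A \<union> ?B)"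
    using AB(1) by simp
  have simplex: "\<exists>i\<le>n. \<rho> = {..n} - {i}" if \<rho>: "\<rho> \<in> cech_simplices n q" for \<rho>
  proof -
    have "card ({..n} - \<rho>) = 1"
      using cech_simplicesD[OF \<rho>] q by (simp add: card_Diff_subset)
    then obtain i where "{..n} - \<rho> = {i}" by (auto simp: card_1_singleton_iff)
    then show ?thesis using cech_simplicesD(2)[OF \<rho>] by (intro exI[of _ i]) auto
  qed
  have face: "{..n} - {i} \<in> cech_simplices n q" if "i \<le> n" for i
    using cech_simplices_remove[of "{..n}" n q i] cech_simplices_top[of n] that q by simp
  have face_exps: "laurent_exps n ({..n} - {i}) m = {r \<in> laurent_exps n {..n} m. 0 \<le> r i}" if "i \<le> n" for i
    using that unfolding laurent_exps_def by auto
  have "cech_coboundaries (F m) U n n = cech_diff (F m) U n q ` carrier (cech_cochains (F m) U n q)"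
    using q by (simp add: cech_coboundaries_def)
  also have "\<dots> = ?k ` finsupp R ?A"
  proof (intro equalityI subsetI)
    fix c assume "c \<in> cech_diff (F m) U n q ` carrier (cech_cochains (F m) U n q)"
    then obtain b where b: "b \<in> carrier (cech_cochains (F m) U n q)" "c = cech_diff (F m) U n q b" by blast
    obtain p where p: "\<And>\<rho>. \<rho> \<in> cech_simplices n q \<Longrightarrow> p \<rho> \<in> finsupp R (laurent_exps n \<rho> m)"
      "b = cochain m q p"
      using cochain_exists[OF b(1)] by blast
    have "c = ?k (signed_sum p {..n})"
      using cech_diff_cochain[of q p m, OF p(1)] k_const[of "signed_sum p"] q by (simp only: b(2) p(2))
    moreover have "signed_sum p {..n} \<in> finsupp R ?A"
    proof (rule signed_sum_finsupp)
      fix i assume "i \<in> {..n}"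
      then have i: "i \<le> n" by simp
      show "p ({..n} - {i}) \<in> finsupp R ?A"
        using p(1)[OF face[OF i]] by (rule finsupp_mono) (use face_exps[OF i] i in auto)
    qed simp
    ultimately show "c \<in> ?k ` finsupp R ?A" by blast
  next
    fix c assume "c \<in> ?k ` finsupp R ?A"
    then obtain d where d: "d \<in> finsupp R ?A" "c = ?k d" by blast
    \<comment> \<open>Each monomial of \<open>d\<close> is assigned to the first variable that has a nonnegative exponent.\<close>
    let ?l = "\<lambda>r :: nat \<Rightarrow> rat. LEAST j. j \<le> n \<and> 0 \<le> r j"
    define part where "part i = (\<lambda>r. if ?l r = i then d r else \<zero>)" for i
    \<comment> \<open>The description recovers the vertex that a face omits; the sign is inserted in
      advance so that it cancels the one in \<open>signed_sum\<close>.\<close>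
    define p where "p \<rho> = (let i = (THE i. i \<in> {..n} - \<rho>) in
      if even (card {j \<in> {..n}. j < i}) then part i else (\<lambda>r. \<ominus> part i r))" for \<rho>
    have l: "?l r \<le> n" "0 \<le> r (?l r)" if "d r \<noteq> \<zero>" for r
    proof -
      have "\<exists>j. j \<le> n \<and> 0 \<le> r j" using finsuppD[OF d(1) that] by blast
      from LeastI_ex[OF this] show "?l r \<le> n" "0 \<le> r (?l r)" by auto
    qed
    have part: "part i \<in> finsupp R (laurent_exps n ({..n} - {i}) m)" if i: "i \<le> n" for i
    proof -
      have "part i \<in> finsupp R {r \<in> ?A. ?l r = i}"
        unfolding part_def by (rule finsupp_restrict[OF d(1)])
      then show ?thesis
        using l(2) i unfolding face_exps[OF i]
        by (auto simp: finsupp_def part_def split: if_splits)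
    qed
    have p_face: "p ({..n} - {i}) =
        (if even (card {j \<in> {..n}. j < i}) then part i else (\<lambda>r. \<ominus> part i r))" if i: "i \<le> n" for i
    proof -
      have "{..n} - ({..n} - {i}) = {i}" using i by auto
      then have "(THE j. j \<in> {..n} - ({..n} - {i})) = i" by simp
      then show ?thesis unfolding p_def Let_def by simp
    qed
    have p: "p \<rho> \<in> finsupp R (laurent_exps n \<rho> m)" if \<rho>: "\<rho> \<in> cech_simplices n q" for \<rho>
    proof -
      obtain i where i: "i \<le> n" "\<rho> = {..n} - {i}" using simplex[OF \<rho>] by blast
      show ?thesis unfolding i(2) p_face[OF i(1)] using part[OF i(1)] finsupp_neg by simp
    qed
    have "signed_sum p {..n} = d"
    proof
      fix r
      have pc: "part i r \<in> carrier R" for i using d(1) by (auto simp: part_def)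
      have "signed_sum p {..n} r = (\<Oplus>i\<in>{..n}. part i r)"
        unfolding signed_sum_def using pc by (intro finsum_cong' refl) (auto simp: p_face)
      also have "\<dots> = d r"
      proof (cases "d r = \<zero>")
        case True
        then show ?thesis by (simp add: part_def cong: if_cong)
      next
        case False
        then show ?thesis using d(1) l(1)[OF False] unfolding part_def by (subst finsum_singleton) auto
      qed
      finally show "signed_sum p {..n} r = d r" .
    qed
    then have "c = cech_diff (F m) U n q (cochain m q p)"
      using cech_diff_cochain[of q p m, OF p] k_const[of "signed_sum p"] q by (simp only: d(2))
    then show "c \<in> cech_diff (F m) U n q ` carrier (cech_cochains (F m) U n q)"
      using cochain_carrier[OF p] by blast
  qed
  finally show "cech_coboundaries (F m) U n n = ?k ` finsupp R ?A" .
qed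

end


text \<open>Among integral exponents only \<open>(-1, ..., -1)\<close> qualifies. Moving a rational
  amount \<open>t\<close> from coordinate 0 to coordinate 1 keeps the sum and, for
  \<open>0 < t < 1\<close>, the signs; the second coordinate exists because
  \<open>n \<ge> 1\<close>.\<close>

lemma top_exps_infinite:
  assumes n: "n \<ge> 1"
  shows "infinite {r \<in> laurent_exps n {..n} (- of_nat n - 1). \<forall>i\<le>n. r i < 0}" (is "infinite ?B")
proof -
  \<comment> \<open>The offset 2 gives \<open>t 0 = 1/2\<close>, so that \<open>t k < 1\<close>
    already at \<open>k = 0\<close>.\<close>
  define t where "t k = inverse (of_nat (k + 2) :: rat)" for k
  define f where "f k = (\<lambda>i :: nat. if i = 0 then - 1 - t k else if i = 1 then t k - 1 else if i \<le> n then - 1 else 0)" for k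
  have t: "0 < t k" "t k < 1" for k unfolding t_def by (simp_all add: field_simps)
  have "f k \<in> ?B" for k
  proof -
    have "(\<Sum>i\<le>n. f k i) = (\<Sum>i\<le>n. - 1 + ((if i = 0 then - t k else 0) + (if i = 1 then t k else 0)))"
      by (rule sum.cong) (auto simp: f_def)
    also have "\<dots> = - of_nat n - 1"
      using n by (simp add: sum.distrib sum_subtractf)
    finally have "(\<Sum>i\<le>n. f k i) = - of_nat n - 1" .
    moreover have "f k i < 0" if "i \<le> n" for i using t[of k] that by (simp add: f_def)
    moreover have "f k i = 0" if "i > n" for i using n that by (simp add: f_def)
    ultimately show ?thesis by (simp add: laurent_exps_def)
  qed
  moreover have "inj f"
  proof (rule injI)
    fix k l assume "f k = f l"
    then have "f k 0 = f l 0" by simp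
    then show "k = l" by (simp add: f_def t_def)
  qed
  ultimately show ?thesis
    using infinite_super[of "range f" ?B] range_inj_infinite by blast
qed

text \<open>
  The basis of the top cohomology has to be indexed by elements of the type of cohomology classes,
  whatever \<open>R\<close> is; an exponent vector is encoded as the set of codes of the points of its graph.
\<close>

definition exponent_code :: "(nat \<Rightarrow> rat) \<Rightarrow> nat set \<Rightarrow> 'x \<Rightarrow> 'y set" where
  "exponent_code r A = (if A = range (\<lambda>i. to_nat (i, r i)) then (\<lambda>_. UNIV) else (\<lambda>_. {}))"

text \<open>Two codes are compared at the coded graph of \<open>r\<close>: \<open>UNIV\<close> and
  \<open>{}\<close> differ in \<open>'y set\<close> for every type \<open>'y\<close>, even one with
  a single element, and the graph determines the function. The outer singleton gives the code the
  type of a coset.\<close>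

lemma inj_exponent_code: "inj (\<lambda>r. {exponent_code r :: nat set \<Rightarrow> 'x \<Rightarrow> 'y set})"
proof (rule injI)
  fix r s :: "nat \<Rightarrow> rat"
  assume "{exponent_code r :: nat set \<Rightarrow> 'x \<Rightarrow> 'y set} = {exponent_code s}"
  then have "(exponent_code r :: nat set \<Rightarrow> 'x \<Rightarrow> 'y set) = exponent_code s" by (rule singleton_inject)
  from fun_cong[OF this, of "range (\<lambda>i. to_nat (i, r i))"]
  have eq: "range (\<lambda>i. to_nat (i, r i)) = range (\<lambda>i. to_nat (i, s i))"
    by (auto simp: exponent_code_def fun_eq_iff split: if_splits)
  show "r = s"
  proof
    fix i
    obtain j where "to_nat (i, r i) = to_nat (j, s j)" using eq by blast
    then show "r i = s i" by auto
  qed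
qed

section \<open>Assembly of the graded isomorphism from its degrees\<close>

context proj_space
begin

text \<open>A polynomial is sent to the family of images of its components, almost all of which
  vanish. Conversely, components of different degrees have disjoint supports, so a finitely
  supported family can be put back together.\<close>

lemma graded_iso_direct_sum:
  assumes \<phi>: "\<And>m. \<phi> m \<in> module_iso R (laurent R (laurent_exps n {} m)) (H m)"
  shows "(\<lambda>p m. \<phi> m (qcomp R n m p)) \<in> graded_module_iso R S G (direct_sum UNIV H) (direct_sum_grading H)"
    (is "?h \<in> _")
proof -
  have exps: "laurent_exps n {} m = {r \<in> exponents n. (\<Sum>i\<le>n. r i) = m}" for m
    unfolding laurent_exps_def exponents_def by auto
  have car: "carrier (laurent R (laurent_exps n {} m)) = G m" for m
    by (simp add: exps qpoly_grading_eq)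
  have bij: "bij_betw (\<phi> m) (G m) (carrier (H m))" for m
    using \<phi>[of m] unfolding module_iso_def car by blast
  note \<phi>D = module_mapD[OF module_iso_map[OF \<phi>], unfolded car]
  have comp: "qcomp R n m p \<in> G m" if "p \<in> carrier S" for m p
    using S.comp_G[OF that] .
  have zero_iff: "\<phi> m x = \<zero>\<^bsub>H m\<^esub> \<longleftrightarrow> x = (\<lambda>_. \<zero>)" if "x \<in> G m" for m x
    using \<phi>D(2)[of m] bij_betw_imp_inj_on[OF bij[of m]] that S.zero_G[of m] unfolding inj_on_def by force
  have closed: "?h p \<in> carrier (direct_sum UNIV H)" if p: "p \<in> carrier S" for p
  proof -
    have "finite {m. ?h p m \<noteq> \<zero>\<^bsub>H m\<^esub>}"
      using S.comp_finite[OF p] zero_iff[OF comp[OF p]] by simp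
    then show ?thesis using \<phi>D(1)[OF comp[OF p]] by (simp add: PiE_UNIV_domain)
  qed
  have qcomp_deg: "qcomp R n (\<Sum>i\<le>n. r i) p r = p r" for p r by (simp add: qcomp_def)
  have onto: "\<exists>p\<in>carrier S. x = ?h p" if x: "x \<in> carrier (direct_sum UNIV H)" for x
  proof -
    have xm: "x m \<in> carrier (H m)" and fin: "finite {m. x m \<noteq> \<zero>\<^bsub>H m\<^esub>}" for m
      using x by auto
    have "\<exists>y. y \<in> G m \<and> x m = \<phi> m y" for m
      using bij_betw_imp_surj_on[OF bij[of m]] xm[of m] by blast
    then obtain y where y: "\<And>m. y m \<in> G m" "\<And>m. x m = \<phi> m (y m)" by metis
    have y_supp: "r \<in> exponents n" "(\<Sum>i\<le>n. r i) = m" if "y m r \<noteq> \<zero>" for m r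
      using finsuppD[of "y m"] y(1)[of m] that unfolding qpoly_grading_eq by blast+
    \<comment> \<open>The coefficient at \<open>r\<close> is taken from the member of the family in
      the degree of \<open>r\<close>.\<close>
    define p where "p r = y (\<Sum>i\<le>n. r i) r" for r
    have "p \<in> finsupp R (exponents n)"
    proof (rule finsuppI)
      show "p r \<in> carrier R" for r
        unfolding p_def using y(1) finsupp_closed unfolding qpoly_grading_eq by blast
      show "r \<in> exponents n" if "p r \<noteq> \<zero>" for r using that y_supp unfolding p_def by blast
      \<comment> \<open>Where \<open>x m\<close> vanishes, so does \<open>y m\<close>, by
        injectivity of \<open>\<phi> m\<close>; finitely many degrees with finitely many exponents
        each remain.\<close>
      have "{r. p r \<noteq> \<zero>} \<subseteq> (\<Union>m\<in>{m. x m \<noteq> \<zero>\<^bsub>H m\<^esub>}. {r. y m r \<noteq> \<zero>})"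
      proof
        fix r assume "r \<in> {r. p r \<noteq> \<zero>}"
        then have r: "y (\<Sum>i\<le>n. r i) r \<noteq> \<zero>" unfolding p_def by simp
        then have "x (\<Sum>i\<le>n. r i) \<noteq> \<zero>\<^bsub>H (\<Sum>i\<le>n. r i)\<^esub>"
          unfolding y(2) zero_iff[OF y(1)] by (metis)
        then show "r \<in> (\<Union>m\<in>{m. x m \<noteq> \<zero>\<^bsub>H m\<^esub>}. {r. y m r \<noteq> \<zero>})" using r by blast
      qed
      moreover have "finite {r. y m r \<noteq> \<zero>}" for m
        using y(1)[of m] finsupp_finite unfolding qpoly_grading_eq by blast
      ultimately show "finite {r. p r \<noteq> \<zero>}"
        using fin by (meson finite_UN_I finite_subset)
    qed
    moreover have "qcomp R n m p = y m" for m
    proof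
      fix r
      show "qcomp R n m p r = y m r"
        using y_supp(2)[of m r] unfolding qcomp_def p_def by (cases "y m r = \<zero>") auto
    qed
    then have "x = ?h p" using y(2) by (intro ext) simp
    ultimately show ?thesis by (intro bexI[of _ p]) simp_all
  qed
  have "?h \<in> module_iso R S (direct_sum UNIV H)"
  proof (rule module_isoI)
    show "module R S" unfolding qpoly_ring_eq_laurent by (rule laurent_module)
    show "module_map R S (direct_sum UNIV H) ?h"
    proof (rule module_mapI)
      show "?h \<zero>\<^bsub>S\<^esub> = \<zero>\<^bsub>direct_sum UNIV H\<^esub>"
        using zero_iff[OF S.zero_G] S.comp_zero by (simp add: restrict_def)
      show "?h (p \<oplus>\<^bsub>S\<^esub> q) = ?h p \<oplus>\<^bsub>direct_sum UNIV H\<^esub> ?h q"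
        if "p \<in> carrier S" "q \<in> carrier S" for p q
        using \<phi>D(3)[OF comp[OF that(1)] comp[OF that(2)]] S.comp_add[OF that] by (simp add: restrict_def)
      show "?h (c \<odot>\<^bsub>S\<^esub> p) = c \<odot>\<^bsub>direct_sum UNIV H\<^esub> ?h p"
        if "c \<in> carrier R" "p \<in> carrier S" for c p
      proof -
        have "qcomp R n m (\<lambda>r. c \<otimes> p r) = (\<lambda>r. c \<otimes> qcomp R n m p r)" for m
          using that(1) by (auto simp: qcomp_def)
        then show ?thesis using \<phi>D(4)[OF that(1) comp[OF that(2)]] by (simp add: restrict_def)
      qed
    qed (rule closed)
    show "inj_on ?h (carrier S)"
    proof (rule inj_onI, rule ext)
      fix p q and r :: "nat \<Rightarrow> rat"
      assume pq: "p \<in> carrier S" "q \<in> carrier S" and eq: "?h p = ?h q"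
      let ?m = "\<Sum>i\<le>n. r i"
      have "\<phi> ?m (qcomp R n ?m p) = \<phi> ?m (qcomp R n ?m q)" using fun_cong[OF eq, of ?m] .
      then have "qcomp R n ?m p = qcomp R n ?m q"
        using inj_onD[OF bij_betw_imp_inj_on[OF bij[of ?m]]] comp pq by blast
      then show "p r = q r" using qcomp_deg[of r p] qcomp_deg[of r q] by simp
    qed
    show "carrier (direct_sum UNIV H) \<subseteq> ?h ` carrier S" using onto by blast
  qed
  moreover have "?h ` G d = direct_sum_grading H d" for d
  proof (intro equalityI subsetI)
    fix x assume "x \<in> ?h ` G d"
    then obtain p where p: "p \<in> G d" "x = ?h p" by blast
    then have "x e = \<zero>\<^bsub>H e\<^esub>" if "e \<noteq> d" for e
      using S.comp_of_G[OF p(1), of e] that zero_iff[OF S.zero_G, of e] by simp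
    then show "x \<in> direct_sum_grading H d"
      unfolding direct_sum_grading_def using closed p by blast
  next
    fix x assume "x \<in> direct_sum_grading H d"
    then have x: "x \<in> carrier (direct_sum UNIV H)" "\<And>e. e \<noteq> d \<Longrightarrow> x e = \<zero>\<^bsub>H e\<^esub>"
      unfolding direct_sum_grading_def by auto
    obtain p where p: "p \<in> carrier S" "x = ?h p" using onto[OF x(1)] by blast
    have "qcomp R n e p = (\<lambda>_. \<zero>)" if "e \<noteq> d" for e
      using x(2)[OF that] zero_iff[OF comp[OF p(1)], of e] p(2) by simp
    \<comment> \<open>A coefficient outside degree \<open>d\<close> is also a coefficient of a
      component that vanishes.\<close>
    then have "p r = \<zero>" if "(\<Sum>i\<le>n. r i) \<noteq> d" for r
      using qcomp_deg[of r p] that by metis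
    then have "p r = qcomp R n d p r" for r
      unfolding qcomp_def by auto
    then have "p \<in> G d" using comp[OF p(1), of d] by (metis ext)
    then show "x \<in> ?h ` G d" using p(2) by blast
  qed
  ultimately show ?thesis unfolding graded_module_iso_def by blast
qed

end

theorem mainTheorem5:
  fixes R :: "('a, 'r) ring_scheme" and n :: nat
  assumes "cring R" and "n \<ge> 1"
  shows "(\<exists>h. h \<in> graded_module_iso R (qpoly_ring R n) (qpoly_grading R n)
               (direct_sum UNIV (H_twist R n 0)) (direct_sum_grading (H_twist R n 0))) \<and>
         free_of_infinite_rank R (H_twist R n n (- of_nat n - 1))"
proof
  interpret proj_space R n using assms(1) by (simp add: proj_space_def)
  obtain \<phi> where "\<And>m. \<phi> m \<in> module_iso R (laurent R (laurent_exps n {} m)) (H_twist R n 0 m)"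
    using H0_iso[OF assms(2)] by metis
  then show "\<exists>h. h \<in> graded_module_iso R (qpoly_ring R n) (qpoly_grading R n)
      (direct_sum UNIV (H_twist R n 0)) (direct_sum_grading (H_twist R n 0))"
    using graded_iso_direct_sum by blast
  let ?m = "- of_nat n - 1 :: rat"
  let ?B = "{r \<in> laurent_exps n {..n} ?m. \<forall>i\<le>n. r i < 0}"
  obtain \<psi> where \<psi>: "\<psi> \<in> module_iso R (laurent R ?B) (H_twist R n n ?m)"
    using Hn_iso[OF assms(2)] by blast
  \<comment> \<open>The basis is indexed in the type of cohomology classes, as
    \<open>free_of_infinite_rank\<close> demands.\<close>
  let ?e = "\<lambda>r. {exponent_code r}"
  have e: "inj_on ?e ?B" by (rule inj_on_subset[OF inj_exponent_code]) simp
  have "infinite (?e ` ?B)"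
    using top_exps_infinite[OF assms(2)] finite_imageD[OF _ e] by blast
  moreover have "\<exists>k. k \<in> module_iso R (direct_sum (?e ` ?B) (\<lambda>_. self_module R)) (H_twist R n n ?m)"
    using module_iso_comp[OF module_iso_inv[OF laurent_iso_direct_sum[OF e]] \<psi>] by blast
  ultimately show "free_of_infinite_rank R (H_twist R n n ?m)"
    unfolding free_of_infinite_rank_def by blast
qed

end
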